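(* Let $n\ge1$. For each integer $r$ with $1\le r\le (n+1)(n+2)$ there exists $W\in(\mathbb{C}^* )^{4n+4}$ such that $\operatorname{mldeg}(X_{W,n})=r$.
   Context: For $W=(w_{ijk})_{i,j\in\{0,1\},\,0\le k\le n}\in(\mathbb{C}^* )^{4n+4}$, the scaled toric variety $X_{W,n}\subset\mathbb{P}^{4n+3}$ is the image of $\mathbb{P}^1\times\mathbb{P}^1\times\mathbb{P}^n$ under the scaled Segre embedding $([x_0:x_1],[y_0:y_1],[z_0:\dots:z_n])\mapsto[w_{ijk}x_iy_jz_k]_{i,j,k}$. Its maximum likelihood degree $\operatorname{mldeg}(X_{W,n})$ is the number of complex critical points of $\prod p_{ijk}^{u_{ijk}}/(\sum p_{ijk})^{\sum u_{ijk}}$ on $X_{W,n}\setminus\{(\prod p_{ijk})(\sum p_{ijk})=0\}$ for generic data $u=(u_{ijk})$. It is known that $\operatorname{mldeg}(X_{W,n})=(-1)^{n+1}\chi(Y_{W,n})$, where $\chi$ is the topological Euler characteristic and $Y_{W,n}\subset(\mathbb{C}^* )^{n+2}$ is the hypersurface $f_0+\sum_{k=1}^nz_kf_k=0$ with $f_k=w_{00k}+w_{10k}x_1+w_{01k}y_1+w_{11k}x_1y_1$. The number $(n+1)(n+2)$ is the degree of the Segre variety $\mathbb{P}^1\times\mathbb{P}^1\times\mathbb{P}^n\subset\mathbb{P}^{4n+3}$, i.e. of $X_{W,n}$ with all $w_{ijk}=1$. *)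

theory Defs
  imports "HOL-Complex_Analysis.Complex_Analysis"
begin

section \<open>Projective space on a finite set of coordinates\<close>

text \<open>
  A vector of homogeneous coordinates indexed by I is a function that is zero off I, so that
  two vectors are equal iff they agree on I. A point of projective space is the
  equivalence class of its homogeneous coordinate vectors.
\<close>

definition hcoords :: "'i set \<Rightarrow> ('i \<Rightarrow> complex) set" where
  "hcoords I = {p. (\<forall>i. i \<notin> I \<longrightarrow> p i = 0) \<and> (\<exists>i\<in>I. p i \<noteq> 0)}"

definition proportional :: "'i set \<Rightarrow> (('i \<Rightarrow> complex) \<times> ('i \<Rightarrow> complex)) set" where
  "proportional I = {(p, q). p \<in> hcoords I \<and> q \<in> hcoords I \<and> (\<exists>c. c \<noteq> 0 \<and> q = (\<lambda>i. c * p i))}"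

definition proj_space :: "'i set \<Rightarrow> ('i \<Rightarrow> complex) set set" where
  "proj_space I = hcoords I // proportional I"

definition proj_point :: "'i set \<Rightarrow> ('i \<Rightarrow> complex) \<Rightarrow> ('i \<Rightarrow> complex) set" where
  "proj_point I p = proportional I `` {p}"

lemma equiv_proportional: "equiv (hcoords I) (proportional I)"
proof (rule equivI)
  show "proportional I \<subseteq> hcoords I \<times> hcoords I"
    by (auto simp: proportional_def)
  show "refl_on (hcoords I) (proportional I)"
    by (auto simp: refl_on_def proportional_def intro!: exI[of _ 1])
  show "sym (proportional I)"
  proof (rule symI)
    fix p q assume "(p, q) \<in> proportional I"
    then obtain c where "p \<in> hcoords I" "q \<in> hcoords I" "c \<noteq> 0" "q = (\<lambda>i. c * p i)"
      by (auto simp: proportional_def)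
    then show "(q, p) \<in> proportional I"
      by (auto simp: proportional_def intro!: exI[of _ "inverse c"])
  qed
  show "trans (proportional I)"
  proof (rule transI)
    fix p q s assume "(p, q) \<in> proportional I" "(q, s) \<in> proportional I"
    then obtain c d where "p \<in> hcoords I" "s \<in> hcoords I" "c \<noteq> 0" "d \<noteq> 0"
      "q = (\<lambda>i. c * p i)" "s = (\<lambda>i. d * q i)"
      by (auto simp: proportional_def)
    then show "(p, s) \<in> proportional I"
      by (auto simp: proportional_def intro!: exI[of _ "d * c"])
  qed
qed


section \<open>The scaled Segre variety\<close>

definition segre_index :: "nat \<Rightarrow> (nat \<times> nat \<times> nat) set" where
  "segre_index n = {0, 1} \<times> {0, 1} \<times> {0..n}"

definition scaled_segre ::
    "nat \<Rightarrow> (nat \<times> nat \<times> nat \<Rightarrow> complex) \<Rightarrow> (nat \<Rightarrow> complex) \<Rightarrow> (nat \<Rightarrow> complex) \<Rightarrow>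
     (nat \<Rightarrow> complex) \<Rightarrow> nat \<times> nat \<times> nat \<Rightarrow> complex" where
  "scaled_segre n W x y z =
     (\<lambda>(i, j, k). if (i, j, k) \<in> segre_index n then W (i, j, k) * x i * y j * z k else 0)"

definition segre_variety ::
    "nat \<Rightarrow> (nat \<times> nat \<times> nat \<Rightarrow> complex) \<Rightarrow> (nat \<times> nat \<times> nat \<Rightarrow> complex) set set" where
  "segre_variety n W =
     {proj_point (segre_index n) (scaled_segre n W x y z) | x y z.
        x \<in> hcoords {0, 1} \<and> y \<in> hcoords {0, 1} \<and> z \<in> hcoords {0..n}}"

lemma segre_variety_subset:
  assumes "\<forall>i\<in>segre_index n. W i \<noteq> 0"
  shows "segre_variety n W \<subseteq> proj_space (segre_index n)"
proof
  fix P assume "P \<in> segre_variety n W"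
  then obtain x y z where P: "P = proj_point (segre_index n) (scaled_segre n W x y z)"
    and xyz: "x \<in> hcoords {0, 1}" "y \<in> hcoords {0, 1}" "z \<in> hcoords {0..n}"
    by (auto simp: segre_variety_def)
  have nonzero: "\<exists>i\<in>I. p i \<noteq> 0" if "p \<in> hcoords I" for I and p :: "nat \<Rightarrow> complex"
    using that by (simp add: hcoords_def)
  obtain i where i: "i \<in> {0, 1}" "x i \<noteq> 0" using nonzero[OF xyz(1)] ..
  obtain j where j: "j \<in> {0, 1}" "y j \<noteq> 0" using nonzero[OF xyz(2)] ..
  obtain k where k: "k \<in> {0..n}" "z k \<noteq> 0" using nonzero[OF xyz(3)] ..
  note ijk = i j k
  then have mem: "(i, j, k) \<in> segre_index n"
    by (auto simp: segre_index_def)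
  with ijk assms have "scaled_segre n W x y z (i, j, k) \<noteq> 0"
    by (simp add: scaled_segre_def)
  with mem have "\<exists>m\<in>segre_index n. scaled_segre n W x y z m \<noteq> 0"
    by (rule bexI[rotated])
  then have "scaled_segre n W x y z \<in> hcoords (segre_index n)"
    by (simp add: hcoords_def scaled_segre_def split_beta)
  then show "P \<in> proj_space (segre_index n)"
    unfolding P proj_point_def proj_space_def by (rule quotientI)
qed


section \<open>Likelihood function and critical points\<close>

definition likelihood :: "'i set \<Rightarrow> ('i \<Rightarrow> nat) \<Rightarrow> ('i \<Rightarrow> complex) \<Rightarrow> complex" where
  "likelihood I u p = (\<Prod>i\<in>I. p i ^ u i) / (\<Sum>i\<in>I. p i) ^ (\<Sum>i\<in>I. u i)"

lemma likelihood_scale: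
  assumes "c \<noteq> 0"
  shows "likelihood I u (\<lambda>i. c * p i) = likelihood I u p"
proof -
  have "(\<Prod>i\<in>I. c ^ u i) = c ^ (\<Sum>i\<in>I. u i)"
    by (simp add: power_sum)
  with assms show ?thesis
    by (simp add: likelihood_def power_mult_distrib prod.distrib flip: sum_distrib_left)
qed

definition very_affine_part :: "'i set \<Rightarrow> ('i \<Rightarrow> complex) set set \<Rightarrow> ('i \<Rightarrow> complex) set set" where
  "very_affine_part I X = {P \<in> X. \<forall>p\<in>P. (\<Prod>i\<in>I. p i) * (\<Sum>i\<in>I. p i) \<noteq> 0}"

text \<open>
  Critical points on S of a function F given on homogeneous coordinate vectors and constant on
  each projective point: the derivative of F vanishes along every holomorphic arc in S through
  the point. Arcs are given by homogeneous coordinates, so they are arcs in the union of S, the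
  punctured cone over S. When S is a complex submanifold, as it is for the scaled Segre
  varieties, the velocities of such arcs are all the tangent vectors, so this says that the
  differential of the restriction of F to S vanishes.
\<close>

definition critical_points ::
    "'i set \<Rightarrow> ('i \<Rightarrow> complex) set set \<Rightarrow> (('i \<Rightarrow> complex) \<Rightarrow> complex) \<Rightarrow> ('i \<Rightarrow> complex) set set"
  where
  "critical_points I S F = {P \<in> S. \<forall>\<gamma> e. 0 < e \<longrightarrow> \<gamma> 0 \<in> P \<longrightarrow>
      (\<forall>i\<in>I. (\<lambda>t. \<gamma> t i) holomorphic_on ball 0 e) \<longrightarrow>
      (\<forall>t\<in>ball 0 e. \<gamma> t \<in> \<Union> S) \<longrightarrow>
      ((\<lambda>t. F (\<gamma> t)) has_field_derivative 0) (at 0)}"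


section \<open>Generic data\<close>

inductive poly_fun :: "'i set \<Rightarrow> (('i \<Rightarrow> complex) \<Rightarrow> complex) \<Rightarrow> bool" for I where
  const: "poly_fun I (\<lambda>v. c)"
| coord: "i \<in> I \<Longrightarrow> poly_fun I (\<lambda>v. v i)"
| add: "poly_fun I f \<Longrightarrow> poly_fun I g \<Longrightarrow> poly_fun I (\<lambda>v. f v + g v)"
| mult: "poly_fun I f \<Longrightarrow> poly_fun I g \<Longrightarrow> poly_fun I (\<lambda>v. f v * g v)"

text \<open>
  A property of data vectors holds generically if it holds off the zero set of some nonzero
  polynomial. The natural vectors are Zariski dense in the complex ones, so for finite I there
  are always data vectors off such a zero set.
\<close>

definition generic_data :: "'i set \<Rightarrow> (('i \<Rightarrow> nat) \<Rightarrow> bool) \<Rightarrow> bool" where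
  "generic_data I Q \<longleftrightarrow> (\<exists>g. poly_fun I g \<and> (\<exists>v. g v \<noteq> 0) \<and>
     (\<forall>u. g (\<lambda>i. of_nat (u i)) \<noteq> 0 \<longrightarrow> Q u))"

lemma poly_fun_cong:
  assumes "poly_fun I g" "\<And>i. i \<in> I \<Longrightarrow> v i = w i"
  shows "g v = g w"
  using assms by (induction rule: poly_fun.induct) auto

lemma poly_fun_line:
  assumes "poly_fun I g"
  shows "\<exists>q. \<forall>t. g (\<lambda>i. v i + t * w i) = poly q t"
  using assms
proof (induction rule: poly_fun.induct)
  case (const c)
  show ?case by (rule exI[of _ "[:c:]"]) simp
next
  case (coord i)
  show ?case by (rule exI[of _ "[:v i, w i:]"]) simp
next
  case (add f g)
  then obtain q1 q2 where "\<forall>t. f (\<lambda>i. v i + t * w i) = poly q1 t"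
    "\<forall>t. g (\<lambda>i. v i + t * w i) = poly q2 t" by blast
  then show ?case by (intro exI[of _ "q1 + q2"]) simp
next
  case (mult f g)
  then obtain q1 q2 where "\<forall>t. f (\<lambda>i. v i + t * w i) = poly q1 t"
    "\<forall>t. g (\<lambda>i. v i + t * w i) = poly q2 t" by blast
  then show ?case by (intro exI[of _ "q1 * q2"]) simp
qed

lemma poly_fun_mult_nonzero:
  assumes "poly_fun I g" "poly_fun I h" "g v \<noteq> 0" "h w \<noteq> 0"
  shows "\<exists>v. g v * h v \<noteq> 0"
proof -
  obtain q1 where q1: "\<And>t. g (\<lambda>i. v i + t * (w i - v i)) = poly q1 t"
    using poly_fun_line[OF assms(1), of v "\<lambda>i. w i - v i"] by blast
  obtain q2 where q2: "\<And>t. h (\<lambda>i. v i + t * (w i - v i)) = poly q2 t"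
    using poly_fun_line[OF assms(2), of v "\<lambda>i. w i - v i"] by blast
  have "poly q1 0 = g v" "poly q2 1 = h w"
    using q1[of 0] q2[of 1] by simp_all
  with assms(3,4) have "q1 \<noteq> 0" "q2 \<noteq> 0" by auto
  then have "finite {t. poly (q1 * q2) t = 0}"
    by (intro poly_roots_finite) auto
  then obtain t where "t \<notin> {t. poly (q1 * q2) t = 0}"
    using ex_new_if_finite[OF infinite_UNIV_char_0] by blast
  then have "poly q1 t * poly q2 t \<noteq> 0"
    by simp
  then have "g (\<lambda>i. v i + t * (w i - v i)) * h (\<lambda>i. v i + t * (w i - v i)) \<noteq> 0"
    by (simp only: q1 q2 not_False_eq_True)
  then show ?thesis
    by (rule exI[where P = "\<lambda>v. g v * h v \<noteq> 0"])
qed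

lemma poly_fun_nonzero_nat:
  fixes I :: "'i set"
  assumes "finite I" "poly_fun I g" "g v \<noteq> 0"
  shows "\<exists>u :: 'i \<Rightarrow> nat. g (\<lambda>i. of_nat (u i)) \<noteq> 0"
proof -
  have "\<exists>v. g v \<noteq> 0 \<and> (\<forall>i\<in>J. v i \<in> \<nat>)" if "finite J" for J
    using that
  proof (induction J)
    case empty
    show ?case using assms(3) by auto
  next
    case (insert j J)
    then obtain v where v: "g v \<noteq> 0" "\<forall>i\<in>J. v i \<in> \<nat>" by blast
    obtain q where q: "\<And>t. g (\<lambda>i. (v(j := 0)) i + t * (if i = j then 1 else 0)) = poly q t"
      using poly_fun_line[OF assms(2), of "v(j := 0)" "\<lambda>i. if i = j then 1 else 0"] by blast
    have upd: "(\<lambda>i. (v(j := 0)) i + t * (if i = j then 1 else 0)) = v(j := t)" for t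
      by auto
    have qt: "g (v(j := t)) = poly q t" for t
      using q[of t] unfolding upd .
    from qt[of "v j"] v(1) have "q \<noteq> 0" by auto
    then have "finite {t. poly q t = 0}" by (rule poly_roots_finite)
    moreover have "infinite (\<nat> :: complex set)"
      by (simp add: Nats_def range_inj_infinite inj_of_nat)
    ultimately have "infinite (\<nat> - {t. poly q t = 0})"
      by (simp add: Diff_infinite_finite)
    then have "\<nat> - {t. poly q t = 0} \<noteq> {}"
      using finite.emptyI by fastforce
    then obtain t where "t \<in> \<nat>" "poly q t \<noteq> 0"
      by blast
    then have "g (v(j := t)) \<noteq> 0" by (simp add: qt)
    moreover have "\<forall>i\<in>insert j J. (v(j := t)) i \<in> \<nat>" using v(2) \<open>t \<in> \<nat>\<close> by auto
    ultimately show ?case by blast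
  qed
  from this[OF assms(1)] obtain w where w: "g w \<noteq> 0" "\<forall>i\<in>I. w i \<in> \<nat>" by blast
  then have "\<forall>i\<in>I. \<exists>m::nat. w i = of_nat m" by (auto elim: Nats_cases)
  then obtain u :: "'i \<Rightarrow> nat" where u: "\<forall>i\<in>I. w i = of_nat (u i)" by metis
  have "g (\<lambda>i. of_nat (u i)) = g w"
    by (rule poly_fun_cong[OF assms(2)]) (use u in simp)
  with w(1) have "g (\<lambda>i. of_nat (u i)) \<noteq> 0" by (simp only: not_False_eq_True)
  then show ?thesis
    by (rule exI[where P = "\<lambda>u. g (\<lambda>i. of_nat (u i)) \<noteq> 0"])
qed

lemma generic_data_conj_ex:
  fixes I :: "'i set"
  assumes "finite I" "generic_data I P" "generic_data I Q"
  shows "\<exists>u. P u \<and> Q u"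
proof -
  obtain g v where g: "poly_fun I g" "g v \<noteq> 0" "\<And>u. g (\<lambda>i. of_nat (u i)) \<noteq> 0 \<Longrightarrow> P u"
    using assms(2) by (auto simp: generic_data_def)
  obtain h w where h: "poly_fun I h" "h w \<noteq> 0" "\<And>u. h (\<lambda>i. of_nat (u i)) \<noteq> 0 \<Longrightarrow> Q u"
    using assms(3) by (auto simp: generic_data_def)
  have "\<exists>x. g x * h x \<noteq> 0"
    using poly_fun_mult_nonzero[where g = g and h = h and v = v and w = w, OF g(1) h(1) g(2) h(2)] .
  then obtain x where x: "g x * h x \<noteq> 0" ..
  have "\<exists>u :: 'i \<Rightarrow> nat. g (\<lambda>i. of_nat (u i)) * h (\<lambda>i. of_nat (u i)) \<noteq> 0"
    using poly_fun_nonzero_nat[where g = "\<lambda>v. g v * h v" and v = x, OF assms(1)]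
      poly_fun.mult[OF g(1) h(1)] x by simp
  then obtain u :: "'i \<Rightarrow> nat" where
    "g (\<lambda>i. of_nat (u i)) * h (\<lambda>i. of_nat (u i)) \<noteq> 0" ..
  then show ?thesis using g(3) h(3) by auto
qed


section \<open>The maximum likelihood degree\<close>

text \<open>
  A relation rather than a function, so that asserting it includes that the number of critical
  points is finite and constant for generic data; the value is unique.
\<close>

definition has_mldeg :: "nat \<Rightarrow> (nat \<times> nat \<times> nat \<Rightarrow> complex) \<Rightarrow> nat \<Rightarrow> bool" where
  "has_mldeg n W d \<longleftrightarrow>
     (let I = segre_index n; S = very_affine_part I (segre_variety n W) in
      generic_data I (\<lambda>u. finite (critical_points I S (likelihood I u)) \<and>
                          card (critical_points I S (likelihood I u)) = d))"

lemma has_mldeg_unique: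
  assumes "has_mldeg n W d" "has_mldeg n W d'"
  shows "d = d'"
proof -
  have "finite (segre_index n)" by (simp add: segre_index_def)
  from generic_data_conj_ex[OF this assms[unfolded has_mldeg_def Let_def]]
  show ?thesis by auto
qed

end

theory Submission
  imports Defs
    "Subresultants.Subresultant_Gcd"
    "Jordan_Normal_Form.Column_Operations"
    "HOL-Computational_Algebra.Field_as_Ring"
    "HOL-Computational_Algebra.Fundamental_Theorem_Algebra"
begin

text \<open>
  On the very affine part the score equations let one eliminate the coordinates
  \<open>z k = c k / f k (x, y)\<close>, leaving the critical equations of
  \<open>x powr -a * y powr -b * (\<Prod>k. f k powr c k)\<close> in the two variables \<open>x, y\<close>, where
  \<open>a, b, c\<close> are the marginals of the data. For irreducible \<open>f k\<close> the curve \<open>f k = 0\<close> is a graph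
  \<open>y = \<phi> k x\<close> of a Moebius transformation, and for fixed \<open>x\<close> the functions \<open>1 / (y - \<phi> k x)\<close> on
  the solutions of the \<open>y\<close>-equation satisfy a linear system whose matrix has simple poles with
  residues of rank one where two of the points \<open>0\<close>, \<open>\<infinity>\<close>, \<open>\<phi> k x\<close> collide. Factoring the residues
  turns the system into a linear pencil of size the number of collisions, and the solutions
  correspond to the roots \<open>x\<close> of its determinant. When the data degenerate to \<open>a = 1, b = c = 0\<close>
  the roots become the collisions themselves, so for generic data the ML degree is the number of
  collisions at \<open>x \<noteq> 0, \<infinity>\<close>, provided these are distinct.

  With \<open>m\<close> curves in general position there are \<open>m * (m + 1)\<close> collisions, and each coincidence
  \<open>\<phi> k 0 = \<phi> l 0\<close> or \<open>\<phi> k \<infinity> = \<phi> l \<infinity>\<close> removes one of them. Sums of triangular numbers then give all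
  degrees but 1, 3 and 7, which need separate curves.
\<close>

section \<open>Generic properties of polynomial families\<close>

text \<open>A generic statement needs one data vector where a polynomial in the data is nonzero, but
  at honest data the critical points cannot be computed. At the degenerate data the score equations
  themselves are meaningless, whereas the determinant of the pencil is still polynomial in the data
  and factors there. The price is that its roots then sit exactly at the collisions, where the
  correspondence with solutions breaks down, so a first-order perturbation has to show that they
  move away. Simplicity of the roots is used twice: it gives the count, and it makes the kernels
  one-dimensional, so that \<open>x\<close> determines \<open>y\<close>. In the other direction a
  kernel vector need not come from a value of \<open>y\<close> at once; the eigenspace that it spans
  does contain a vector that does. Coincidences at \<open>0\<close> and \<open>\<infinity>\<close>
  alone leave at least \<open>2 * m\<close> of the \<open>m * (m + 1)\<close> collisions. Hence 1 is
  out of reach, 3 would need \<open>m = 1\<close>, which gives only 2, and 7 would need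
  \<open>m = 3\<close>, where a deficit of 5 is not a sum of two numbers among 0, 1, 3.\<close>

lemma poly_fun_uminus: "poly_fun I f \<Longrightarrow> poly_fun I (\<lambda>v. - f v)"
  using poly_fun.mult[OF poly_fun.const[of I "-1"]] by simp

lemma poly_fun_diff: "poly_fun I f \<Longrightarrow> poly_fun I g \<Longrightarrow> poly_fun I (\<lambda>v. f v - g v)"
  using poly_fun.add[OF _ poly_fun_uminus] by simp

lemma poly_fun_sum: "(\<And>i. i \<in> A \<Longrightarrow> poly_fun I (f i)) \<Longrightarrow> poly_fun I (\<lambda>v. \<Sum>i\<in>A. f i v)"
  by (induction A rule: infinite_finite_induct) (auto intro: poly_fun.intros)

lemma poly_fun_prod: "(\<And>i. i \<in> A \<Longrightarrow> poly_fun I (f i)) \<Longrightarrow> poly_fun I (\<lambda>v. \<Prod>i\<in>A. f i v)"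
  by (induction A rule: infinite_finite_induct) (auto intro: poly_fun.intros)

lemma poly_fun_if: "(c \<Longrightarrow> poly_fun I f) \<Longrightarrow> (\<not> c \<Longrightarrow> poly_fun I g) \<Longrightarrow> poly_fun I (\<lambda>v. if c then f v else g v)"
  by (cases c) simp_all

lemmas poly_fun_intros = poly_fun.intros poly_fun_uminus poly_fun_diff poly_fun_sum poly_fun_prod
  poly_fun_if

text \<open>Ranges over complex vectors and not only natural ones, so that test vectors may have
  negative entries.\<close>

definition generic :: "'i set \<Rightarrow> (('i \<Rightarrow> complex) \<Rightarrow> bool) \<Rightarrow> bool" where
  "generic I Q \<longleftrightarrow> (\<exists>g. poly_fun I g \<and> (\<exists>v. g v \<noteq> 0) \<and> (\<forall>v. g v \<noteq> 0 \<longrightarrow> Q v))"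

lemma generic_nonzero: "poly_fun I g \<Longrightarrow> g v \<noteq> 0 \<Longrightarrow> generic I (\<lambda>v. g v \<noteq> 0)"
  unfolding generic_def by blast

lemma generic_mono: "generic I Q \<Longrightarrow> (\<And>v. Q v \<Longrightarrow> Q' v) \<Longrightarrow> generic I Q'"
  unfolding generic_def by meson

lemma generic_True: "generic I (\<lambda>v. True)"
  unfolding generic_def by (intro exI[of _ "\<lambda>v. 1"]) (auto intro: poly_fun.const)

lemma generic_conj:
  assumes "generic I P" "generic I Q"
  shows "generic I (\<lambda>v. P v \<and> Q v)"
proof -
  obtain g v where g: "poly_fun I g" "g v \<noteq> 0" "\<And>v. g v \<noteq> 0 \<Longrightarrow> P v"
    using assms(1) unfolding generic_def by blast
  obtain h w where h: "poly_fun I h" "h w \<noteq> 0" "\<And>v. h v \<noteq> 0 \<Longrightarrow> Q v"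
    using assms(2) unfolding generic_def by blast
  show ?thesis
    unfolding generic_def
  proof (intro exI[of _ "\<lambda>v. g v * h v"] conjI allI impI)
    show "poly_fun I (\<lambda>v. g v * h v)" by (intro poly_fun_intros g h)
    show "\<exists>v. g v * h v \<noteq> 0" by (rule poly_fun_mult_nonzero[where g = g and h = h, OF g(1) h(1) g(2) h(2)])
  qed (use g(3) h(3) in auto)
qed

lemma generic_ball:
  assumes "finite A" "\<And>a. a \<in> A \<Longrightarrow> generic I (P a)"
  shows "generic I (\<lambda>v. \<forall>a\<in>A. P a v)"
  using assms
proof (induction A)
  case empty
  show ?case by (simp add: generic_True)
next
  case (insert a A)
  have "generic I (\<lambda>v. P a v \<and> (\<forall>a\<in>A. P a v))"
    by (intro generic_conj insert) auto
  then show ?case by simp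
qed

lemma generic_data_of_generic:
  assumes "generic I Q" shows "generic_data I (\<lambda>u. Q (\<lambda>i. of_nat (u i)))"
  using assms unfolding generic_def generic_data_def by blast

section \<open>Polynomials in one variable whose coefficients are polynomial in the data\<close>

definition poly_coeffs_fun :: "'i set \<Rightarrow> (('i \<Rightarrow> complex) \<Rightarrow> complex poly) \<Rightarrow> bool" where
  "poly_coeffs_fun I F \<longleftrightarrow> (\<forall>k. poly_fun I (\<lambda>v. coeff (F v) k))"

lemma poly_coeffs_fun_const: "poly_coeffs_fun I (\<lambda>v. p)"
  by (simp add: poly_coeffs_fun_def poly_fun_intros)

lemma poly_coeffs_fun_pCons:
  "poly_fun I f \<Longrightarrow> poly_coeffs_fun I F \<Longrightarrow> poly_coeffs_fun I (\<lambda>v. pCons (f v) (F v))"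
  unfolding poly_coeffs_fun_def
proof (intro allI)
  fix k assume "poly_fun I f" "\<forall>k. poly_fun I (\<lambda>v. coeff (F v) k)"
  then show "poly_fun I (\<lambda>v. coeff (pCons (f v) (F v)) k)" by (cases k) auto
qed

lemma poly_coeffs_fun_add:
  "poly_coeffs_fun I F \<Longrightarrow> poly_coeffs_fun I G \<Longrightarrow> poly_coeffs_fun I (\<lambda>v. F v + G v)"
  by (simp add: poly_coeffs_fun_def poly_fun_intros)

lemma poly_coeffs_fun_mult:
  "poly_coeffs_fun I F \<Longrightarrow> poly_coeffs_fun I G \<Longrightarrow> poly_coeffs_fun I (\<lambda>v. F v * G v)"
  unfolding poly_coeffs_fun_def coeff_mult by (intro allI poly_fun_intros) auto

lemma poly_coeffs_fun_sum:
  "(\<And>i. i \<in> A \<Longrightarrow> poly_coeffs_fun I (F i)) \<Longrightarrow> poly_coeffs_fun I (\<lambda>v. \<Sum>i\<in>A. F i v)"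
  by (induction A rule: infinite_finite_induct)
    (auto intro: poly_coeffs_fun_const poly_coeffs_fun_add)

lemma poly_coeffs_fun_prod:
  "(\<And>i. i \<in> A \<Longrightarrow> poly_coeffs_fun I (F i)) \<Longrightarrow> poly_coeffs_fun I (\<lambda>v. \<Prod>i\<in>A. F i v)"
  by (induction A rule: infinite_finite_induct)
    (auto intro: poly_coeffs_fun_const poly_coeffs_fun_mult)

lemma poly_coeffs_fun_if:
  "(c \<Longrightarrow> poly_coeffs_fun I F) \<Longrightarrow> (\<not> c \<Longrightarrow> poly_coeffs_fun I G) \<Longrightarrow>
    poly_coeffs_fun I (\<lambda>v. if c then F v else G v)"
  by (cases c) simp_all

lemmas poly_coeffs_fun_intros = poly_coeffs_fun_const poly_coeffs_fun_pCons poly_coeffs_fun_add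
  poly_coeffs_fun_mult poly_coeffs_fun_sum poly_coeffs_fun_prod poly_coeffs_fun_if

text \<open>A degree bound uniform in \<open>v\<close> turns the evaluation into one fixed finite
  sum of coefficients.\<close>

lemma poly_coeffs_fun_poly:
  assumes "poly_coeffs_fun I F" "\<And>v. degree (F v) \<le> d"
  shows "poly_fun I (\<lambda>v. poly (F v) x)"
proof -
  have "poly (F v) x = (\<Sum>k\<le>d. coeff (F v) k * x ^ k)" for v
    unfolding poly_altdef using assms(2)[of v]
    by (intro sum.mono_neutral_left) (auto simp: coeff_eq_0)
  then show ?thesis
    using assms(1) by (auto simp: poly_coeffs_fun_def intro!: poly_fun_intros)
qed

section \<open>Determinants with polynomial entries\<close>

lemma det_mat_Leibniz:
  "Determinant.det (Matrix.mat n n (\<lambda>(i, j). A i j)) =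
    (\<Sum>p | p permutes {0..<n}. signof p * (\<Prod>i = 0..<n. A i (p i)))"
  by (subst det_def'[of _ n]) (auto intro!: sum.cong prod.cong simp: permutes_in_image)

lemma poly_fun_det:
  assumes "\<And>i j. i < n \<Longrightarrow> j < n \<Longrightarrow> poly_fun I (\<lambda>v. A v i j)"
  shows "poly_fun I (\<lambda>v. Determinant.det (Matrix.mat n n (\<lambda>(i, j). A v i j)))"
  unfolding det_mat_Leibniz
  by (intro poly_fun_intros assms) (auto simp: permutes_in_image)

lemma poly_coeffs_fun_det:
  assumes "\<And>i j. i < n \<Longrightarrow> j < n \<Longrightarrow> poly_coeffs_fun I (\<lambda>v. A v i j)"
  shows "poly_coeffs_fun I (\<lambda>v. Determinant.det (Matrix.mat n n (\<lambda>(i, j). A v i j)))"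
  unfolding det_mat_Leibniz
  by (intro poly_coeffs_fun_intros assms) (auto simp: permutes_in_image)

lemma degree_det_le:
  fixes A :: "nat \<Rightarrow> nat \<Rightarrow> complex poly"
  assumes "\<And>i j. i < n \<Longrightarrow> j < n \<Longrightarrow> degree (A i j) \<le> w i"
  shows "degree (Determinant.det (Matrix.mat n n (\<lambda>(i, j). A i j))) \<le> (\<Sum>i = 0..<n. w i)"
  unfolding det_mat_Leibniz
proof (intro degree_sum_le)
  show "finite {p. p permutes {0..<n}}" by (simp add: finite_permutations)
  fix p assume p: "p \<in> {p. p permutes {0..<n}}"
  have "degree (signof p * (\<Prod>i = 0..<n. A i (p i))) \<le> degree (\<Prod>i = 0..<n. A i (p i))"
    by (simp add: sign_def)
  also have "\<dots> \<le> (\<Sum>i = 0..<n. degree (A i (p i)))"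
    using degree_prod_sum_le[of "{0..<n}" "\<lambda>i. A i (p i)"] by simp
  also have "\<dots> \<le> (\<Sum>i = 0..<n. w i)"
    using p by (intro sum_mono assms) (auto simp: permutes_in_image)
  finally show "degree (signof p * (\<Prod>i = 0..<n. A i (p i))) \<le> (\<Sum>i = 0..<n. w i)" .
qed

lemma poly_det:
  "poly (Determinant.det (Matrix.mat n n (\<lambda>(i, j). A i j))) (x :: complex) =
    Determinant.det (Matrix.mat n n (\<lambda>(i, j). poly (A i j) x))"
  unfolding det_mat_Leibniz by (simp add: poly_sum poly_prod sign_def)

text \<open>A permutation that fixes every index but \<open>i\<close> fixes \<open>i\<close> too, so
  only the identity contributes and row \<open>i\<close> may be arbitrary. With \<open>i = n\<close>
  no row is exceptional and the matrix is diagonal.\<close>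

lemma det_diagonal_except_row:
  assumes "\<And>k j. k < n \<Longrightarrow> j < n \<Longrightarrow> k \<noteq> i \<Longrightarrow> k \<noteq> j \<Longrightarrow> A k j = (0 :: 'a :: idom)"
  shows "Determinant.det (Matrix.mat n n (\<lambda>(i, j). A i j)) = (\<Prod>k = 0..<n. A k k)"
proof -
  have "signof p * (\<Prod>k = 0..<n. A k (p k)) = 0"
    if p: "p permutes {0..<n}" and "p \<noteq> id" for p
  proof -
    have "\<exists>k. k < n \<and> k \<noteq> i \<and> p k \<noteq> k"
    proof (rule ccontr)
      assume "\<not> (\<exists>k. k < n \<and> k \<noteq> i \<and> p k \<noteq> k)"
      then have *: "p k = k" if "k \<noteq> i" for k
        using that permutes_not_in[OF p, of k] by (cases "k < n") auto
      have "p i = i"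
        using *[of "p i"] permutes_inj[OF p] by (auto simp: inj_eq)
      with * have "p = id" by (metis eq_id_iff)
      with \<open>p \<noteq> id\<close> show False by simp
    qed
    then obtain k where k: "k < n" "k \<noteq> i" "p k \<noteq> k" by blast
    then have "A k (p k) = 0"
      using assms[of k "p k"] permutes_in_image[OF p, of k] by auto
    with k have "(\<Prod>k = 0..<n. A k (p k)) = 0" by auto
    then show ?thesis by simp
  qed
  then have "Determinant.det (Matrix.mat n n (\<lambda>(i, j). A i j)) =
      (\<Sum>p\<in>{id}. signof p * (\<Prod>k = 0..<n. A k (p k)))"
    unfolding det_mat_Leibniz
    by (intro sum.mono_neutral_right) (auto simp: finite_permutations permutes_id)
  then show ?thesis by (simp add: sign_id)
qed

section \<open>Simple roots as a generic property\<close>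

lemma rsquarefree_prod_linear:
  fixes A :: "complex set"
  assumes "finite A" "c \<noteq> 0"
  shows "rsquarefree (Polynomial.smult c (\<Prod>a\<in>A. [:- a, 1:]))"
  unfolding rsquarefree_roots
proof (intro allI notI)
  fix a assume *: "poly (Polynomial.smult c (\<Prod>a\<in>A. [:- a, 1:])) a = 0 \<and>
    poly (pderiv (Polynomial.smult c (\<Prod>a\<in>A. [:- a, 1:]))) a = 0"
  then have "a \<in> A" using assms by (auto simp: poly_prod)
  define q where "q = (\<Prod>a\<in>A - {a}. [:- a, 1:])"
  have "(\<Prod>a\<in>A. [:- a, 1:]) = [:- a, 1:] * q"
    unfolding q_def using \<open>a \<in> A\<close> assms(1) by (simp add: prod.remove)
  then have "poly (pderiv (Polynomial.smult c (\<Prod>a\<in>A. [:- a, 1:]))) a = c * poly q a"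
    by (simp add: pderiv_smult pderiv_mult pderiv_pCons del: mult_pCons_left)
  moreover have "poly q a \<noteq> 0" unfolding q_def using assms(1) by (auto simp: poly_prod)
  ultimately show False using * assms(2) by simp
qed

lemma card_roots_rsquarefree:
  fixes p :: "complex poly"
  assumes "rsquarefree p"
  shows "card {x. poly p x = 0} = degree p"
proof -
  have "p \<noteq> 0" using assms by (simp add: rsquarefree_def)
  have "degree p = degree (\<Prod>z | poly p z = 0. [:- z, 1:])"
    using complex_poly_decompose_rsquarefree[OF assms] \<open>p \<noteq> 0\<close>
    by (metis degree_smult_eq leading_coeff_0_iff)
  also have "\<dots> = (\<Sum>z | poly p z = 0. degree [:- z, 1:])"
    by (rule degree_prod_eq_sum_degree) auto
  finally show ?thesis by simp
qed

text \<open>The test polynomial is the coefficient at \<open>d\<close> times the resultant of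
  \<open>F v\<close> and its derivative. The Sylvester matrix has the fixed format \<open>d\<close>,
  \<open>d - 1\<close>, so its determinant is polynomial in the data even where the degree drops;
  where the coefficient at \<open>d\<close> is nonzero it is the true resultant.\<close>

lemma generic_rsquarefree:
  assumes F: "poly_coeffs_fun I F" "\<And>v. degree (F v) \<le> d"
    and v0: "degree (F v0) = d" "rsquarefree (F v0)" "0 < d"
  shows "generic I (\<lambda>v. degree (F v) = d \<and> rsquarefree (F v))"
proof -
  define g where "g = (\<lambda>v. coeff (F v) d * resultant_sub d (d - 1) (F v) (pderiv (F v)))"
  have *: "g v \<noteq> 0 \<longleftrightarrow> degree (F v) = d \<and> rsquarefree (F v)" for v
  proof (cases "coeff (F v) d = 0")
    case True
    then show ?thesis using v0(3)
      by (auto simp: g_def)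
  next
    case False
    then have deg: "degree (F v) = d" using F(2)[of v] le_degree by (metis order_antisym)
    have "F v \<noteq> 0" using False by auto
    have "resultant_sub d (d - 1) (F v) (pderiv (F v)) = resultant (F v) (pderiv (F v))"
      unfolding resultant_sub by (simp add: degree_pderiv deg)
    then have "g v \<noteq> 0 \<longleftrightarrow> degree (gcd (F v) (pderiv (F v))) = 0"
      using False by (simp add: g_def resultant_0_gcd)
    also have "\<dots> \<longleftrightarrow> (\<forall>x. poly (gcd (F v) (pderiv (F v))) x \<noteq> 0)"
    proof
      assume "degree (gcd (F v) (pderiv (F v))) = 0"
      then obtain c where "gcd (F v) (pderiv (F v)) = [:c:]" by (elim degree_eq_zeroE)
      then show "\<forall>x. poly (gcd (F v) (pderiv (F v))) x \<noteq> 0"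
        using \<open>F v \<noteq> 0\<close> by (metis gcd_eq_0_iff pCons_0_0 poly_const_conv)
    next
      assume "\<forall>x. poly (gcd (F v) (pderiv (F v))) x \<noteq> 0"
      then show "degree (gcd (F v) (pderiv (F v))) = 0"
        using fundamental_theorem_of_algebra constant_degree by blast
    qed
    also have "\<dots> \<longleftrightarrow> rsquarefree (F v)"
      unfolding rsquarefree_roots poly_eq_0_iff_dvd by (simp add: gcd_greatest_iff)
    finally show ?thesis using deg by simp
  qed
  have "poly_fun I g"
    using F(1) unfolding g_def resultant_sub_def sylvester_mat_sub_def poly_coeffs_fun_def
    by (auto intro!: poly_fun_intros poly_fun_det simp: coeff_pderiv)
  moreover have "g v0 \<noteq> 0" using * v0 by simp
  ultimately show ?thesis using generic_nonzero[of I g v0] by (simp add: *)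
qed

section \<open>Linear pencils\<close>

lemma det_dvd_col:
  fixes A :: "nat \<Rightarrow> nat \<Rightarrow> 'a :: idom"
  assumes "k < n" "\<And>i. i < n \<Longrightarrow> A i k = d * c i"
  shows "Determinant.det (Matrix.mat n n (\<lambda>(i, j). A i j)) =
    d * Determinant.det (Matrix.mat n n (\<lambda>(i, j). if j = k then c i else A i j))"
proof -
  let ?B = "Matrix.mat n n (\<lambda>(i, j). if j = k then c i else A i j)"
  have "Determinant.det (Matrix.mat n n (\<lambda>(i, j). A i j)) = Determinant.det (multcol k d ?B)"
    using assms by (intro arg_cong[of _ _ Determinant.det] eq_matI) auto
  also have "Determinant.det (multcol k d ?B) = Determinant.det (?B * multrow_mat n k d)"
    by (subst multcol_mat[of ?B n n]) auto
  also have "\<dots> = Determinant.det ?B * Determinant.det (multrow_mat n k d)"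
    by (rule det_mult) auto
  finally show ?thesis using assms(1) by (simp add: det_multrow_mat)
qed

text \<open>By Cramer's rule, replacing column \<open>i0\<close> by \<open>A \<xi>\<close> and then
  column \<open>i1\<close> by \<open>A \<eta>\<close> multiplies the determinant by the nonzero
  constants \<open>\<xi> i0\<close> and \<open>\<eta> i1\<close>. Both new columns vanish at
  \<open>x\<close>, which yields two linear factors. The normalisation \<open>\<eta> i0 = 0\<close>
  keeps the column already replaced out of the second combination.\<close>

lemma double_root_det:
  fixes A :: "nat \<Rightarrow> nat \<Rightarrow> complex poly"
  assumes ij: "i0 < n" "i1 < n" "\<xi> i0 \<noteq> 0" "\<eta> i0 = 0" "\<eta> i1 \<noteq> 0"
    and ker: "\<And>i. i < n \<Longrightarrow> (\<Sum>j = 0..<n. poly (A i j) x * \<xi> j) = 0"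
      "\<And>i. i < n \<Longrightarrow> (\<Sum>j = 0..<n. poly (A i j) x * \<eta> j) = 0"
  shows "[:- x, 1:]\<^sup>2 dvd Determinant.det (Matrix.mat n n (\<lambda>(i, j). A i j))"
proof -
  let ?L = "[:- x, 1:]"
  have ne: "i0 \<noteq> i1" using ij by auto
  define M where "M = Matrix.mat n n (\<lambda>(i, j). A i j)"
  define a where "a i = (\<Sum>j = 0..<n. A i j * [:\<xi> j:])" for i
  define b where "b i = (\<Sum>j = 0..<n. A i j * [:\<eta> j:])" for i
  define B where "B i j = (if j = i0 then a i else A i j)" for i j
  have "\<exists>c. i < n \<longrightarrow> a i = ?L * c" for i
  proof (cases "i < n")
    case True
    then have "poly (a i) x = 0" using ker(1) by (simp add: a_def poly_sum mult.commute)
    then show ?thesis unfolding poly_eq_0_iff_dvd by (metis dvdE)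
  qed simp
  then obtain ca where ca: "\<And>i. i < n \<Longrightarrow> a i = ?L * ca i" by metis
  have "\<exists>c. i < n \<longrightarrow> b i = ?L * c" for i
  proof (cases "i < n")
    case True
    then have "poly (b i) x = 0" using ker(2) by (simp add: b_def poly_sum mult.commute)
    then show ?thesis unfolding poly_eq_0_iff_dvd by (metis dvdE)
  qed simp
  then obtain cb where cb: "\<And>i. i < n \<Longrightarrow> b i = ?L * cb i" by metis
  have M: "M \<in> carrier_mat n n" by (simp add: M_def)
  have "Determinant.det (replace_col M (M *\<^sub>v Matrix.vec n (\<lambda>j. [:\<xi> j:])) i0) = [:\<xi> i0:] * Determinant.det M"
    using cramer_lemma_mat[OF M _ ij(1), of "Matrix.vec n (\<lambda>j. [:\<xi> j:])"] ij(1) by simp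
  moreover have "replace_col M (M *\<^sub>v Matrix.vec n (\<lambda>j. [:\<xi> j:])) i0 = Matrix.mat n n (\<lambda>(i, j). B i j)"
    by (auto simp: replace_col_def M_def B_def a_def scalar_prod_def intro!: eq_matI sum.cong)
  ultimately have 1: "Determinant.det (Matrix.mat n n (\<lambda>(i, j). B i j)) = [:\<xi> i0:] * Determinant.det M"
    by simp
  define N where "N = Matrix.mat n n (\<lambda>(i, j). B i j)"
  define C where "C i j = (if j = i1 then b i else B i j)" for i j
  have N: "N \<in> carrier_mat n n" by (simp add: N_def)
  have "Determinant.det (replace_col N (N *\<^sub>v Matrix.vec n (\<lambda>j. [:\<eta> j:])) i1) = [:\<eta> i1:] * Determinant.det N"
    using cramer_lemma_mat[OF N _ ij(2), of "Matrix.vec n (\<lambda>j. [:\<eta> j:])"] ij(2) by simp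
  moreover have "replace_col N (N *\<^sub>v Matrix.vec n (\<lambda>j. [:\<eta> j:])) i1 = Matrix.mat n n (\<lambda>(i, j). C i j)"
    using ij(4)
    by (auto simp: replace_col_def N_def C_def B_def b_def scalar_prod_def intro!: eq_matI sum.cong)
  ultimately have 2: "Determinant.det (Matrix.mat n n (\<lambda>(i, j). C i j)) = [:\<eta> i1:] * Determinant.det N"
    by simp
  have "Determinant.det (Matrix.mat n n (\<lambda>(i, j). C i j)) =
      ?L * Determinant.det (Matrix.mat n n (\<lambda>(i, j). if j = i1 then cb i else C i j))"
    using ij(2) cb by (intro det_dvd_col) (auto simp: C_def)
  also have "Determinant.det (Matrix.mat n n (\<lambda>(i, j). if j = i1 then cb i else C i j)) =
      ?L * Determinant.det (Matrix.mat n n (\<lambda>(i, j). if j = i0 then ca i else if j = i1 then cb i else C i j))"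
    using ij(1) ca ne by (intro det_dvd_col) (auto simp: C_def B_def)
  finally have "[:\<eta> i1:] * ([:\<xi> i0:] * Determinant.det M) = ?L\<^sup>2 *
      Determinant.det (Matrix.mat n n (\<lambda>(i, j). if j = i0 then ca i else if j = i1 then cb i else C i j))"
    unfolding 2 N_def 1 by (simp only: power2_eq_square mult.assoc)
  then have "?L\<^sup>2 dvd [:\<eta> i1:] * ([:\<xi> i0:] * Determinant.det M)"
    by (rule dvdI)
  then have "?L\<^sup>2 dvd Polynomial.smult (\<eta> i1 * \<xi> i0) (Determinant.det M)"
    by (simp add: mult.commute)
  then show ?thesis
    using ij unfolding M_def by (simp add: dvd_smult_iff)
qed

text \<open>
  The kernel condition at the point \<open>x\<close> for the matrix with the rows \<open>a * (x - \<rho> i) * I - x * G\<close> for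
  \<open>i \<notin> J0\<close> and \<open>a * I - G\<close> for \<open>i \<in> J0\<close>.
\<close>

definition pencil_kernel ::
    "'j set \<Rightarrow> 'j set \<Rightarrow> ('j \<Rightarrow> complex) \<Rightarrow> complex \<Rightarrow> ('j \<Rightarrow> 'j \<Rightarrow> complex) \<Rightarrow> complex \<Rightarrow> ('j \<Rightarrow> complex) \<Rightarrow> bool"
  where
  "pencil_kernel J J0 \<rho> a G x \<xi> \<longleftrightarrow>
    (\<forall>i\<in>J. if i \<in> J0 then a * \<xi> i = (\<Sum>j\<in>J. G i j * \<xi> j)
           else a * (x - \<rho> i) * \<xi> i = x * (\<Sum>j\<in>J. G i j * \<xi> j))"

definition pencil_roots ::
    "'j set \<Rightarrow> 'j set \<Rightarrow> ('j \<Rightarrow> complex) \<Rightarrow> complex \<Rightarrow> ('j \<Rightarrow> 'j \<Rightarrow> complex) \<Rightarrow> complex set"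
  where
  "pencil_roots J J0 \<rho> a G = {x. \<exists>\<xi>. pencil_kernel J J0 \<rho> a G x \<xi> \<and> (\<exists>i\<in>J. \<xi> i \<noteq> 0)}"

text \<open>At \<open>v0\<close> the determinant is the product of the factors
  \<open>x - \<rho> i\<close> with \<open>i\<close> in \<open>J - J0\<close>. This one evaluation
  settles the degree, the simplicity of the roots and nonvanishing at 0. Nonvanishing at
  \<open>\<rho> i\<close> fails at \<open>v0\<close> and needs a test vector on the line in
  direction \<open>w\<close>: to first order, the value at \<open>\<rho> i\<close> is a nonzero
  multiple of \<open>G w i i\<close>. Proportionality of kernel vectors follows from simplicity,
  since two independent ones would force a double root.\<close>

lemma generic_pencil_roots:
  fixes J :: "'j set" and \<rho> :: "'j \<Rightarrow> complex" and G :: "('i \<Rightarrow> complex) \<Rightarrow> 'j \<Rightarrow> 'j \<Rightarrow> complex"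
  assumes J: "finite J" "J - J0 \<noteq> {}"
    and \<rho>: "inj_on \<rho> (J - J0)" "\<And>i. i \<in> J - J0 \<Longrightarrow> \<rho> i \<noteq> 0"
    and pf: "poly_fun I a" "\<And>i j. i \<in> J \<Longrightarrow> j \<in> J \<Longrightarrow> poly_fun I (\<lambda>v. G v i j)"
    and v0: "a v0 = 1" "\<And>i j. i \<in> J \<Longrightarrow> j \<in> J \<Longrightarrow> G v0 i j = 0"
    and w: "\<And>i. i \<in> J - J0 \<Longrightarrow> \<exists>w. G w i i \<noteq> 0 \<and> (\<forall>t. a (\<lambda>k. v0 k + t * w k) = 1 \<and>
      (\<forall>i\<in>J. \<forall>j\<in>J. G (\<lambda>k. v0 k + t * w k) i j = t * G w i j))"
  shows "generic I (\<lambda>v. finite (pencil_roots J J0 \<rho> (a v) (G v)) \<and>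
    card (pencil_roots J J0 \<rho> (a v) (G v)) = card (J - J0) \<and>
    0 \<notin> pencil_roots J J0 \<rho> (a v) (G v) \<and>
    (\<forall>i\<in>J - J0. \<rho> i \<notin> pencil_roots J J0 \<rho> (a v) (G v)) \<and>
    (\<forall>x \<xi> \<eta>. pencil_kernel J J0 \<rho> (a v) (G v) x \<xi> \<longrightarrow> pencil_kernel J J0 \<rho> (a v) (G v) x \<eta> \<longrightarrow>
      (\<exists>i\<in>J. \<xi> i \<noteq> 0) \<longrightarrow> (\<exists>c. \<forall>i\<in>J. \<eta> i = c * \<xi> i)))"
proof -
  define n where "n = card J"
  obtain e where e: "bij_betw e {0..<n} J"
    using ex_bij_betw_nat_finite[OF J(1)] unfolding n_def by blast
  have eJ: "e i \<in> J" if "i < n" for i using e that by (auto simp: bij_betw_def)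
  have e_inj: "e i = e j \<longleftrightarrow> i = j" if "i < n" "j < n" for i j
    using e that by (auto simp: bij_betw_def inj_on_def)
  have e_ex: "\<exists>i<n. j = e i" if "j \<in> J" for j
    using e that by (force simp: bij_betw_def)
  have sum_e: "(\<Sum>j\<in>J. f j) = (\<Sum>j = 0..<n. f (e j))" for f :: "'j \<Rightarrow> complex"
    using sum.reindex_bij_betw[OF e, of f] by simp
  define A where "A v i j = (if e i \<in> J0 then [:(if i = j then a v else 0) - G v (e i) (e j):]
    else [:if i = j then - a v * \<rho> (e i) else 0, (if i = j then a v else 0) - G v (e i) (e j):])"
    for v i j
  define F where "F v = Determinant.det (Matrix.mat n n (\<lambda>(i, j). A v i j))" for v
  define d where "d = card (J - J0)"
  have "0 < d" unfolding d_def using J by (simp add: card_gt_0_iff)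

  have sum_A: "(\<Sum>j = 0..<n. poly (A v i j) x * \<xi> (e j)) =
      (if e i \<in> J0 then a v * \<xi> (e i) - (\<Sum>j\<in>J. G v (e i) j * \<xi> j)
       else a v * (x - \<rho> (e i)) * \<xi> (e i) - x * (\<Sum>j\<in>J. G v (e i) j * \<xi> j))" if "i < n" for v i x \<xi>
  proof (cases "e i \<in> J0")
    case True
    have "(\<Sum>j = 0..<n. poly (A v i j) x * \<xi> (e j)) =
        (\<Sum>j = 0..<n. (if i = j then a v * \<xi> (e j) else 0) - G v (e i) (e j) * \<xi> (e j))"
      using True by (intro sum.cong) (auto simp: A_def algebra_simps)
    then show ?thesis using that True by (simp add: sum_subtractf sum_e)
  next
    case False
    have "(\<Sum>j = 0..<n. poly (A v i j) x * \<xi> (e j)) =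
        (\<Sum>j = 0..<n. (if i = j then a v * (x - \<rho> (e i)) * \<xi> (e j) else 0) - x * (G v (e i) (e j) * \<xi> (e j)))"
      using False by (intro sum.cong) (auto simp: A_def algebra_simps)
    then show ?thesis using that False by (simp add: sum_subtractf sum_e sum_distrib_left)
  qed
  have ker_iff: "pencil_kernel J J0 \<rho> (a v) (G v) x \<xi> \<longleftrightarrow>
      (\<forall>i<n. (\<Sum>j = 0..<n. poly (A v i j) x * \<xi> (e j)) = 0)" for v x \<xi>
    unfolding pencil_kernel_def using eJ e_ex
    by (auto simp: sum_A split: if_splits)
  have root_iff: "x \<in> pencil_roots J J0 \<rho> (a v) (G v) \<longleftrightarrow> poly (F v) x = 0" for v x
  proof -
    let ?M = "Matrix.mat n n (\<lambda>(i, j). poly (A v i j) x)"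
    have "poly (F v) x = 0 \<longleftrightarrow> (\<exists>y. y \<in> carrier_vec n \<and> y \<noteq> 0\<^sub>v n \<and> ?M *\<^sub>v y = 0\<^sub>v n)"
      unfolding F_def poly_det by (rule det_0_iff_vec_prod_zero) simp
    also have "\<dots> \<longleftrightarrow> (\<exists>\<xi>. pencil_kernel J J0 \<rho> (a v) (G v) x \<xi> \<and> (\<exists>i\<in>J. \<xi> i \<noteq> 0))"
    proof
      assume "\<exists>y. y \<in> carrier_vec n \<and> y \<noteq> 0\<^sub>v n \<and> ?M *\<^sub>v y = 0\<^sub>v n"
      then obtain y where y: "y \<in> carrier_vec n" "y \<noteq> 0\<^sub>v n" "?M *\<^sub>v y = 0\<^sub>v n" by blast
      define \<xi> where "\<xi> j = vec_index y (the_inv_into {0..<n} e j)" for j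
      have \<xi>: "\<xi> (e j) = vec_index y j" if "j < n" for j
        using that e unfolding \<xi>_def by (simp add: the_inv_into_f_f bij_betw_def)
      have "(\<Sum>j = 0..<n. poly (A v i j) x * \<xi> (e j)) = 0" if "i < n" for i
      proof -
        have "(\<Sum>j = 0..<n. poly (A v i j) x * \<xi> (e j)) = vec_index (?M *\<^sub>v y) i"
          using that y(1) by (auto simp: scalar_prod_def \<xi> intro!: sum.cong)
        then show ?thesis using y(3) that by simp
      qed
      moreover have "\<exists>i\<in>J. \<xi> i \<noteq> 0"
      proof (rule ccontr)
        assume "\<not> (\<exists>i\<in>J. \<xi> i \<noteq> 0)"
        then have "vec_index y j = 0" if "j < n" for j using \<xi>[OF that] eJ[OF that] by auto
        then have "y = 0\<^sub>v n" using y(1) by (intro eq_vecI) auto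
        with y(2) show False by simp
      qed
      ultimately show "\<exists>\<xi>. pencil_kernel J J0 \<rho> (a v) (G v) x \<xi> \<and> (\<exists>i\<in>J. \<xi> i \<noteq> 0)"
        unfolding ker_iff by blast
    next
      assume "\<exists>\<xi>. pencil_kernel J J0 \<rho> (a v) (G v) x \<xi> \<and> (\<exists>i\<in>J. \<xi> i \<noteq> 0)"
      then obtain \<xi> i where \<xi>: "pencil_kernel J J0 \<rho> (a v) (G v) x \<xi>" "i \<in> J" "\<xi> i \<noteq> 0" by blast
      define y where "y = Matrix.vec n (\<lambda>j. \<xi> (e j))"
      have "?M *\<^sub>v y = 0\<^sub>v n"
        using \<xi>(1) unfolding ker_iff by (auto intro!: eq_vecI simp: scalar_prod_def y_def)
      moreover obtain k where "k < n" "i = e k" using e_ex[OF \<xi>(2)] by blast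
      then have "y \<noteq> 0\<^sub>v n"
        using \<xi>(3) by (metis index_vec index_zero_vec(1) y_def)
      ultimately show "\<exists>y. y \<in> carrier_vec n \<and> y \<noteq> 0\<^sub>v n \<and> ?M *\<^sub>v y = 0\<^sub>v n"
        by (intro exI[of _ y]) (auto simp: y_def)
    qed
    finally show ?thesis unfolding pencil_roots_def by simp
  qed

  have F_pf: "poly_coeffs_fun I F"
    unfolding F_def A_def
    by (intro poly_coeffs_fun_det poly_coeffs_fun_intros poly_fun_intros pf eJ)
  \<comment> \<open>The rows in \<open>J0\<close> are constant in \<open>x\<close> and the others
    are of degree one.\<close>
  have d_sum: "(\<Sum>i = 0..<n. if e i \<in> J0 then 0 else 1) = d"
  proof -
    have "(\<Sum>i = 0..<n. if e i \<in> J0 then 0 else 1) = (\<Sum>j\<in>J. if j \<in> J0 then 0 else (1::nat))"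
      by (rule sum.reindex_bij_betw[OF e])
    also have "\<dots> = (\<Sum>j\<in>J - J0. 1)"
      using J(1) by (intro sum.mono_neutral_cong_right) auto
    finally show ?thesis by (simp add: d_def)
  qed
  have F_deg: "degree (F v) \<le> d" for v
    unfolding F_def d_sum[symmetric] by (rule degree_det_le) (auto simp: A_def)
  have F_v0: "F v0 = Polynomial.smult 1 (\<Prod>z\<in>\<rho> ` (J - J0). [:- z, 1:])"
  proof -
    have "F v0 = (\<Prod>i = 0..<n. A v0 i i)"
      unfolding F_def by (rule det_diagonal_except_row[of n n]) (auto simp: A_def v0 eJ)
    also have "\<dots> = (\<Prod>i = 0..<n. if e i \<in> J0 then 1 else [:- \<rho> (e i), 1:])"
      by (intro prod.cong) (auto simp: A_def v0 eJ pCons_one)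
    also have "\<dots> = (\<Prod>j\<in>J. if j \<in> J0 then 1 else [:- \<rho> j, 1:])"
      by (rule prod.reindex_bij_betw[OF e])
    also have "\<dots> = (\<Prod>j\<in>J - J0. [:- \<rho> j, 1:])"
      using J(1) by (intro prod.mono_neutral_cong_right) auto
    also have "\<dots> = (\<Prod>z\<in>\<rho> ` (J - J0). [:- z, 1:])"
      by (simp add: prod.reindex[OF \<rho>(1)])
    finally show ?thesis by simp
  qed
  have deg_v0: "degree (F v0) = d"
    unfolding F_v0 using J(1)
    by (simp add: degree_prod_eq_sum_degree card_image[OF \<rho>(1)] d_def)
  have "generic I (\<lambda>v. degree (F v) = d \<and> rsquarefree (F v))"
    by (rule generic_rsquarefree[OF F_pf F_deg deg_v0 _ \<open>0 < d\<close>])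
      (unfold F_v0, rule rsquarefree_prod_linear, use J in auto)
  moreover have "generic I (\<lambda>v. poly (F v) 0 \<noteq> 0)"
    using J(1) \<rho>(2) by (intro generic_nonzero[of _ _ v0] poly_coeffs_fun_poly[OF F_pf F_deg])
      (auto simp: F_v0 poly_prod)
  moreover have "generic I (\<lambda>v. \<forall>i\<in>J - J0. poly (F v) (\<rho> i) \<noteq> 0)"
  proof (rule generic_ball)
    show "finite (J - J0)" using J by simp
    fix i' assume i': "i' \<in> J - J0"
    then obtain i where i: "i < n" "i' = e i" using e_ex by auto
    obtain w where w: "G w i' i' \<noteq> 0" "\<And>t. a (\<lambda>k. v0 k + t * w k) = 1"
      "\<And>t i j. i \<in> J \<Longrightarrow> j \<in> J \<Longrightarrow> G (\<lambda>k. v0 k + t * w k) i j = t * G w i j"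
      using w[OF i'] by blast
    \<comment> \<open>On the line through \<open>v0\<close> and at \<open>x = \<rho> i'\<close> the
      diagonal term of row \<open>i\<close> vanishes, which leaves \<open>t\<close> times a row;
      \<open>B\<close> is the matrix with this factor removed. At \<open>t = 0\<close> its other
      rows are diagonal, with entries 1 or \<open>\<rho> i' - \<rho> (e k)\<close>.\<close>
    define B where "B k j = (if k = i then [:- \<rho> i' * G w (e i) (e j):]
      else if e k \<in> J0 then [:if k = j then 1 else 0, - G w (e k) (e j):]
      else [:if k = j then \<rho> i' - \<rho> (e k) else 0, - \<rho> i' * G w (e k) (e j):])" for k j
    define q where "q = Determinant.det (Matrix.mat n n (\<lambda>(k, j). B k j))"
    have q: "poly (F (\<lambda>k. v0 k + t * w k)) (\<rho> i') = t * poly q t" for t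
    proof -
      let ?v = "\<lambda>k. v0 k + t * w k"
      let ?B = "Matrix.mat n n (\<lambda>(k, j). poly (B k j) t)"
      have "Matrix.mat n n (\<lambda>(k, j). poly (A ?v k j) (\<rho> i')) = multrow i t ?B"
        using i i' by (intro eq_matI) (auto simp: A_def B_def w eJ algebra_simps)
      then show ?thesis
        using det_multrow[OF i(1), of ?B t] by (simp add: F_def q_def poly_det)
    qed
    have "poly q 0 = (\<Prod>k = 0..<n. poly (B k k) 0)"
      unfolding q_def poly_det by (rule det_diagonal_except_row[of n i]) (auto simp: B_def)
    also have "\<dots> \<noteq> 0"
      using i i' w(1) \<rho> by (auto simp: B_def inj_on_eq_iff[OF \<rho>(1)] eJ e_inj)
    finally have "q \<noteq> 0" by auto
    then have "finite {t. poly (q * [:0, 1:]) t = 0}"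
      by (intro poly_roots_finite) auto
    then obtain t where "t \<notin> {t. poly (q * [:0, 1:]) t = 0}"
      using ex_new_if_finite[OF infinite_UNIV_char_0] by blast
    then have "poly (F (\<lambda>k. v0 k + t * w k)) (\<rho> i') \<noteq> 0" by (auto simp: q)
    then show "generic I (\<lambda>v. poly (F v) (\<rho> i') \<noteq> 0)"
      by (intro generic_nonzero[of _ _ "\<lambda>k. v0 k + t * w k"] poly_coeffs_fun_poly[OF F_pf F_deg])
  qed
  ultimately have "generic I (\<lambda>v. (degree (F v) = d \<and> rsquarefree (F v)) \<and> poly (F v) 0 \<noteq> 0 \<and>
      (\<forall>i\<in>J - J0. poly (F v) (\<rho> i) \<noteq> 0))"
    by (rule generic_conj[OF _ generic_conj])
  then show ?thesis
  proof (rule generic_mono, elim conjE, intro conjI allI impI)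
    fix v assume deg: "degree (F v) = d" and sqf: "rsquarefree (F v)" and F0: "poly (F v) 0 \<noteq> 0"
      and F\<rho>: "\<forall>i\<in>J - J0. poly (F v) (\<rho> i) \<noteq> 0"
    have roots: "pencil_roots J J0 \<rho> (a v) (G v) = {x. poly (F v) x = 0}"
      using root_iff by blast
    have "F v \<noteq> 0" using F0 by auto
    show "finite (pencil_roots J J0 \<rho> (a v) (G v))"
      unfolding roots using \<open>F v \<noteq> 0\<close> by (rule poly_roots_finite)
    show "card (pencil_roots J J0 \<rho> (a v) (G v)) = card (J - J0)"
      unfolding roots card_roots_rsquarefree[OF sqf] deg d_def ..
    show "0 \<notin> pencil_roots J J0 \<rho> (a v) (G v)" using F0 by (simp add: root_iff)
    show "\<forall>i\<in>J - J0. \<rho> i \<notin> pencil_roots J J0 \<rho> (a v) (G v)" using F\<rho> by (simp add: root_iff)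
    fix x \<xi> \<eta>
    assume \<xi>: "pencil_kernel J J0 \<rho> (a v) (G v) x \<xi>" and \<eta>: "pencil_kernel J J0 \<rho> (a v) (G v) x \<eta>"
      and "\<exists>i\<in>J. \<xi> i \<noteq> 0"
    then obtain i0 where i0: "i0 < n" "\<xi> (e i0) \<noteq> 0" using e_ex by blast
    \<comment> \<open>Chosen so that \<open>\<eta> - c * \<xi>\<close> vanishes at
      \<open>i0\<close>; if it is not zero, it is then independent of \<open>\<xi>\<close>.\<close>
    define c where "c = \<eta> (e i0) / \<xi> (e i0)"
    show "\<exists>c. \<forall>i\<in>J. \<eta> i = c * \<xi> i"
    proof (rule ccontr)
      assume "\<nexists>c. \<forall>i\<in>J. \<eta> i = c * \<xi> i"
      then obtain i where "i \<in> J" "\<eta> i \<noteq> c * \<xi> i" by blast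
      then obtain i1 where i1: "i1 < n" "\<eta> (e i1) - c * \<xi> (e i1) \<noteq> 0" using e_ex by auto
      have "(\<Sum>j = 0..<n. poly (A v i j) x * (\<eta> (e j) - c * \<xi> (e j))) = 0" if "i < n" for i
      proof -
        have "(\<Sum>j = 0..<n. poly (A v i j) x * (\<eta> (e j) - c * \<xi> (e j))) =
          (\<Sum>j = 0..<n. poly (A v i j) x * \<eta> (e j)) - c * (\<Sum>j = 0..<n. poly (A v i j) x * \<xi> (e j))"
          by (simp add: sum_distrib_left sum_subtractf algebra_simps)
        then show ?thesis using that \<xi> \<eta> unfolding ker_iff by simp
      qed
      then have "[:- x, 1:]\<^sup>2 dvd F v"
        unfolding F_def using i0 i1 \<xi>[unfolded ker_iff]
        by (intro double_root_det[of i0 n i1 "\<lambda>j. \<xi> (e j)" "\<lambda>j. \<eta> (e j) - c * \<xi> (e j)"])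
          (auto simp: c_def)
      then obtain Q where "F v = [:- x, 1:]\<^sup>2 * Q" by (elim dvdE)
      then have "poly (F v) x = 0 \<and> poly (pderiv (F v)) x = 0"
        by (simp add: power2_eq_square pderiv_mult pderiv_pCons del: mult_pCons_left)
      with sqf show False unfolding rsquarefree_roots by blast
    qed
  qed
qed

section \<open>The score equations\<close>

lemma sum_segre_index:
  "(\<Sum>i\<in>segre_index n. f i) =
    (\<Sum>k = 0..n. f (0, 0, k) + f (1, 0, k) + f (0, 1, k) + f (1, 1, k) :: 'a :: comm_monoid_add)"
  by (simp add: segre_index_def sum.cartesian_product' sum.distrib add_ac)

lemma finite_segre_index: "finite (segre_index n)"
  by (simp add: segre_index_def)

lemma has_field_derivative_prod_power:
  fixes g :: "'i \<Rightarrow> complex \<Rightarrow> complex"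
  assumes "\<And>i. i \<in> A \<Longrightarrow> (g i has_field_derivative g' i) (at t)" "\<And>i. i \<in> A \<Longrightarrow> g i t \<noteq> 0"
  shows "((\<lambda>t. \<Prod>i\<in>A. g i t ^ u i) has_field_derivative
    (\<Prod>i\<in>A. g i t ^ u i) * (\<Sum>i\<in>A. of_nat (u i) * g' i / g i t)) (at t)"
  using assms
proof (induction A rule: infinite_finite_induct)
  case (insert i A)
  have "((\<lambda>t. g i t ^ u i) has_field_derivative g i t ^ u i * (of_nat (u i) * g' i / g i t)) (at t)"
  proof (cases "u i")
    case (Suc m)
    show ?thesis
      by (rule DERIV_cong[OF DERIV_power[where n = "u i"]], rule insert.prems)
        (use insert.prems(2)[of i] Suc in auto)
  qed simp
  from DERIV_mult'[OF this insert.IH] insert show ?case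
    by (simp add: algebra_simps)
qed auto

text \<open>The arc enters through the logarithmic derivatives \<open>d i\<close> of its
  coordinates, because on a toric variety these are sums of contributions of the single
  indices.\<close>

lemma likelihood_has_field_derivative:
  fixes \<gamma> :: "complex \<Rightarrow> 'i \<Rightarrow> complex"
  assumes "\<And>i. i \<in> I \<Longrightarrow> ((\<lambda>t. \<gamma> t i) has_field_derivative d i * \<gamma> 0 i) (at 0)"
    and "\<And>i. i \<in> I \<Longrightarrow> \<gamma> 0 i \<noteq> 0" and "(\<Sum>i\<in>I. \<gamma> 0 i) \<noteq> 0"
  shows "((\<lambda>t. likelihood I u (\<gamma> t)) has_field_derivative likelihood I u (\<gamma> 0) *
    ((\<Sum>i\<in>I. of_nat (u i) * d i) -
     of_nat (\<Sum>i\<in>I. u i) * (\<Sum>i\<in>I. d i * \<gamma> 0 i) / (\<Sum>i\<in>I. \<gamma> 0 i))) (at 0)"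
proof -
  define U where "U = (\<Sum>i\<in>I. u i)"
  define T where "T t = (\<Sum>i\<in>I. \<gamma> t i)" for t
  have "(T has_field_derivative (\<Sum>i\<in>I. d i * \<gamma> 0 i)) (at 0)"
    unfolding T_def using assms(1) by (intro DERIV_sum) auto
  then have T: "((\<lambda>t. T t ^ U) has_field_derivative T 0 ^ U * (of_nat U * (\<Sum>i\<in>I. d i * \<gamma> 0 i) / T 0)) (at 0)"
    using has_field_derivative_prod_power[of "{()}" "\<lambda>_. T" "\<lambda>_. \<Sum>i\<in>I. d i * \<gamma> 0 i" 0 "\<lambda>_. U"]
      assms(3) by (simp add: T_def)
  have P: "((\<lambda>t. \<Prod>i\<in>I. \<gamma> t i ^ u i) has_field_derivative
      (\<Prod>i\<in>I. \<gamma> 0 i ^ u i) * (\<Sum>i\<in>I. of_nat (u i) * (d i * \<gamma> 0 i) / \<gamma> 0 i)) (at 0)"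
    using assms by (intro has_field_derivative_prod_power) auto
  also have "(\<Sum>i\<in>I. of_nat (u i) * (d i * \<gamma> 0 i) / \<gamma> 0 i) = (\<Sum>i\<in>I. of_nat (u i) * d i)"
    using assms(2) by (intro sum.cong) auto
  finally have P: "((\<lambda>t. \<Prod>i\<in>I. \<gamma> t i ^ u i) has_field_derivative
      (\<Prod>i\<in>I. \<gamma> 0 i ^ u i) * (\<Sum>i\<in>I. of_nat (u i) * d i)) (at 0)" .
  have "T 0 \<noteq> 0" using assms(3) by (simp add: T_def)
  show ?thesis
    unfolding likelihood_def U_def[symmetric] T_def[symmetric]
    by (rule DERIV_cong[OF DERIV_divide[OF P T]])
      (use \<open>T 0 \<noteq> 0\<close> in \<open>auto simp: divide_simps algebra_simps\<close>)
qed

section \<open>Margins of the data and the likelihood equations\<close>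

definition curve :: "(nat \<times> nat \<times> nat \<Rightarrow> complex) \<Rightarrow> nat \<Rightarrow> complex \<Rightarrow> complex \<Rightarrow> complex" where
  "curve W k x y = W (0, 0, k) + W (1, 0, k) * x + W (0, 1, k) * y + W (1, 1, k) * x * y"

definition curve_dx :: "(nat \<times> nat \<times> nat \<Rightarrow> complex) \<Rightarrow> nat \<Rightarrow> complex \<Rightarrow> complex" where
  "curve_dx W k y = W (1, 0, k) + W (1, 1, k) * y"

definition curve_dy :: "(nat \<times> nat \<times> nat \<Rightarrow> complex) \<Rightarrow> nat \<Rightarrow> complex \<Rightarrow> complex" where
  "curve_dy W k x = W (0, 1, k) + W (1, 1, k) * x"

definition margin_x :: "nat \<Rightarrow> (nat \<times> nat \<times> nat \<Rightarrow> complex) \<Rightarrow> complex" where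
  "margin_x n v = (\<Sum>k = 0..n. v (1, 0, k) + v (1, 1, k))"

definition margin_y :: "nat \<Rightarrow> (nat \<times> nat \<times> nat \<Rightarrow> complex) \<Rightarrow> complex" where
  "margin_y n v = (\<Sum>k = 0..n. v (0, 1, k) + v (1, 1, k))"

definition margin_z :: "(nat \<times> nat \<times> nat \<Rightarrow> complex) \<Rightarrow> nat \<Rightarrow> complex" where
  "margin_z v k = v (0, 0, k) + v (1, 0, k) + v (0, 1, k) + v (1, 1, k)"

definition margin_total :: "nat \<Rightarrow> (nat \<times> nat \<times> nat \<Rightarrow> complex) \<Rightarrow> complex" where
  "margin_total n v = (\<Sum>k = 0..n. margin_z v k)"

lemma margin_total_eq: "margin_total n v = (\<Sum>i\<in>segre_index n. v i)"
  by (simp add: margin_total_def margin_z_def sum_segre_index)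

text \<open>Equality of the normalised margins, cleared of denominators and hence unaffected by
  rescaling \<open>p\<close>. That it characterises critical points on a toric model is Birch's
  theorem, proved in the two directions below.\<close>

definition same_margins :: "nat \<Rightarrow> (nat \<times> nat \<times> nat \<Rightarrow> complex) \<Rightarrow> (nat \<times> nat \<times> nat \<Rightarrow> complex) \<Rightarrow> bool" where
  "same_margins n v p \<longleftrightarrow>
    margin_total n v * margin_x n p = margin_x n v * margin_total n p \<and>
    margin_total n v * margin_y n p = margin_y n v * margin_total n p \<and>
    (\<forall>k\<le>n. margin_total n v * margin_z p k = margin_z v k * margin_total n p)"

text \<open>Both sides have degree three in \<open>r\<close>, so the factor \<open>c\<close>
  cancels. The relation expresses each coordinate through those with at most one nonzero index; its
  logarithmic derivative makes the velocity of an arc additive in \<open>i\<close>,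
  \<open>j\<close>, \<open>k\<close>.\<close>

lemma scaled_segre_multiplicative:
  assumes "r = (\<lambda>i. c * scaled_segre n W x y z i)" "(i, j, k) \<in> segre_index n"
  shows "r (i, j, k) * r (0, 0, 0) ^ 2 * (W (i, 0, 0) * W (0, j, 0) * W (0, 0, k)) =
    r (i, 0, 0) * r (0, j, 0) * r (0, 0, k) * (W (i, j, k) * W (0, 0, 0) ^ 2)"
  using assms by (auto simp: scaled_segre_def segre_index_def power2_eq_square)

lemma Union_segre_variety:
  assumes "q \<in> \<Union> (very_affine_part (segre_index n) (segre_variety n W))"
  shows "\<exists>c x y z. q = (\<lambda>i. c * scaled_segre n W x y z i)"
    and "i \<in> segre_index n \<Longrightarrow> q i \<noteq> 0" and "margin_total n q \<noteq> 0"
proof -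
  obtain P where P: "q \<in> P" "P \<in> segre_variety n W"
    "\<forall>p\<in>P. (\<Prod>i\<in>segre_index n. p i) * (\<Sum>i\<in>segre_index n. p i) \<noteq> 0"
    using assms unfolding very_affine_part_def by blast
  then show "i \<in> segre_index n \<Longrightarrow> q i \<noteq> 0" and "margin_total n q \<noteq> 0"
    using finite_segre_index[of n] by (auto simp: margin_total_eq)
  obtain x y z where "P = proj_point (segre_index n) (scaled_segre n W x y z)"
    using P(2) unfolding segre_variety_def by blast
  then show "\<exists>c x y z. q = (\<lambda>i. c * scaled_segre n W x y z i)"
    using P(1) unfolding proj_point_def proportional_def by blast
qed

lemma proj_point_mem:
  "p \<in> hcoords I \<Longrightarrow> p \<in> proj_point I p"
  by (auto simp: proj_point_def proportional_def intro!: exI[of _ 1])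

lemma proj_point_in_very_affine_part:
  assumes p: "p = scaled_segre n W x y z" and nz: "\<And>i. i \<in> segre_index n \<Longrightarrow> p i \<noteq> 0" "margin_total n p \<noteq> 0"
    and xyz: "x \<in> hcoords {0, 1}" "y \<in> hcoords {0, 1}" "z \<in> hcoords {0..n}"
  shows "proj_point (segre_index n) p \<in> very_affine_part (segre_index n) (segre_variety n W)"
    and "p \<in> proj_point (segre_index n) p"
proof -
  have "(0, 0, 0) \<in> segre_index n" by (simp add: segre_index_def)
  then have "p \<in> hcoords (segre_index n)"
    using nz(1) by (auto simp: hcoords_def p scaled_segre_def)
  then show "p \<in> proj_point (segre_index n) p" by (rule proj_point_mem)
  show "proj_point (segre_index n) p \<in> very_affine_part (segre_index n) (segre_variety n W)"
    unfolding very_affine_part_def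
  proof (intro CollectI conjI ballI)
    show "proj_point (segre_index n) p \<in> segre_variety n W"
      using p xyz unfolding segre_variety_def by blast
    fix q assume "q \<in> proj_point (segre_index n) p"
    then obtain c where "c \<noteq> 0" "q = (\<lambda>i. c * p i)"
      by (auto simp: proj_point_def proportional_def)
    then show "(\<Prod>i\<in>segre_index n. q i) * (\<Sum>i\<in>segre_index n. q i) \<noteq> 0"
      using nz finite_segre_index[of n] by (auto simp: margin_total_eq sum_distrib_left[symmetric])
  qed
qed

lemma proj_point_eqI:
  assumes "q \<in> proj_point I p" shows "proj_point I q = proj_point I p"
  using assms equiv_class_eq[OF equiv_proportional[of I], of p q] unfolding proj_point_def by auto

lemma hcoords_scale_coord:
  assumes "x \<in> hcoords I" "c \<noteq> 0"
  shows "(\<lambda>i. if i = k then c * x i else x i) \<in> hcoords I"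
proof -
  obtain i where i: "i \<in> I" "x i \<noteq> 0" using assms(1) unfolding hcoords_def by blast
  then have "(if i = k then c * x i else x i) \<noteq> 0" using assms(2) by auto
  moreover have "(if j = k then c * x j else x j) = 0" if "j \<notin> I" for j
    using assms(1) that unfolding hcoords_def by auto
  ultimately show ?thesis using i(1) unfolding hcoords_def by blast
qed

text \<open>Multiplying one coordinate of one factor by \<open>1 + t\<close> moves the point along
  an arc on which \<open>p i\<close> becomes \<open>p i * (1 + t * s i)\<close>, where
  \<open>s\<close> is the indicator of the indices that involve this coordinate. The vanishing
  derivative along each such arc is one margin equation.\<close>

lemma same_margins_of_critical:
  fixes u :: "nat \<times> nat \<times> nat \<Rightarrow> nat"
  assumes crit: "P \<in> critical_points (segre_index n)
      (very_affine_part (segre_index n) (segre_variety n W)) (likelihood (segre_index n) u)"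
    and p: "p \<in> P" "p = scaled_segre n W x y z"
    and xyz: "x \<in> hcoords {0, 1}" "y \<in> hcoords {0, 1}" "z \<in> hcoords {0..n}"
  shows "same_margins n (\<lambda>i. of_nat (u i)) p"
proof -
  let ?I = "segre_index n" and ?S = "very_affine_part (segre_index n) (segre_variety n W)"
  have PS: "P \<in> ?S" using crit by (simp add: critical_points_def)
  then have pS: "p \<in> \<Union> ?S" using p(1) by blast
  note nz = Union_segre_variety(2,3)[OF pS]
  have main: "margin_total n (\<lambda>i. of_nat (u i)) * (\<Sum>i\<in>?I. s i * p i) = (\<Sum>i\<in>?I. of_nat (u i) * s i) * margin_total n p"
    if x': "\<And>t. cmod t < 1 \<Longrightarrow> x' t \<in> hcoords {0, 1} \<and> y' t \<in> hcoords {0, 1} \<and> z' t \<in> hcoords {0..n} \<and>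
        scaled_segre n W (x' t) (y' t) (z' t) = (\<lambda>i. p i * (1 + t * s i))"
      and s: "\<And>i. s i \<in> {0, 1}" for s :: "nat \<times> nat \<times> nat \<Rightarrow> complex" and x' y' z'
  proof -
    define \<gamma> where "\<gamma> t = (\<lambda>i. p i * (1 + t * s i))" for t
    have "continuous_on UNIV (\<lambda>t. margin_total n (\<gamma> t))"
      unfolding margin_total_eq \<gamma>_def by (intro continuous_intros)
    then have "open {t. margin_total n (\<gamma> t) \<noteq> 0}"
      by (intro open_Collect_neq continuous_on_const)
    moreover have "0 \<in> {t. margin_total n (\<gamma> t) \<noteq> 0}" using nz by (simp add: \<gamma>_def)
    ultimately obtain e where e: "e > 0" "\<And>t. dist t 0 < e \<Longrightarrow> margin_total n (\<gamma> t) \<noteq> 0"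
      unfolding open_dist by blast
    \<comment> \<open>A radius below \<open>e\<close> keeps the coordinate sum nonzero, a radius at
      most 1 keeps the factors \<open>1 + t * s i\<close> nonzero.\<close>
    define e' where "e' = min e 1"
    have "0 < e'" using e(1) by (simp add: e'_def)
    moreover have "\<gamma> 0 \<in> P" using p(1) by (simp add: \<gamma>_def)
    moreover have "\<forall>i\<in>?I. (\<lambda>t. \<gamma> t i) holomorphic_on ball 0 e'"
      unfolding \<gamma>_def by (auto intro!: holomorphic_intros)
    moreover have "\<forall>t\<in>ball 0 e'. \<gamma> t \<in> \<Union> ?S"
    proof
      fix t :: complex assume "t \<in> ball 0 e'"
      then have t: "cmod t < 1" "dist t 0 < e" by (auto simp: e'_def)
      have ne: "1 + t * s i \<noteq> 0" for i
      proof
        assume "1 + t * s i = 0"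
        then have "s i = 1" using s[of i] by auto
        then have "t = -1" using \<open>1 + t * s i = 0\<close> by (simp add: add_eq_0_iff)
        then show False using t by simp
      qed
      have "\<gamma> t i \<noteq> 0" if "i \<in> ?I" for i using ne nz that by (simp add: \<gamma>_def)
      moreover have "\<gamma> t = scaled_segre n W (x' t) (y' t) (z' t)" using x'[OF t(1)] by (simp add: \<gamma>_def)
      ultimately show "\<gamma> t \<in> \<Union> ?S"
        using proj_point_in_very_affine_part[of "\<gamma> t" n W "x' t" "y' t" "z' t"] x'[OF t(1)] e(2)[OF t(2)]
        by blast
    qed
    ultimately have 1: "((\<lambda>t. likelihood ?I u (\<gamma> t)) has_field_derivative 0) (at 0)"
      using crit unfolding critical_points_def by blast
    have 2: "((\<lambda>t. likelihood ?I u (\<gamma> t)) has_field_derivative likelihood ?I u (\<gamma> 0) *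
      ((\<Sum>i\<in>?I. of_nat (u i) * s i) -
       of_nat (\<Sum>i\<in>?I. u i) * (\<Sum>i\<in>?I. s i * \<gamma> 0 i) / (\<Sum>i\<in>?I. \<gamma> 0 i))) (at 0)"
      using nz by (intro likelihood_has_field_derivative)
        (auto simp: \<gamma>_def margin_total_eq intro!: derivative_eq_intros)
    have "likelihood ?I u (\<gamma> 0) \<noteq> 0"
      using nz finite_segre_index[of n] by (auto simp: likelihood_def \<gamma>_def margin_total_eq)
    then have "(\<Sum>i\<in>?I. of_nat (u i) * s i) =
       of_nat (\<Sum>i\<in>?I. u i) * (\<Sum>i\<in>?I. s i * p i) / margin_total n p"
      using DERIV_unique[OF 1 2] by (simp add: \<gamma>_def margin_total_eq)
    then show ?thesis using nz(2) by (simp add: margin_total_eq field_simps)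
  qed
  have nz_t: "1 + t \<noteq> 0" if "cmod t < 1" for t :: complex
    using that by (metis add_eq_0_iff2 less_irrefl norm_minus_cancel norm_one)
  have mx: "margin_total n (\<lambda>i. of_nat (u i)) * (\<Sum>i\<in>?I. (if fst i = 1 then 1 else 0) * p i) =
      (\<Sum>i\<in>?I. of_nat (u i) * (if fst i = 1 then 1 else 0)) * margin_total n p"
    by (rule main[where x' = "\<lambda>t i. if i = 1 then (1 + t) * x i else x i" and y' = "\<lambda>_. y" and z' = "\<lambda>_. z"])
      (auto simp: p(2) scaled_segre_def fun_eq_iff intro!: xyz xyz[simplified] hcoords_scale_coord dest: nz_t)
  have my: "margin_total n (\<lambda>i. of_nat (u i)) * (\<Sum>i\<in>?I. (if fst (snd i) = 1 then 1 else 0) * p i) =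
      (\<Sum>i\<in>?I. of_nat (u i) * (if fst (snd i) = 1 then 1 else 0)) * margin_total n p"
    by (rule main[where x' = "\<lambda>_. x" and y' = "\<lambda>t i. if i = 1 then (1 + t) * y i else y i" and z' = "\<lambda>_. z"])
      (auto simp: p(2) scaled_segre_def fun_eq_iff intro!: xyz xyz[simplified] hcoords_scale_coord dest: nz_t)
  have mz: "margin_total n (\<lambda>i. of_nat (u i)) * (\<Sum>i\<in>?I. (if snd (snd i) = k then 1 else 0) * p i) =
      (\<Sum>i\<in>?I. of_nat (u i) * (if snd (snd i) = k then 1 else 0)) * margin_total n p" for k
    by (rule main[where x' = "\<lambda>_. x" and y' = "\<lambda>_. y" and z' = "\<lambda>t i. if i = k then (1 + t) * z i else z i"])
      (auto simp: p(2) scaled_segre_def fun_eq_iff intro!: xyz xyz[simplified] hcoords_scale_coord dest: nz_t)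
  have if_sum: "(\<Sum>i = 0..n. if i = k then f i else 0) = (if k \<le> n then f k else 0)" for f :: "nat \<Rightarrow> complex" and k
    by (subst sum.delta) auto
  have delta: "(\<Sum>i\<in>?I. (if snd (snd i) = k then 1 else 0) * f i) = margin_z f k" if "k \<le> n" for f k
  proof -
    have "(\<Sum>i\<in>?I. (if snd (snd i) = k then 1 else 0) * f i) = (\<Sum>i = 0..n. if i = k then margin_z f i else 0)"
      unfolding sum_segre_index by (intro sum.cong) (auto simp: margin_z_def)
    then show ?thesis using that by (simp add: if_sum)
  qed
  show ?thesis
    unfolding same_margins_def
  proof (intro conjI allI impI)
    show "margin_total n (\<lambda>i. of_nat (u i)) * margin_x n p = margin_x n (\<lambda>i. of_nat (u i)) * margin_total n p"
      using mx by (simp add: sum_segre_index margin_x_def)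
    show "margin_total n (\<lambda>i. of_nat (u i)) * margin_y n p = margin_y n (\<lambda>i. of_nat (u i)) * margin_total n p"
      using my by (simp add: sum_segre_index margin_y_def)
    fix k assume "k \<le> n"
    then show "margin_total n (\<lambda>i. of_nat (u i)) * margin_z p k = margin_z (\<lambda>i. of_nat (u i)) k * margin_total n p"
      using mz[of k] delta[of k p] delta[of k "\<lambda>i. of_nat (u i)"] by (simp add: mult.commute)
  qed
qed

text \<open>The Segre relation shows that the logarithmic velocity \<open>d\<close> of an arbitrary
  arc is determined by its values with at most one nonzero index. The logarithmic derivative of the
  likelihood therefore depends on \<open>u\<close> and on the point only through the
  margins.\<close>

lemma critical_of_same_margins:
  fixes u :: "nat \<times> nat \<times> nat \<Rightarrow> nat"
  assumes W: "\<forall>i\<in>segre_index n. W i \<noteq> 0"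
    and P: "P \<in> very_affine_part (segre_index n) (segre_variety n W)"
    and sm: "\<And>p. p \<in> P \<Longrightarrow> same_margins n (\<lambda>i. of_nat (u i)) p"
  shows "P \<in> critical_points (segre_index n)
      (very_affine_part (segre_index n) (segre_variety n W)) (likelihood (segre_index n) u)"
  unfolding critical_points_def
proof (intro CollectI conjI allI impI P)
  let ?I = "segre_index n" and ?S = "very_affine_part (segre_index n) (segre_variety n W)"
  fix \<gamma> :: "complex \<Rightarrow> nat \<times> nat \<times> nat \<Rightarrow> complex" and e :: real
  assume e: "0 < e" and \<gamma>0: "\<gamma> 0 \<in> P" and hol: "\<forall>i\<in>?I. (\<lambda>t. \<gamma> t i) holomorphic_on ball 0 e"
    and \<gamma>S: "\<forall>t\<in>ball 0 e. \<gamma> t \<in> \<Union> ?S"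
  define p where "p = \<gamma> 0"
  have pS: "p \<in> \<Union> ?S" using \<gamma>S e by (simp add: p_def)
  note nz = Union_segre_variety(2,3)[OF pS]
  define d where "d i = deriv (\<lambda>t. \<gamma> t i) 0 / p i" for i
  have der: "((\<lambda>t. \<gamma> t i) has_field_derivative d i * p i) (at 0)" if "i \<in> ?I" for i
    using holomorphic_derivI[of "\<lambda>t. \<gamma> t i" "ball 0 e" 0] hol that e nz(1)[OF that] by (simp add: d_def)
  have d: "d (i, j, k) = d (i, 0, 0) + d (0, j, 0) + d (0, 0, k) - 2 * d (0, 0, 0)"
    if ijk: "(i, j, k) \<in> ?I" for i j k
  proof -
    have I: "(0, 0, 0) \<in> ?I" "(i, 0, 0) \<in> ?I" "(0, j, 0) \<in> ?I" "(0, 0, k) \<in> ?I"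
      using ijk by (auto simp: segre_index_def)
    define A where "A = W (i, 0, 0) * W (0, j, 0) * W (0, 0, k)"
    define B where "B = W (i, j, k) * W (0, 0, 0) ^ 2"
    define L where "L t = \<gamma> t (i, j, k) * \<gamma> t (0, 0, 0) ^ 2 * A" for t
    define R where "R t = \<gamma> t (i, 0, 0) * \<gamma> t (0, j, 0) * \<gamma> t (0, 0, k) * B" for t
    have LR: "L t = R t" if "t \<in> ball 0 e" for t
    proof -
      have "\<gamma> t \<in> \<Union> ?S" using \<gamma>S that by blast
      from Union_segre_variety(1)[OF this] obtain c x y z where
        "\<gamma> t = (\<lambda>i. c * scaled_segre n W x y z i)" by blast
      from scaled_segre_multiplicative[OF this ijk] show ?thesis
        by (simp add: L_def R_def A_def B_def)
    qed
    have dL: "(L has_field_derivative L 0 * (d (i, j, k) + 2 * d (0, 0, 0))) (at 0)"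
      unfolding L_def using der[OF ijk] der[OF I(1)]
      by (auto intro!: derivative_eq_intros simp: p_def[symmetric] algebra_simps power2_eq_square)
    have dR: "(R has_field_derivative R 0 * (d (i, 0, 0) + d (0, j, 0) + d (0, 0, k))) (at 0)"
      unfolding R_def using der[OF I(2)] der[OF I(3)] der[OF I(4)]
      by (auto intro!: derivative_eq_intros simp: p_def[symmetric] algebra_simps)
    have "(L has_field_derivative R 0 * (d (i, 0, 0) + d (0, j, 0) + d (0, 0, k))) (at 0)"
      by (rule has_field_derivative_transform_within_open[OF dR open_ball[of 0 e]]) (use e LR in auto)
    then have "L 0 * (d (i, j, k) + 2 * d (0, 0, 0)) = R 0 * (d (i, 0, 0) + d (0, j, 0) + d (0, 0, k))"
      using DERIV_unique[OF dL] by blast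
    moreover have "L 0 = R 0" using LR e by simp
    moreover have "R 0 \<noteq> 0"
      using W I ijk nz(1) by (simp add: R_def B_def p_def[symmetric])
    ultimately have "d (i, j, k) + 2 * d (0, 0, 0) = d (i, 0, 0) + d (0, j, 0) + d (0, 0, k)"
      using mult_left_cancel[of "R 0"] by metis
    then show ?thesis by (simp add: algebra_simps)
  qed
  have dsum: "(\<Sum>i\<in>?I. q i * d i) = (d (1, 0, 0) - d (0, 0, 0)) * margin_x n q +
      (d (0, 1, 0) - d (0, 0, 0)) * margin_y n q + (\<Sum>k = 0..n. d (0, 0, k) * margin_z q k)" for q
  proof -
    have "(\<Sum>i\<in>?I. q i * d i) = (\<Sum>k = 0..n. (d (1, 0, 0) - d (0, 0, 0)) * (q (1, 0, k) + q (1, 1, k)) +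
      (d (0, 1, 0) - d (0, 0, 0)) * (q (0, 1, k) + q (1, 1, k)) + d (0, 0, k) * margin_z q k)"
      unfolding sum_segre_index
    proof (intro sum.cong refl)
      fix k assume "k \<in> {0..n}"
      then have *: "d (1, 0, k) = d (1, 0, 0) + d (0, 0, k) - d (0, 0, 0)"
        "d (0, 1, k) = d (0, 1, 0) + d (0, 0, k) - d (0, 0, 0)"
        "d (1, 1, k) = d (1, 0, 0) + d (0, 1, 0) + d (0, 0, k) - 2 * d (0, 0, 0)"
        using d[of 1 0 k] d[of 0 1 k] d[of 1 1 k] by (auto simp: segre_index_def)
      show "q (0, 0, k) * d (0, 0, k) + q (1, 0, k) * d (1, 0, k) + q (0, 1, k) * d (0, 1, k) +
          q (1, 1, k) * d (1, 1, k) = (d (1, 0, 0) - d (0, 0, 0)) * (q (1, 0, k) + q (1, 1, k)) +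
          (d (0, 1, 0) - d (0, 0, 0)) * (q (0, 1, k) + q (1, 1, k)) + d (0, 0, k) * margin_z q k"
        unfolding margin_z_def * by (simp add: algebra_simps)
    qed
    then show ?thesis 
      unfolding margin_x_def margin_y_def sum_distrib_left by (simp only: sum.distrib)
  qed
  let ?u = "\<lambda>i. of_nat (u i) :: complex"
  have "((\<lambda>t. likelihood ?I u (\<gamma> t)) has_field_derivative likelihood ?I u (\<gamma> 0) *
    ((\<Sum>i\<in>?I. of_nat (u i) * d i) -
     of_nat (\<Sum>i\<in>?I. u i) * (\<Sum>i\<in>?I. d i * \<gamma> 0 i) / (\<Sum>i\<in>?I. \<gamma> 0 i))) (at 0)"
    using der nz unfolding p_def margin_total_eq by (intro likelihood_has_field_derivative) auto
  moreover have "margin_total n ?u * (\<Sum>i\<in>?I. p i * d i) = (\<Sum>i\<in>?I. ?u i * d i) * margin_total n p"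
  proof -
    have "same_margins n ?u p" using sm \<gamma>0 by (simp add: p_def)
    then have m: "margin_total n ?u * margin_x n p = margin_x n ?u * margin_total n p"
      "margin_total n ?u * margin_y n p = margin_y n ?u * margin_total n p"
      "\<And>k. k \<le> n \<Longrightarrow> margin_total n ?u * margin_z p k = margin_z ?u k * margin_total n p"
      by (auto simp: same_margins_def)
    have z: "margin_total n ?u * (\<Sum>k = 0..n. d (0, 0, k) * margin_z p k) = (\<Sum>k = 0..n. d (0, 0, k) * margin_z ?u k) * margin_total n p"
      unfolding sum_distrib_left sum_distrib_right
    proof (intro sum.cong refl)
      fix k assume "k \<in> {0..n}"
      then have "d (0, 0, k) * (margin_total n ?u * margin_z p k) = d (0, 0, k) * (margin_z ?u k * margin_total n p)"
        using m(3)[of k] by simp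
      then show "margin_total n ?u * (d (0, 0, k) * margin_z p k) = d (0, 0, k) * margin_z ?u k * margin_total n p"
        by (simp only: mult_ac)
    qed
    have "margin_total n ?u * ((d (1, 0, 0) - d (0, 0, 0)) * margin_x n p + (d (0, 1, 0) - d (0, 0, 0)) * margin_y n p +
        (\<Sum>k = 0..n. d (0, 0, k) * margin_z p k)) =
      (d (1, 0, 0) - d (0, 0, 0)) * (margin_total n ?u * margin_x n p) +
      (d (0, 1, 0) - d (0, 0, 0)) * (margin_total n ?u * margin_y n p) +
      margin_total n ?u * (\<Sum>k = 0..n. d (0, 0, k) * margin_z p k)"
      by (simp only: distrib_left mult_ac)
    then show ?thesis
      unfolding dsum m(1,2) z by (simp only: distrib_left distrib_right mult_ac)
  qed
  then have "(\<Sum>i\<in>?I. of_nat (u i) * d i) =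
     of_nat (\<Sum>i\<in>?I. u i) * (\<Sum>i\<in>?I. d i * \<gamma> 0 i) / (\<Sum>i\<in>?I. \<gamma> 0 i)"
    using nz(2) unfolding margin_total_eq p_def[symmetric] by (simp add: field_simps)
  ultimately show "((\<lambda>t. likelihood ?I u (\<gamma> t)) has_field_derivative 0) (at 0)" by simp
qed

definition score_solutions ::
    "nat \<Rightarrow> (nat \<times> nat \<times> nat \<Rightarrow> complex) \<Rightarrow> complex \<Rightarrow> complex \<Rightarrow> (nat \<Rightarrow> complex) \<Rightarrow> (complex \<times> complex) set"
  where
  "score_solutions n W a b c = {(x, y). x \<noteq> 0 \<and> y \<noteq> 0 \<and> (\<forall>k\<le>n. curve W k x y \<noteq> 0) \<and>
     x * (\<Sum>k = 0..n. c k * curve_dx W k y / curve W k x y) = a \<and>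
     y * (\<Sum>k = 0..n. c k * curve_dy W k x / curve W k x y) = b}"

definition affine_pt :: "complex \<Rightarrow> nat \<Rightarrow> complex" where
  "affine_pt x i = (if i = 0 then 1 else if i = 1 then x else 0)"

definition critical_vec ::
    "nat \<Rightarrow> (nat \<times> nat \<times> nat \<Rightarrow> complex) \<Rightarrow> (nat \<Rightarrow> complex) \<Rightarrow> complex \<times> complex \<Rightarrow> nat \<times> nat \<times> nat \<Rightarrow> complex"
  where
  "critical_vec n W c = (\<lambda>(x, y). scaled_segre n W (affine_pt x) (affine_pt y)
     (\<lambda>k. if k \<le> n then c k / curve W k x y else 0))"

lemma margins_scaled_segre_affine:
  assumes "p = scaled_segre n W (affine_pt x) (affine_pt y) z"
  shows "k \<le> n \<Longrightarrow> margin_z p k = z k * curve W k x y"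
    and "margin_x n p = x * (\<Sum>k = 0..n. z k * curve_dx W k y)"
    and "margin_y n p = y * (\<Sum>k = 0..n. z k * curve_dy W k x)"
  using assms
  by (auto simp: margin_z_def margin_x_def margin_y_def scaled_segre_def segre_index_def affine_pt_def
      curve_def curve_dx_def curve_dy_def sum_distrib_left algebra_simps intro!: sum.cong)

text \<open>All coordinates are nonzero on the very affine part, so the first two factors can be
  normalised to affine points. The \<open>z\<close>-margins then fix the third factor up to the
  ratio \<open>T\<close> of the totals, and the two margin equations that remain are the score
  equations.\<close>

lemma bij_betw_critical_points:
  fixes u :: "nat \<times> nat \<times> nat \<Rightarrow> nat" and n :: nat
  defines "v \<equiv> \<lambda>i. of_nat (u i) :: complex"
  assumes W: "\<forall>i\<in>segre_index n. W i \<noteq> 0"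
    and c: "\<forall>k\<le>n. margin_z v k \<noteq> 0" and U: "margin_total n v \<noteq> 0"
  shows "bij_betw (\<lambda>xy. proj_point (segre_index n) (critical_vec n W (margin_z v) xy))
    (score_solutions n W (margin_x n v) (margin_y n v) (margin_z v))
    (critical_points (segre_index n)
      (very_affine_part (segre_index n) (segre_variety n W)) (likelihood (segre_index n) u))"
proof -
  let ?I = "segre_index n" and ?S = "very_affine_part (segre_index n) (segre_variety n W)"
  let ?c = "margin_z v"
  let ?Sol = "score_solutions n W (margin_x n v) (margin_y n v) (margin_z v)"
  let ?Crit = "critical_points ?I ?S (likelihood ?I u)"
  have sol: "critical_vec n W ?c (x, y) i \<noteq> 0" "margin_total n (critical_vec n W ?c (x, y)) = margin_total n v"
    "proj_point ?I (critical_vec n W ?c (x, y)) \<in> ?Crit"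
    "critical_vec n W ?c (x, y) \<in> proj_point ?I (critical_vec n W ?c (x, y))"
    if xy: "(x, y) \<in> ?Sol" and i: "i \<in> ?I" for x y i
  proof -
    define z where "z k = (if k \<le> n then ?c k / curve W k x y else 0)" for k
    define p where "p = critical_vec n W ?c (x, y)"
    have p: "p = scaled_segre n W (affine_pt x) (affine_pt y) z"
      by (simp add: p_def critical_vec_def z_def[abs_def])
    have xy': "x \<noteq> 0" "y \<noteq> 0" "\<And>k. k \<le> n \<Longrightarrow> curve W k x y \<noteq> 0"
      "x * (\<Sum>k = 0..n. ?c k * curve_dx W k y / curve W k x y) = margin_x n v"
      "y * (\<Sum>k = 0..n. ?c k * curve_dy W k x / curve W k x y) = margin_y n v"
      using xy by (auto simp: score_solutions_def)
    have mz: "margin_z p k = ?c k" if "k \<le> n" for k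
      using margins_scaled_segre_affine(1)[OF p that] xy'(3)[OF that] that by (simp add: z_def)
    have tot: "margin_total n p = margin_total n v" using mz by (simp add: margin_total_def)
    have mx: "margin_x n p = margin_x n v"
      unfolding margins_scaled_segre_affine(2)[OF p] xy'(4)[symmetric]
      by (intro arg_cong[of _ _ "\<lambda>t. x * t"] sum.cong) (auto simp: z_def)
    have my: "margin_y n p = margin_y n v"
      unfolding margins_scaled_segre_affine(3)[OF p] xy'(5)[symmetric]
      by (intro arg_cong[of _ _ "\<lambda>t. y * t"] sum.cong) (auto simp: z_def)
    have sm: "same_margins n v p"
      using mz mx my tot by (simp add: same_margins_def)
    have nz: "p i \<noteq> 0" if "i \<in> ?I" for i
      using that W xy' c unfolding p
      by (auto simp: scaled_segre_def affine_pt_def z_def segre_index_def)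
    have h: "affine_pt x \<in> hcoords {0, 1}" "affine_pt y \<in> hcoords {0, 1}" "z \<in> hcoords {0..n}"
      using c xy'(3) by (auto simp: hcoords_def affine_pt_def z_def intro!: bexI[of _ 0])
    have PS: "proj_point ?I p \<in> ?S" "p \<in> proj_point ?I p"
      using proj_point_in_very_affine_part[OF p nz _ h] U tot by auto
    have "same_margins n v q" if "q \<in> proj_point ?I p" for q
    proof -
      obtain d where "q = (\<lambda>i. d * p i)" using \<open>q \<in> proj_point ?I p\<close>
        by (auto simp: proj_point_def proportional_def)
      then have "margin_x n q = d * margin_x n p" "margin_y n q = d * margin_y n p"
        "\<And>k. margin_z q k = d * margin_z p k" "margin_total n q = d * margin_total n p"
        by (auto simp: margin_x_def margin_y_def margin_z_def margin_total_def sum_distrib_left algebra_simps)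
      then show ?thesis using sm by (auto simp: same_margins_def)
    qed
    then have "proj_point ?I p \<in> ?Crit"
      using critical_of_same_margins[OF W PS(1)] unfolding v_def by blast
    then show "critical_vec n W ?c (x, y) i \<noteq> 0" "margin_total n (critical_vec n W ?c (x, y)) = margin_total n v"
      "proj_point ?I (critical_vec n W ?c (x, y)) \<in> ?Crit"
      "critical_vec n W ?c (x, y) \<in> proj_point ?I (critical_vec n W ?c (x, y))"
      using nz[OF i] tot PS(2) by (simp_all add: p_def)
  qed
  have I0: "(0, 0, 0) \<in> ?I" "(1, 0, 0) \<in> ?I" "(0, 1, 0) \<in> ?I" by (auto simp: segre_index_def)
  have coord: "critical_vec n W ?c (x, y) (1, 0, 0) * W (0, 0, 0) = x * W (1, 0, 0) * critical_vec n W ?c (x, y) (0, 0, 0)"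
    "critical_vec n W ?c (x, y) (0, 1, 0) * W (0, 0, 0) = y * W (0, 1, 0) * critical_vec n W ?c (x, y) (0, 0, 0)" for x y
    using I0 by (auto simp: critical_vec_def scaled_segre_def affine_pt_def)
  show ?thesis
    unfolding bij_betw_def
  proof (intro conjI inj_onI equalityI subsetI)
    fix s t assume s: "s \<in> ?Sol" and t: "t \<in> ?Sol"
      and eq: "proj_point ?I (critical_vec n W ?c s) = proj_point ?I (critical_vec n W ?c t)"
    obtain x y x' y' where st: "s = (x, y)" "t = (x', y')" by (metis surj_pair)
    have "critical_vec n W ?c s \<in> proj_point ?I (critical_vec n W ?c t)"
      using sol(4)[of x y] s I0 eq unfolding st by blast
    then obtain d where d: "critical_vec n W ?c (x, y) = (\<lambda>i. d * critical_vec n W ?c (x', y') i)" 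
      by (auto simp: proj_point_def proportional_def st)
    define q where "q = critical_vec n W ?c (x', y')"
    have q: "critical_vec n W ?c (x, y) i = d * q i" for i using d by (simp add: q_def)
    have "d * q (0, 0, 0) \<noteq> 0"
      using sol(1)[of x y "(0, 0, 0)"] s I0 unfolding st by (simp add: q)
    moreover have "d * q (1, 0, 0) * W (0, 0, 0) = x * W (1, 0, 0) * (d * q (0, 0, 0))"
      "q (1, 0, 0) * W (0, 0, 0) = x' * W (1, 0, 0) * q (0, 0, 0)"
      using coord(1)[of x y] coord(1)[of x' y'] unfolding q by (simp_all add: q_def)
    moreover have "d * q (0, 1, 0) * W (0, 0, 0) = y * W (0, 1, 0) * (d * q (0, 0, 0))"
      "q (0, 1, 0) * W (0, 0, 0) = y' * W (0, 1, 0) * q (0, 0, 0)"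
      using coord(2)[of x y] coord(2)[of x' y'] unfolding q by (simp_all add: q_def)
    ultimately have "x * W (1, 0, 0) = x' * W (1, 0, 0)" "y * W (0, 1, 0) = y' * W (0, 1, 0)"
      by (auto simp: algebra_simps)
    then show "s = t" using W I0 st by auto
  next
    fix P assume "P \<in> (\<lambda>xy. proj_point ?I (critical_vec n W ?c xy)) ` ?Sol"
    then obtain x y where "(x, y) \<in> ?Sol" "P = proj_point ?I (critical_vec n W ?c (x, y))" by auto
    then show "P \<in> ?Crit" using sol(3) I0 by blast
  next
    fix P assume crit: "P \<in> ?Crit"
    then have PS: "P \<in> ?S" by (simp add: critical_points_def)
    then obtain x y z where P: "P = proj_point ?I (scaled_segre n W x y z)"
      and xyz: "x \<in> hcoords {0, 1}" "y \<in> hcoords {0, 1}" "z \<in> hcoords {0..n}"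
      by (auto simp: very_affine_part_def segre_variety_def)
    define q where "q = scaled_segre n W x y z"
    have "q \<in> hcoords ?I"
    proof -
      have "\<exists>q'. q' \<in> P" 
        using segre_variety_subset[OF W] PS in_quotient_imp_non_empty[OF equiv_proportional]
        unfolding very_affine_part_def proj_space_def by blast
      then show ?thesis by (auto simp: P proj_point_def proportional_def q_def)
    qed
    then have qP: "q \<in> P" unfolding P q_def by (rule proj_point_mem)
    have sm: "same_margins n v q"
      using same_margins_of_critical[OF crit qP q_def xyz] by (simp add: v_def)
    have qS: "q \<in> \<Union> ?S" using qP PS by blast
    note nz = Union_segre_variety(2,3)[OF qS]
    have xy0: "x 0 \<noteq> 0" "x 1 \<noteq> 0" "y 0 \<noteq> 0" "y 1 \<noteq> 0"
      using nz(1)[of "(0, 0, 0)"] nz(1)[of "(1, 0, 0)"] nz(1)[of "(0, 1, 0)"] I0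
      by (auto simp: q_def scaled_segre_def)
    define X where "X = x 1 / x 0"
    define Y where "Y = y 1 / y 0"
    have "X \<noteq> 0" "Y \<noteq> 0" using xy0 by (auto simp: X_def Y_def)
    define Z where "Z k = x 0 * y 0 * z k" for k
    have q: "q = scaled_segre n W (affine_pt X) (affine_pt Y) Z"
      using xy0 by (auto simp: q_def scaled_segre_def affine_pt_def X_def Y_def Z_def segre_index_def fun_eq_iff)
    define T where "T = margin_total n q / margin_total n v"
    have "T \<noteq> 0" using nz U by (simp add: T_def)
    have Zk: "Z k * curve W k X Y = T * ?c k" if "k \<le> n" for k
      using sm that U unfolding same_margins_def margins_scaled_segre_affine(1)[OF q that, symmetric]
      by (auto simp: T_def field_simps)
    have fk: "curve W k X Y \<noteq> 0" if "k \<le> n" for k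
      using Zk[OF that] c that \<open>T \<noteq> 0\<close> by auto
    have Zk': "Z k = T * (?c k / curve W k X Y)" if "k \<le> n" for k
      using Zk[OF that] fk[OF that] by (simp add: field_simps)
    have "margin_x n q = T * margin_x n v" "margin_y n q = T * margin_y n v"
      using sm U by (auto simp: same_margins_def T_def field_simps)
    moreover have "margin_x n q = T * (X * (\<Sum>k = 0..n. ?c k * curve_dx W k Y / curve W k X Y))"
      unfolding margins_scaled_segre_affine(2)[OF q] sum_distrib_left
      by (intro sum.cong) (auto simp: Zk')
    moreover have "margin_y n q = T * (Y * (\<Sum>k = 0..n. ?c k * curve_dy W k X / curve W k X Y))"
      unfolding margins_scaled_segre_affine(3)[OF q] sum_distrib_left
      by (intro sum.cong) (auto simp: Zk')
    ultimately have "(X, Y) \<in> ?Sol"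
      using \<open>T \<noteq> 0\<close> fk \<open>X \<noteq> 0\<close> \<open>Y \<noteq> 0\<close> by (simp add: score_solutions_def)
    moreover have "q = (\<lambda>i. T * critical_vec n W ?c (X, Y) i)"
      unfolding q critical_vec_def using Zk' by (auto simp: scaled_segre_def segre_index_def fun_eq_iff)
    then have "q \<in> proj_point ?I (critical_vec n W ?c (X, Y))"
      using sol(4)[OF \<open>(X, Y) \<in> ?Sol\<close> I0(1)] \<open>T \<noteq> 0\<close> \<open>q \<in> hcoords ?I\<close>
      by (auto simp: proj_point_def proportional_def)
    then have "P = proj_point ?I (critical_vec n W ?c (X, Y))"
      using proj_point_eqI unfolding P q_def by metis
    ultimately show "P \<in> (\<lambda>xy. proj_point ?I (critical_vec n W ?c xy)) ` ?Sol" by blast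
  qed
qed

section \<open>Test data and the passage to generic data\<close>

lemma poly_fun_margins:
  "poly_fun (segre_index n) (margin_x n)" "poly_fun (segre_index n) (margin_y n)"
  "k \<le> n \<Longrightarrow> poly_fun (segre_index n) (\<lambda>v. margin_z v k)"
  unfolding margin_x_def[abs_def] margin_y_def[abs_def] margin_z_def[abs_def]
  by (intro poly_fun_intros; simp add: segre_index_def)+

text \<open>A right inverse of the margins. The entry at \<open>(0, 0, 0)\<close> compensates for
  \<open>a\<close> and \<open>b\<close> in slice 0 and may well be negative.\<close>

definition data_with_margins :: "complex \<Rightarrow> complex \<Rightarrow> (nat \<Rightarrow> complex) \<Rightarrow> nat \<times> nat \<times> nat \<Rightarrow> complex" where
  "data_with_margins a b c = (\<lambda>(i, j, k). if (i, j, k) = (1, 0, 0) then a else if (i, j, k) = (0, 1, 0) then b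
     else if (i, j) = (0, 0) then c k - (if k = 0 then a + b else 0) else 0)"

lemma margins_data_with_margins:
  "margin_x n (data_with_margins a b c) = a" "margin_y n (data_with_margins a b c) = b"
  "margin_z (data_with_margins a b c) k = c k"
proof -
  have "(\<Sum>k = 0..n. if k = 0 then t else 0) = t" for t :: complex
    by (subst sum.delta) auto
  then show "margin_x n (data_with_margins a b c) = a" "margin_y n (data_with_margins a b c) = b"
    by (simp_all add: margin_x_def margin_y_def data_with_margins_def cong: if_cong)
  show "margin_z (data_with_margins a b c) k = c k"
    by (simp add: margin_z_def data_with_margins_def)
qed

lemma has_mldegI:
  assumes W: "\<forall>i\<in>segre_index n. W i \<noteq> 0"
    and gen: "generic (segre_index n) (\<lambda>v. finite (score_solutions n W (margin_x n v) (margin_y n v) (margin_z v)) \<and>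
      card (score_solutions n W (margin_x n v) (margin_y n v) (margin_z v)) = d)"
  shows "has_mldeg n W d"
proof -
  let ?I = "segre_index n"
  have "generic ?I (\<lambda>v. margin_total n v \<noteq> 0)"
  proof (rule generic_nonzero)
    show "poly_fun ?I (margin_total n)" unfolding margin_total_def[abs_def] by (intro poly_fun_intros poly_fun_margins) auto
    show "margin_total n (data_with_margins 0 0 (\<lambda>_. 1)) \<noteq> 0"
      by (simp add: margin_total_def margins_data_with_margins flip: of_nat_Suc)
  qed
  moreover have "generic ?I (\<lambda>v. \<forall>k\<in>{0..n}. margin_z v k \<noteq> 0)"
  proof (rule generic_ball)
    fix k assume "k \<in> {0..n}"
    then show "generic ?I (\<lambda>v. margin_z v k \<noteq> 0)"
      by (intro generic_nonzero[of _ _ "data_with_margins 0 0 (\<lambda>_. 1)"] poly_fun_margins)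
        (auto simp: margins_data_with_margins)
  qed simp
  ultimately have 1: "generic ?I (\<lambda>v. margin_total n v \<noteq> 0 \<and> (\<forall>k\<in>{0..n}. margin_z v k \<noteq> 0) \<and>
      finite (score_solutions n W (margin_x n v) (margin_y n v) (margin_z v)) \<and>
      card (score_solutions n W (margin_x n v) (margin_y n v) (margin_z v)) = d)"
    using generic_conj[OF _ generic_conj[OF _ gen]] by simp
  from generic_data_of_generic[OF 1] obtain g where g: "poly_fun ?I g" "\<exists>v. g v \<noteq> 0"
    "\<And>u. g (\<lambda>i. of_nat (u i)) \<noteq> 0 \<Longrightarrow> margin_total n (\<lambda>i. of_nat (u i)) \<noteq> 0 \<and>
      (\<forall>k\<in>{0..n}. margin_z (\<lambda>i. of_nat (u i)) k \<noteq> 0) \<and>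
      finite (score_solutions n W (margin_x n (\<lambda>i. of_nat (u i))) (margin_y n (\<lambda>i. of_nat (u i))) (margin_z (\<lambda>i. of_nat (u i)))) \<and>
      card (score_solutions n W (margin_x n (\<lambda>i. of_nat (u i))) (margin_y n (\<lambda>i. of_nat (u i))) (margin_z (\<lambda>i. of_nat (u i)))) = d"
    unfolding generic_data_def by blast
  show ?thesis
    unfolding has_mldeg_def Let_def generic_data_def
  proof (intro exI[of _ g] conjI allI impI g(1,2))
    fix u :: "nat \<times> nat \<times> nat \<Rightarrow> nat" assume "g (\<lambda>i. of_nat (u i)) \<noteq> 0"
    note gu = g(3)[OF this]
    have bij: "bij_betw (\<lambda>xy. proj_point ?I (critical_vec n W (margin_z (\<lambda>i. of_nat (u i))) xy))
      (score_solutions n W (margin_x n (\<lambda>i. of_nat (u i))) (margin_y n (\<lambda>i. of_nat (u i))) (margin_z (\<lambda>i. of_nat (u i))))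
      (critical_points ?I (very_affine_part ?I (segre_variety n W)) (likelihood ?I u))"
      using gu by (intro bij_betw_critical_points[OF W]) auto
    show "finite (critical_points ?I (very_affine_part ?I (segre_variety n W)) (likelihood ?I u))"
      using bij_betw_finite[OF bij] gu by blast
    show "card (critical_points ?I (very_affine_part ?I (segre_variety n W)) (likelihood ?I u)) = d"
      using bij_betw_same_card[OF bij] gu by simp
  qed
qed

section \<open>The Moebius arrangement\<close>

lemma homogeneous_system_nontrivial:
  fixes f :: "'i \<Rightarrow> 'k \<Rightarrow> complex"
  assumes "finite K" "finite I" "card K < card I"
  shows "\<exists>h. (\<exists>i\<in>I. h i \<noteq> 0) \<and> (\<forall>k\<in>K. (\<Sum>i\<in>I. h i * f i k) = 0)"
  using assms
proof (induction K arbitrary: I f rule: finite_induct)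
  case empty
  then have "I \<noteq> {}" by auto
  then show ?case by (intro exI[of _ "\<lambda>_. 1"]) auto
next
  case (insert k0 K)
  show ?case
  proof (cases "\<forall>i\<in>I. f i k0 = 0")
    case True
    obtain h where "\<exists>i\<in>I. h i \<noteq> 0" "\<forall>k\<in>K. (\<Sum>i\<in>I. h i * f i k) = 0"
      using insert.IH[of I f] insert.prems insert.hyps by auto
    with True show ?thesis by (intro exI[of _ h]) auto
  next
    case False
    then obtain i0 where i0: "i0 \<in> I" "f i0 k0 \<noteq> 0" by blast
    define f' where "f' i k = f i k - f i k0 / f i0 k0 * f i0 k" for i k
    have "card K < card (I - {i0})"
      using insert.prems insert.hyps i0(1) by (simp add: card_Diff_singleton)
    then obtain h where h: "\<exists>i\<in>I - {i0}. h i \<noteq> 0" "\<And>k. k \<in> K \<Longrightarrow> (\<Sum>i\<in>I - {i0}. h i * f' i k) = 0"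
      using insert.IH[of "I - {i0}" f'] insert.prems by blast
    define h' where "h' i = (if i = i0 then - (\<Sum>i\<in>I - {i0}. h i * f i k0 / f i0 k0) else h i)" for i
    have "(\<Sum>i\<in>I. h' i * f i k) = (\<Sum>i\<in>I - {i0}. h i * f' i k)" for k
    proof -
      have "(\<Sum>i\<in>I. h' i * f i k) = h' i0 * f i0 k + (\<Sum>i\<in>I - {i0}. h' i * f i k)"
        using insert.prems(1) i0(1) by (rule sum.remove)
      also have "(\<Sum>i\<in>I - {i0}. h' i * f i k) = (\<Sum>i\<in>I - {i0}. h i * f i k)"
        by (intro sum.cong) (auto simp: h'_def)
      also have "h' i0 * f i0 k = - (\<Sum>i\<in>I - {i0}. h i * (f i k0 / f i0 k0 * f i0 k))"
        by (simp add: h'_def sum_distrib_right mult.assoc)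
      finally show ?thesis by (simp add: f'_def right_diff_distrib sum_subtractf mult.assoc)
    qed
    moreover have "(\<Sum>i\<in>I - {i0}. h i * f' i k0) = 0"
      using i0 by (simp add: f'_def)
    moreover have "\<exists>i\<in>I. h' i \<noteq> 0" using h(1) by (auto simp: h'_def)
    ultimately show ?thesis using h(2) by (intro exI[of _ h']) auto
  qed
qed

text \<open>Among the iterates of \<open>w\<close> under \<open>T\<close> there is a linear relation
  on \<open>K\<close>, that is, a nonzero polynomial \<open>p\<close> in \<open>T\<close> that
  annihilates \<open>w\<close> on \<open>K\<close>; \<open>P p\<close> is \<open>p(T)\<close>
  applied to \<open>w\<close>. Splitting off linear factors as long as the cofactor still
  annihilates \<open>w\<close> ends at a cofactor that does not, and its value at \<open>w\<close>
  is the eigenvector. Vectors matter only through their values on \<open>K\<close>.\<close>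

lemma invariant_subspace_eigenvector:
  fixes T :: "('k \<Rightarrow> complex) \<Rightarrow> 'k \<Rightarrow> complex"
  assumes K: "finite K"
    and T: "\<And>(I :: nat set) h f. T (\<lambda>k. \<Sum>i\<in>I. h i * f i k) = (\<lambda>k. \<Sum>i\<in>I. h i * T (f i) k)"
    and V: "\<And>(I :: nat set) h f. (\<And>i. f i \<in> V) \<Longrightarrow> (\<lambda>k. \<Sum>i\<in>I. h i * f i k) \<in> V"
    and TV: "\<And>w. w \<in> V \<Longrightarrow> T w \<in> V"
    and w: "w \<in> V" "\<exists>k\<in>K. w k \<noteq> 0"
  shows "\<exists>w y. w \<in> V \<and> (\<exists>k\<in>K. w k \<noteq> 0) \<and> (\<forall>k\<in>K. T w k = y * w k)"
proof -
  define P where "P p = (\<lambda>k. \<Sum>i\<le>degree p. coeff p i * (T ^^ i) w k)" for p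
  have TwV: "(T ^^ i) w \<in> V" for i by (induction i) (auto intro: w TV)
  have P_eq: "P p = (\<lambda>k. \<Sum>i\<le>N. coeff p i * (T ^^ i) w k)" if "degree p \<le> N" for p N
    unfolding P_def using that by (intro ext sum.mono_neutral_left) (auto simp: coeff_eq_0)
  have PV: "P p \<in> V" for p unfolding P_def by (intro V TwV)
  have P_mult: "P ([:- z, 1:] * p) k = T (P p) k - z * P p k" for p z k
  proof -
    let ?n = "degree p"
    have "degree ([:- z, 1:] * p) \<le> Suc ?n"
      by (rule order_trans[OF degree_mult_le]) simp
    then have "P ([:- z, 1:] * p) k = (\<Sum>i\<le>Suc ?n. coeff ([:- z, 1:] * p) i * (T ^^ i) w k)"
      by (simp only: P_eq)
    also have "\<dots> = (\<Sum>i\<le>Suc ?n. coeff (pCons 0 p) i * (T ^^ i) w k) - z * (\<Sum>i\<le>Suc ?n. coeff p i * (T ^^ i) w k)"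
      by (simp add: sum_distrib_left sum_subtractf left_diff_distrib mult.assoc del: sum.atMost_Suc)
    also have "(\<Sum>i\<le>Suc ?n. coeff (pCons 0 p) i * (T ^^ i) w k) = (\<Sum>i\<le>?n. coeff p i * (T ^^ Suc i) w k)"
      by (subst sum.atMost_Suc_shift) simp
    also have "\<dots> = T (P p) k"
      by (simp add: P_def T)
    also have "(\<Sum>i\<le>Suc ?n. coeff p i * (T ^^ i) w k) = P p k"
      using P_eq[of p "Suc ?n"] by simp
    finally show ?thesis .
  qed
  have main: "\<exists>w y. w \<in> V \<and> (\<exists>k\<in>K. w k \<noteq> 0) \<and> (\<forall>k\<in>K. T w k = y * w k)"
    if "degree p = d" "p \<noteq> 0" "\<forall>k\<in>K. P p k = 0" for p d
    using that
  proof (induction d arbitrary: p)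
    case 0
    then obtain c where "p = [:c:]" "c \<noteq> 0" by (metis degree_eq_zeroE pCons_0_0)
    then show ?case using 0 w(2) by (auto simp: P_def)
  next
    case (Suc d)
    then have "\<not> constant (poly p)" by (simp add: constant_degree)
    then obtain z where "poly p z = 0" using fundamental_theorem_of_algebra by blast
    then obtain p' where p': "p = [:- z, 1:] * p'" by (metis poly_eq_0_iff_dvd dvdE)
    then have "p' \<noteq> 0" using Suc.prems by auto
    then have "degree p = Suc (degree p')" unfolding p' by (subst degree_mult_eq) auto
    then have "degree p' = d" using Suc.prems(1) by simp
    show ?case
    proof (cases "\<forall>k\<in>K. P p' k = 0")
      case True
      then show ?thesis using Suc.IH \<open>degree p' = d\<close> \<open>p' \<noteq> 0\<close> by blast
    next
      case False
      moreover have "\<forall>k\<in>K. T (P p') k = z * P p' k"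
        using Suc.prems(3) unfolding p' P_mult by simp
      ultimately show ?thesis using PV by blast
    qed
  qed
  obtain h where h: "\<exists>i\<in>{..card K}. h i \<noteq> 0" "\<And>k. k \<in> K \<Longrightarrow> (\<Sum>i\<in>{..card K}. h i * (T ^^ i) w k) = 0"
    using homogeneous_system_nontrivial[OF K, of "{..card K}" "\<lambda>i. (T ^^ i) w"] by auto
  define p where "p = (\<Sum>i\<le>card K. monom (h i) i)"
  have coeff_p: "coeff p i = (if i \<le> card K then h i else 0)" for i
    unfolding p_def by (simp add: coeff_sum)
  have "p \<noteq> 0" using h(1) coeff_p by (metis atMost_iff coeff_0)
  moreover have "degree p \<le> card K" by (rule degree_le) (simp add: coeff_p)
  then have "\<forall>k\<in>K. P p k = 0" using h(2) by (simp add: P_eq coeff_p)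
  ultimately show ?thesis using main by blast
qed

text \<open>
  The matrix \<open>w \<mapsto> (\<Sum>k. c k * \<delta> k l * (w l - w k))\<close> is the connection matrix of
  the family of functions \<open>\<Prod>k. (y - \<phi> k) powr c k\<close> of \<open>y\<close>. It commutes with
  \<open>Y w l = \<phi> l * w l + q w\<close>, the multiplication by \<open>y\<close> on the algebra of functions on the
  critical points, in which \<open>w l\<close> stands for \<open>1 / (y - \<phi> l)\<close>.
\<close>

lemma connection_eigenvector:
  fixes c \<phi> \<phi>' :: "nat \<Rightarrow> complex" and \<delta> :: "nat \<Rightarrow> nat \<Rightarrow> complex"
  assumes K: "finite K" and c: "\<And>k. k \<in> K \<Longrightarrow> c k \<noteq> 0" and C: "(\<Sum>k\<in>K. c k) \<noteq> 0" and inj: "inj_on \<phi> K"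
    and \<delta>: "\<And>k l. k \<in> K \<Longrightarrow> l \<in> K \<Longrightarrow> \<delta> k l * (\<phi> l - \<phi> k) = \<phi>' l - \<phi>' k"
      "\<And>k l. k \<in> K \<Longrightarrow> l \<in> K \<Longrightarrow> \<delta> k l = \<delta> l k"
    and w: "(\<Sum>k\<in>K. c k * w k) = 0" "\<And>l. l \<in> K \<Longrightarrow> \<sigma> * w l = (\<Sum>k\<in>K. c k * \<delta> k l * (w l - w k))"
      "\<exists>k\<in>K. w k \<noteq> 0"
  shows "\<exists>y. (\<forall>k\<in>K. y \<noteq> \<phi> k) \<and> (\<Sum>k\<in>K. c k / (y - \<phi> k)) = 0 \<and> \<sigma> = - (\<Sum>k\<in>K. c k * \<phi>' k / (y - \<phi> k))"
proof -
  define C where "C = (\<Sum>k\<in>K. c k)"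
  have "C \<noteq> 0" using C by (simp add: C_def)
  define q where "q w = - (\<Sum>k\<in>K. c k * \<phi> k * w k) / C" for w :: "nat \<Rightarrow> complex"
  define Y where "Y w = (\<lambda>l. \<phi> l * w l + q w)" for w :: "nat \<Rightarrow> complex"
  define V where "V = {w. (\<Sum>k\<in>K. c k * w k) = 0 \<and> (\<forall>l\<in>K. \<sigma> * w l = (\<Sum>k\<in>K. c k * \<delta> k l * (w l - w k)))}"
  have q_sum: "q (\<lambda>k. \<Sum>i\<in>I. h i * f i k) = (\<Sum>i\<in>I. h i * q (f i))" for I :: "nat set" and h f
  proof -
    have "(\<Sum>k\<in>K. c k * \<phi> k * (\<Sum>i\<in>I. h i * f i k)) = (\<Sum>i\<in>I. h i * (\<Sum>k\<in>K. c k * \<phi> k * f i k))"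
      unfolding sum_distrib_left by (subst sum.swap) (simp add: mult_ac)
    then show ?thesis by (simp add: q_def sum_negf sum_divide_distrib[symmetric])
  qed
  have Y_sum: "Y (\<lambda>k. \<Sum>i\<in>I. h i * f i k) = (\<lambda>k. \<Sum>i\<in>I. h i * Y (f i) k)" for I :: "nat set" and h f
    unfolding Y_def q_sum by (simp add: sum_distrib_left sum.distrib algebra_simps)
  have V_sum: "(\<lambda>k. \<Sum>i\<in>I. h i * f i k) \<in> V" if f: "\<And>i. f i \<in> V" for I :: "nat set" and h f
  proof -
    have "(\<Sum>k\<in>K. c k * (\<Sum>i\<in>I. h i * f i k)) = (\<Sum>i\<in>I. h i * (\<Sum>k\<in>K. c k * f i k))"
      unfolding sum_distrib_left by (subst sum.swap) (simp add: mult_ac)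
    also have "\<dots> = 0" using f by (simp add: V_def)
    finally have 1: "(\<Sum>k\<in>K. c k * (\<Sum>i\<in>I. h i * f i k)) = 0" .
    have 2: "\<sigma> * (\<Sum>i\<in>I. h i * f i l) = (\<Sum>k\<in>K. c k * \<delta> k l * ((\<Sum>i\<in>I. h i * f i l) - (\<Sum>i\<in>I. h i * f i k)))"
      if "l \<in> K" for l
    proof -
      have "(\<Sum>k\<in>K. c k * \<delta> k l * ((\<Sum>i\<in>I. h i * f i l) - (\<Sum>i\<in>I. h i * f i k))) =
          (\<Sum>i\<in>I. h i * (\<Sum>k\<in>K. c k * \<delta> k l * (f i l - f i k)))"
        unfolding sum_subtractf[symmetric] sum_distrib_left by (subst sum.swap) (simp add: algebra_simps)
      also have "\<dots> = (\<Sum>i\<in>I. h i * (\<sigma> * f i l))"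
        using f that by (simp add: V_def)
      finally show ?thesis by (simp add: sum_distrib_left mult_ac)
    qed
    show ?thesis unfolding V_def using 1 2 by blast
  qed
  have YV: "Y w \<in> V" if "w \<in> V" for w
  proof -
    have cw: "(\<Sum>k\<in>K. c k * w k) = 0" and \<sigma>w: "\<And>l. l \<in> K \<Longrightarrow> \<sigma> * w l = (\<Sum>k\<in>K. c k * \<delta> k l * (w l - w k))"
      using that by (auto simp: V_def)
    have "(\<Sum>k\<in>K. c k * Y w k) = (\<Sum>k\<in>K. c k * \<phi> k * w k) + C * q w"
      by (simp add: Y_def C_def distrib_left sum.distrib sum_distrib_right mult.assoc)
    also have "\<dots> = 0" using \<open>C \<noteq> 0\<close> by (simp add: q_def)
    finally have 1: "(\<Sum>k\<in>K. c k * Y w k) = 0" .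
    define D where "D = (\<Sum>k\<in>K. c k * \<phi>' k * w k)"
    define E where "E = (\<Sum>k\<in>K. c k * \<phi>' k)"
    have swap: "(\<Sum>l\<in>K. \<Sum>k\<in>K. f l k) = (\<Sum>l\<in>K. \<Sum>k\<in>K. f k l)" for f :: "nat \<Rightarrow> nat \<Rightarrow> complex"
      by (rule sum.swap)
    \<comment> \<open>Evaluating \<open>X\<close> twice with \<open>k\<close> and \<open>l\<close>
      exchanged and adding replaces \<open>\<delta> k l * \<phi> l\<close> by
      \<open>\<delta> k l * (\<phi> l - \<phi> k)\<close>, which is known. The outcome
      \<open>\<sigma> * q w = - D\<close> is what makes the eigenspace invariant under
      \<open>Y\<close>.\<close>
    define X where "X = \<sigma> * (\<Sum>l\<in>K. c l * \<phi> l * w l)"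
    have X1: "X = (\<Sum>l\<in>K. \<Sum>k\<in>K. c l * c k * \<delta> k l * \<phi> l * (w l - w k))"
    proof -
      have "X = (\<Sum>l\<in>K. c l * \<phi> l * (\<sigma> * w l))"
        by (simp add: X_def sum_distrib_left mult_ac)
      also have "\<dots> = (\<Sum>l\<in>K. c l * \<phi> l * (\<Sum>k\<in>K. c k * \<delta> k l * (w l - w k)))"
        by (intro sum.cong refl) (simp add: \<sigma>w)
      finally show ?thesis by (simp add: sum_distrib_left mult_ac)
    qed
    have X2: "X = (\<Sum>l\<in>K. \<Sum>k\<in>K. - (c l * c k * \<delta> k l * \<phi> k * (w l - w k)))"
      unfolding X1 by (subst swap) (intro sum.cong refl, use \<delta>(2) in \<open>auto simp: algebra_simps\<close>)
    have "2 * X = (\<Sum>l\<in>K. \<Sum>k\<in>K. c l * c k * (\<delta> k l * (\<phi> l - \<phi> k)) * (w l - w k))"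
      unfolding mult_2 by (subst (1) X1, subst X2)
        (simp add: sum.distrib[symmetric] algebra_simps)
    also have "\<dots> = (\<Sum>l\<in>K. \<Sum>k\<in>K. c l * c k * (\<phi>' l - \<phi>' k) * (w l - w k))"
      by (intro sum.cong refl) (simp add: \<delta>(1))
    also have "\<dots> = (\<Sum>l\<in>K. \<Sum>k\<in>K. c l * \<phi>' l * w l * c k) - (\<Sum>l\<in>K. \<Sum>k\<in>K. c l * \<phi>' l * (c k * w k))
        - (\<Sum>l\<in>K. \<Sum>k\<in>K. c l * w l * (c k * \<phi>' k)) + (\<Sum>l\<in>K. \<Sum>k\<in>K. c l * (c k * \<phi>' k * w k))"
      by (simp add: sum.distrib[symmetric] sum_subtractf[symmetric] algebra_simps)
    also have "\<dots> = 2 * (C * D)"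
      unfolding sum_product[symmetric] cw C_def D_def by simp
    finally have X: "X = C * D" by simp
    have \<sigma>q: "\<sigma> * q w = - D"
      using X \<open>C \<noteq> 0\<close> by (simp add: q_def X_def field_simps)
    have 2: "\<sigma> * Y w l = (\<Sum>k\<in>K. c k * \<delta> k l * (Y w l - Y w k))" if l: "l \<in> K" for l
    proof -
      have "(\<Sum>k\<in>K. c k * \<delta> k l * (Y w l - Y w k)) =
          (\<Sum>k\<in>K. \<phi> l * (c k * \<delta> k l * (w l - w k)) + c k * (\<delta> k l * (\<phi> l - \<phi> k)) * w k)"
        by (intro sum.cong refl) (simp add: Y_def algebra_simps)
      also have "\<dots> = \<phi> l * (\<sigma> * w l) + (\<Sum>k\<in>K. c k * (\<delta> k l * (\<phi> l - \<phi> k)) * w k)"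
        unfolding \<sigma>w[OF l] by (simp add: sum.distrib sum_distrib_left)
      also have "(\<Sum>k\<in>K. c k * (\<delta> k l * (\<phi> l - \<phi> k)) * w k) = (\<Sum>k\<in>K. \<phi>' l * (c k * w k) - c k * \<phi>' k * w k)"
      proof (intro sum.cong refl)
        fix k assume k: "k \<in> K"
        show "c k * (\<delta> k l * (\<phi> l - \<phi> k)) * w k = \<phi>' l * (c k * w k) - c k * \<phi>' k * w k"
          unfolding \<delta>(1)[OF k l] by (simp add: algebra_simps)
      qed
      also have "\<dots> = - D"
        by (simp add: sum_subtractf sum_distrib_left[symmetric] cw D_def)
      finally show ?thesis using \<sigma>q by (simp add: Y_def algebra_simps)
    qed
    show ?thesis unfolding V_def using 1 2 by blast
  qed
  have "w \<in> V" using w by (simp add: V_def)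
  have "\<exists>w y. w \<in> V \<and> (\<exists>k\<in>K. w k \<noteq> 0) \<and> (\<forall>k\<in>K. Y w k = y * w k)"
  proof (rule invariant_subspace_eigenvector[of K Y V w])
    show "Y (\<lambda>k. \<Sum>i\<in>I. h i * f i k) = (\<lambda>k. \<Sum>i\<in>I. h i * Y (f i) k)" for I :: "nat set" and h f
      by (rule Y_sum)
    show "(\<lambda>k. \<Sum>i\<in>I. h i * f i k) \<in> V" if "\<And>i. f i \<in> V" for I :: "nat set" and h f
      using that by (rule V_sum)
    show "Y w \<in> V" if "w \<in> V" for w using that by (rule YV)
  qed fact+
  then obtain w y where wV: "w \<in> V" and w0: "\<exists>k\<in>K. w k \<noteq> 0" and Yw: "\<And>k. k \<in> K \<Longrightarrow> Y w k = y * w k"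
    by blast
  have eig: "(y - \<phi> k) * w k = q w" if "k \<in> K" for k
    using Yw[OF that] by (simp add: Y_def algebra_simps)
  \<comment> \<open>Otherwise \<open>y\<close> is one of the \<open>\<phi> k\<close>, by injectivity
    \<open>w\<close> is supported at this single index, and its weighted sum cannot vanish. This is
    what keeps \<open>y\<close> off every curve.\<close>
  have "q w \<noteq> 0"
  proof
    assume q0: "q w = 0"
    obtain k0 where k0: "k0 \<in> K" "w k0 \<noteq> 0" using w0 by blast
    then have "y = \<phi> k0" using eig[OF k0(1)] q0 by simp
    then have "w k = 0" if "k \<in> K" "k \<noteq> k0" for k
      using eig[OF that(1)] q0 inj that k0(1) by (auto simp: inj_on_eq_iff)
    then have "(\<Sum>k\<in>K. c k * w k) = (\<Sum>k\<in>{k0}. c k * w k)"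
      using K k0 by (intro sum.mono_neutral_right) auto
    then show False using wV c[OF k0(1)] k0 by (simp add: V_def)
  qed
  have y: "y \<noteq> \<phi> k" if "k \<in> K" for k using eig[OF that] \<open>q w \<noteq> 0\<close> by auto
  have wk: "w k = q w / (y - \<phi> k)" if "k \<in> K" for k
    using eig[OF that] y[OF that] by (simp add: field_simps)
  have "(\<Sum>k\<in>K. c k * w k) = q w * (\<Sum>k\<in>K. c k / (y - \<phi> k))"
    unfolding sum_distrib_left by (intro sum.cong) (auto simp: wk)
  then have cy: "(\<Sum>k\<in>K. c k / (y - \<phi> k)) = 0"
    using wV \<open>q w \<noteq> 0\<close> by (simp add: V_def)
  obtain l where l: "l \<in> K" "w l \<noteq> 0" using w0 by blast
  have "\<sigma> * w l = (\<Sum>k\<in>K. c k * \<delta> k l * (w l - w k))" using wV l by (simp add: V_def)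
  also have "\<dots> = (\<Sum>k\<in>K. w l * (\<phi>' l * (c k / (y - \<phi> k)) - c k * \<phi>' k / (y - \<phi> k)))"
  proof (intro sum.cong refl)
    fix k assume k: "k \<in> K"
    have "w l - w k = (\<phi> l - \<phi> k) * (w l / (y - \<phi> k))"
      using y[OF k] y[OF l(1)] unfolding wk[OF k] wk[OF l(1)] by (simp add: field_simps)
    then have "c k * \<delta> k l * (w l - w k) = c k * (\<delta> k l * (\<phi> l - \<phi> k)) * (w l / (y - \<phi> k))"
      by simp
    then show "c k * \<delta> k l * (w l - w k) = w l * (\<phi>' l * (c k / (y - \<phi> k)) - c k * \<phi>' k / (y - \<phi> k))"
      unfolding \<delta>(1)[OF k l(1)] by (simp add: diff_divide_distrib algebra_simps)
  qed
  also have "\<dots> = w l * (\<phi>' l * (\<Sum>k\<in>K. c k / (y - \<phi> k)) - (\<Sum>k\<in>K. c k * \<phi>' k / (y - \<phi> k)))"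
    by (simp only: sum_distrib_left sum_subtractf right_diff_distrib)
  finally have "w l * \<sigma> = w l * - (\<Sum>k\<in>K. c k * \<phi>' k / (y - \<phi> k))"
    by (simp add: cy mult.commute)
  then have "\<sigma> = - (\<Sum>k\<in>K. c k * \<phi>' k / (y - \<phi> k))"
    using l(2) unfolding mult_cancel_left by simp
  then show ?thesis using y cy by blast
qed

text \<open>The derivative of \<open>q / b - p / a\<close>, computed from the derivative of the
  determinant \<open>a * q - b * p\<close>. Here \<open>u\<close>, \<open>v\<close>,
  \<open>p'\<close>, \<open>q'\<close> play the part of the derivatives of \<open>a\<close>,
  \<open>b\<close>, \<open>p\<close>, \<open>q\<close>.\<close>

lemma log_derivative_quotient_diff:
  fixes a b :: complex
  assumes "a \<noteq> 0" "b \<noteq> 0"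
  shows "(u * q + a * q' - v * p - b * p') / (a * b) - (u / a + v / b) * (q / b - p / a) =
    (q' * b - v * q) / b\<^sup>2 - (p' * a - u * p) / a\<^sup>2"
  using assms by (simp add: power2_eq_square add_divide_distrib diff_divide_distrib algebra_simps)

text \<open>
  Curve \<open>l\<close> is the zero set of \<open>(A l + s l * x) - (1 + t l * x) * y\<close>. Curve 0 is \<open>y = 0\<close>; giving it
  the weight \<open>- b\<close> makes the \<open>y\<close>-equation homogeneous. The collision of curve \<open>j\<close> with \<open>y = \<infinity>\<close> is
  \<open>Pole j\<close>. The collisions \<open>CrossZero\<close> at \<open>x = 0\<close>, which lie outside the torus, contribute constant
  rows to the pencil.
\<close>

datatype collision = Pole nat | Cross nat nat complex | CrossZero nat nat

text \<open>\<open>S k l\<close> holds the crossings of curves \<open>k\<close> and \<open>l\<close>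
  at \<open>x \<noteq> 0\<close>, each of them simple, and \<open>\<epsilon> k l\<close> is their
  order of contact at \<open>x = 0\<close>, which may be arbitrary. Crossings at
  \<open>x = \<infinity>\<close> show only as a lower degree of the right side and need no row in
  the pencil.\<close>

locale mobius_arrangement =
  fixes m :: nat and A s t :: "nat \<Rightarrow> complex" and S :: "nat \<Rightarrow> nat \<Rightarrow> complex set"
    and \<epsilon> :: "nat \<Rightarrow> nat \<Rightarrow> nat" and \<kappa> :: "nat \<Rightarrow> nat \<Rightarrow> complex" and pole :: "collision \<Rightarrow> complex"
  defines "pole \<equiv> \<lambda>i. case i of Pole j \<Rightarrow> - 1 / t j | Cross k l \<rho> \<Rightarrow> \<rho> | CrossZero k l \<Rightarrow> 0"
  assumes m: "1 \<le> m"
    and zero: "A 0 = 0" "s 0 = 0" "t 0 = 0"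
    and nonzero: "\<And>l. 1 \<le> l \<Longrightarrow> l \<le> m \<Longrightarrow> A l \<noteq> 0 \<and> s l \<noteq> 0 \<and> t l \<noteq> 0"
    and S: "\<And>k l. k < l \<Longrightarrow> l \<le> m \<Longrightarrow> finite (S k l) \<and> 0 \<notin> S k l"
    and \<kappa>: "\<And>k l. k < l \<Longrightarrow> l \<le> m \<Longrightarrow> \<kappa> k l \<noteq> 0"
    and collision: "\<And>k l x. k < l \<Longrightarrow> l \<le> m \<Longrightarrow>
      (1 + t k * x) * (A l + s l * x) - (1 + t l * x) * (A k + s k * x) =
        \<kappa> k l * x ^ \<epsilon> k l * (\<Prod>\<rho>\<in>S k l. x - \<rho>)"
    and inj_pole: "inj_on pole (Pole ` {1..m} \<union> (\<lambda>(l, k, \<rho>). Cross k l \<rho>) ` (SIGMA l:{..m}. SIGMA k:{..<l}. S k l))"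
begin

definition num :: "nat \<Rightarrow> complex \<Rightarrow> complex" where "num l x = A l + s l * x"
definition den :: "nat \<Rightarrow> complex \<Rightarrow> complex" where "den l x = 1 + t l * x"
definition form :: "nat \<Rightarrow> complex \<Rightarrow> complex \<Rightarrow> complex" where "form l x y = num l x - den l x * y"
definition slope :: "nat \<Rightarrow> complex \<Rightarrow> complex" where "slope l y = s l - t l * y"

definition cross :: "nat \<Rightarrow> nat \<Rightarrow> complex \<Rightarrow> complex" where
  "cross k l x = den k x * num l x - den l x * num k x"

definition dcross :: "nat \<Rightarrow> nat \<Rightarrow> complex \<Rightarrow> complex" where
  "dcross k l x = t k * num l x + den k x * s l - t l * num k x - den l x * s k"

definition J1 :: "collision set" where
  "J1 = Pole ` {1..m} \<union> (\<lambda>(l, k, \<rho>). Cross k l \<rho>) ` (SIGMA l:{..m}. SIGMA k:{..<l}. S k l)"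

text \<open>All pairs occur, also those with \<open>\<epsilon> k l = 0\<close>, whose left factor is
  zero. Their kernel coordinates still record the differences \<open>w l - w k\<close>, from which
  \<open>y\<close> is recovered in \<open>sols_inj\<close>.\<close>

definition J0 :: "collision set" where
  "J0 = (\<lambda>(l, k). CrossZero k l) ` (SIGMA l:{..m}. {..<l})"

definition J :: "collision set" where "J = J1 \<union> J0"

text \<open>The residue at collision \<open>i\<close> sends \<open>w\<close> to
  \<open>residue_left c i\<close> times \<open>residue_right i w\<close>. A crossing of
  \<open>k\<close> and \<open>l\<close> sees only \<open>w l - w k\<close>, a pole of curve
  \<open>j\<close> only \<open>w j\<close>.\<close>

definition residue_left :: "(nat \<Rightarrow> complex) \<Rightarrow> collision \<Rightarrow> nat \<Rightarrow> complex" where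
  "residue_left c i l = (case i of
      Pole j \<Rightarrow> c j - (if l = j then \<Sum>k\<le>m. c k else 0)
    | Cross k k' \<rho> \<Rightarrow> (if l = k' then c k else 0) - (if l = k then c k' else 0)
    | CrossZero k k' \<Rightarrow> of_nat (\<epsilon> k k') * ((if l = k' then c k else 0) - (if l = k then c k' else 0)))"

definition residue_right :: "collision \<Rightarrow> (nat \<Rightarrow> complex) \<Rightarrow> complex" where
  "residue_right i w = (case i of Pole j \<Rightarrow> w j | Cross k l \<rho> \<Rightarrow> w l - w k | CrossZero k l \<Rightarrow> w l - w k)"

text \<open>Put \<open>\<xi> i = residue_right i w / (x - pole i)\<close>. Then the system saying
  that \<open>a * w\<close> equals \<open>x\<close> times the sum of the residues applied to
  \<open>w\<close>, each over \<open>x - pole i\<close>, turns into the pencil for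
  \<open>\<xi>\<close>, whose coefficients are these products.\<close>

definition gram :: "(nat \<Rightarrow> complex) \<Rightarrow> collision \<Rightarrow> collision \<Rightarrow> complex" where
  "gram c i j = residue_right i (residue_left c j)"

text \<open>\<open>slope\<close> and \<open>- den\<close> are the partial derivatives of
  \<open>form\<close>, so the two sums are the \<open>y\<close>-equation, homogeneous thanks to
  curve 0, and the \<open>x\<close>-equation.\<close>

definition sols :: "(nat \<Rightarrow> complex) \<Rightarrow> complex \<Rightarrow> (complex \<times> complex) set" where
  "sols c a = {(x, y). x \<noteq> 0 \<and> (\<forall>k\<le>m. form k x y \<noteq> 0) \<and>
     (\<Sum>k\<le>m. c k * den k x / form k x y) = 0 \<and> x * (\<Sum>k\<le>m. c k * slope k y / form k x y) = a}"

lemma pole_simps: "pole (Pole j) = - 1 / t j" "pole (Cross k l \<rho>) = \<rho>" "pole (CrossZero k l) = 0"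
  by (simp_all add: pole_def)

lemma finite_J1: "finite J1"
  unfolding J1_def using S by (auto intro!: finite_imageI finite_SigmaI)

lemma finite_J: "finite J"
  unfolding J_def using finite_J1 by (auto simp: J0_def intro!: finite_imageI finite_SigmaI)

lemma J_diff: "J - J0 = J1"
  by (auto simp: J_def J1_def J0_def)

lemma Pole_J: "1 \<le> j \<Longrightarrow> j \<le> m \<Longrightarrow> Pole j \<in> J1"
  by (simp add: J1_def)

lemma Cross_J: "k < l \<Longrightarrow> l \<le> m \<Longrightarrow> \<rho> \<in> S k l \<Longrightarrow> Cross k l \<rho> \<in> J1"
  unfolding J1_def by (intro UnI2 image_eqI[of _ _ "(l, k, \<rho>)"]) auto

lemma CrossZero_J: "k < l \<Longrightarrow> l \<le> m \<Longrightarrow> CrossZero k l \<in> J0"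
  unfolding J0_def by (intro image_eqI[of _ _ "(l, k)"]) auto

lemma J_cases:
  assumes "i \<in> J"
  obtains j where "i = Pole j" "1 \<le> j" "j \<le> m" "i \<in> J1" "i \<notin> J0"
    | k l \<rho> where "i = Cross k l \<rho>" "k < l" "l \<le> m" "\<rho> \<in> S k l" "i \<in> J1" "i \<notin> J0"
    | k l where "i = CrossZero k l" "k < l" "l \<le> m" "i \<in> J0"
proof -
  consider j where "i = Pole j" "j \<in> {1..m}"
    | k l \<rho> where "i = Cross k l \<rho>" "k < l" "l \<le> m" "\<rho> \<in> S k l"
    | k l where "i = CrossZero k l" "k < l" "l \<le> m"
    using assms unfolding J_def J1_def J0_def by auto
  then show thesis
  proof cases
    case (1 j)
    moreover have "i \<notin> J0" by (auto simp: 1 J0_def)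
    ultimately show ?thesis using that(1)[of j] Pole_J[of j] by simp
  next
    case (2 k l \<rho>)
    moreover have "i \<notin> J0" by (auto simp: 2 J0_def)
    ultimately show ?thesis using that(2)[of k l \<rho>] Cross_J[of k l \<rho>] by simp
  next
    case (3 k l)
    then show ?thesis using that(3)[of k l] CrossZero_J[of k l] by simp
  qed
qed

section \<open>Sums over the collisions\<close>

lemma sum_J1:
  fixes f :: "collision \<Rightarrow> 'a :: comm_monoid_add"
  shows "(\<Sum>j\<in>J1. f j) = (\<Sum>j = 1..m. f (Pole j)) + (\<Sum>l\<le>m. \<Sum>k<l. \<Sum>\<rho>\<in>S k l. f (Cross k l \<rho>))"
proof -
  have fin: "finite (SIGMA l:{..m}. SIGMA k:{..<l}. S k l)" using S by (auto intro!: finite_SigmaI)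
  have "(\<Sum>j\<in>J1. f j) = (\<Sum>j\<in>Pole ` {1..m}. f j) +
      (\<Sum>j\<in>(\<lambda>(l, k, \<rho>). Cross k l \<rho>) ` (SIGMA l:{..m}. SIGMA k:{..<l}. S k l). f j)"
    unfolding J1_def using fin by (intro sum.union_disjoint) auto
  also have "(\<Sum>j\<in>Pole ` {1..m}. f j) = (\<Sum>j = 1..m. f (Pole j))"
    by (subst sum.reindex) (auto simp: inj_on_def)
  also have "(\<Sum>j\<in>(\<lambda>(l, k, \<rho>). Cross k l \<rho>) ` (SIGMA l:{..m}. SIGMA k:{..<l}. S k l). f j) =
      (\<Sum>(l, k, \<rho>)\<in>(SIGMA l:{..m}. SIGMA k:{..<l}. S k l). f (Cross k l \<rho>))"
    by (subst sum.reindex) (auto simp: inj_on_def intro!: sum.cong)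
  also have "\<dots> = (\<Sum>l\<le>m. \<Sum>(k, \<rho>)\<in>(SIGMA k:{..<l}. S k l). f (Cross k l \<rho>))"
    using S by (subst sum.Sigma) (auto intro!: finite_SigmaI)
  also have "\<dots> = (\<Sum>l\<le>m. \<Sum>k<l. \<Sum>\<rho>\<in>S k l. f (Cross k l \<rho>))"
    using S by (intro sum.cong refl, subst sum.Sigma) auto
  finally show ?thesis .
qed

lemma card_J1: "card J1 = m + (\<Sum>l\<le>m. \<Sum>k<l. card (S k l))"
  using sum_J1[of "\<lambda>_. 1 :: nat"] by simp

lemma sum_J:
  fixes f :: "collision \<Rightarrow> 'a :: comm_monoid_add"
  shows "(\<Sum>j\<in>J. f j) = (\<Sum>j = 1..m. f (Pole j)) +
    (\<Sum>l\<le>m. \<Sum>k<l. (\<Sum>\<rho>\<in>S k l. f (Cross k l \<rho>)) + f (CrossZero k l))"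
proof -
  have "(\<Sum>j\<in>J0. f j) = (\<Sum>(l, k)\<in>(SIGMA l:{..m}. {..<l}). f (CrossZero k l))"
    unfolding J0_def by (subst sum.reindex) (auto simp: inj_on_def intro!: sum.cong)
  also have "\<dots> = (\<Sum>l\<le>m. \<Sum>k<l. f (CrossZero k l))"
    by (subst sum.Sigma) auto
  finally have "(\<Sum>j\<in>J0. f j) = (\<Sum>l\<le>m. \<Sum>k<l. f (CrossZero k l))" .
  moreover have "(\<Sum>j\<in>J. f j) = (\<Sum>j\<in>J1. f j) + (\<Sum>j\<in>J0. f j)"
    unfolding J_def using finite_J by (intro sum.union_disjoint) (auto simp: J_def J1_def J0_def)
  ultimately show ?thesis by (simp add: sum_J1 sum.distrib add.assoc)
qed

text \<open>Crossings are recorded for \<open>k < l\<close> only. The antisymmetric extension lets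
  row \<open>l\<close> of the linear system be written as a sum over all curves
  \<open>k\<close>.\<close>

definition antisym_pair :: "(nat \<Rightarrow> nat \<Rightarrow> complex) \<Rightarrow> nat \<Rightarrow> nat \<Rightarrow> complex" where
  "antisym_pair h k l = (if k < l then h k l else if l < k then - h l k else 0)"

lemma sum_residue_left:
  assumes l: "l \<le> m"
  shows "(\<Sum>j\<in>J. \<xi> j * residue_left c j l) =
    (\<Sum>j = 1..m. c j * \<xi> (Pole j)) - (if l = 0 then 0 else (\<Sum>k\<le>m. c k) * \<xi> (Pole l)) +
    (\<Sum>k\<le>m. c k * antisym_pair (\<lambda>k l. (\<Sum>\<rho>\<in>S k l. \<xi> (Cross k l \<rho>)) + of_nat (\<epsilon> k l) * \<xi> (CrossZero k l)) k l)"
proof -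
  define h where "h k l = (\<Sum>\<rho>\<in>S k l. \<xi> (Cross k l \<rho>)) + of_nat (\<epsilon> k l) * \<xi> (CrossZero k l)" for k l
  define C where "C = (\<Sum>k\<le>m. c k)"
  have "(\<Sum>j = 1..m. \<xi> (Pole j) * residue_left c (Pole j) l) =
      (\<Sum>j = 1..m. c j * \<xi> (Pole j) - (if l = j then C * \<xi> (Pole j) else 0))"
    by (intro sum.cong refl) (simp add: residue_left_def C_def algebra_simps)
  also have "\<dots> = (\<Sum>j = 1..m. c j * \<xi> (Pole j)) - (if l = 0 then 0 else C * \<xi> (Pole l))"
    using l by (simp add: sum_subtractf)
  finally have 1: "(\<Sum>j = 1..m. \<xi> (Pole j) * residue_left c (Pole j) l) =
      (\<Sum>j = 1..m. c j * \<xi> (Pole j)) - (if l = 0 then 0 else C * \<xi> (Pole l))" .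
  have "(\<Sum>l'\<le>m. \<Sum>k<l'. (\<Sum>\<rho>\<in>S k l'. \<xi> (Cross k l' \<rho>) * residue_left c (Cross k l' \<rho>) l) +
        \<xi> (CrossZero k l') * residue_left c (CrossZero k l') l) =
      (\<Sum>l'\<le>m. \<Sum>k<l'. (if l' = l then c k * h k l else 0) - (if k = l then c l' * h l l' else 0))"
  proof (intro sum.cong refl)
    fix l' k :: nat assume "k \<in> {..<l'}"
    define z where "z = (if l = l' then c k else 0) - (if l = k then c l' else 0)"
    have "residue_left c (Cross k l' \<rho>) l = z" "residue_left c (CrossZero k l') l = of_nat (\<epsilon> k l') * z" for \<rho>
      by (simp_all add: residue_left_def z_def)
    then have "(\<Sum>\<rho>\<in>S k l'. \<xi> (Cross k l' \<rho>) * residue_left c (Cross k l' \<rho>) l) +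
        \<xi> (CrossZero k l') * residue_left c (CrossZero k l') l = h k l' * z"
      by (simp add: h_def sum_distrib_left distrib_left mult_ac)
    then show "(\<Sum>\<rho>\<in>S k l'. \<xi> (Cross k l' \<rho>) * residue_left c (Cross k l' \<rho>) l) +
        \<xi> (CrossZero k l') * residue_left c (CrossZero k l') l =
        (if l' = l then c k * h k l else 0) - (if k = l then c l' * h l l' else 0)"
      by (auto simp: z_def algebra_simps)
  qed
  also have "\<dots> = (\<Sum>l'\<le>m. (if l' = l then \<Sum>k<l. c k * h k l else 0) - (if l < l' then c l' * h l l' else 0))"
  proof (intro sum.cong refl)
    fix l' :: nat
    have "(\<Sum>k<l'. if k = l then c l' * h l l' else 0) = (if l < l' then c l' * h l l' else 0)"
      by simp
    moreover have "(\<Sum>k<l'. if l' = l then c k * h k l else 0) = (if l' = l then \<Sum>k<l. c k * h k l else 0)"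
      by simp
    ultimately show "(\<Sum>k<l'. (if l' = l then c k * h k l else 0) - (if k = l then c l' * h l l' else 0)) =
        (if l' = l then \<Sum>k<l. c k * h k l else 0) - (if l < l' then c l' * h l l' else 0)"
      by (simp only: sum_subtractf)
  qed
  also have "\<dots> = (\<Sum>k<l. c k * h k l) - (\<Sum>k\<le>m. if l < k then c k * h l k else 0)"
    using l by (simp add: sum_subtractf)
  also have "(\<Sum>k<l. c k * h k l) = (\<Sum>k\<le>m. if k < l then c k * h k l else 0)"
    using l by (intro sum.mono_neutral_cong_left) auto
  also have "(\<Sum>k\<le>m. if k < l then c k * h k l else 0) - (\<Sum>k\<le>m. if l < k then c k * h l k else 0) =
      (\<Sum>k\<le>m. c k * antisym_pair h k l)"
    unfolding sum_subtractf[symmetric] by (intro sum.cong) (auto simp: antisym_pair_def)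
  finally show ?thesis
    unfolding sum_J 1 by (simp add: h_def[abs_def] C_def)
qed

text \<open>The residues map into the hyperplane that expresses the \<open>y\<close>-equation when
  \<open>w l\<close> stands for \<open>1 / (y - \<phi> l)\<close>. A vector rebuilt from a kernel
  vector thus satisfies that equation by construction.\<close>

lemma sum_residue_left_eq_0:
  assumes "j \<in> J" shows "(\<Sum>l\<le>m. c l * residue_left c j l) = 0"
proof -
  have delta: "(\<Sum>l\<le>m. c l * (if l = k then z else 0)) = c k * z" if "k \<le> m" for k z
    using that by (simp add: if_distrib[of "\<lambda>x. _ * x"] cong: if_cong)
  from assms show ?thesis
  proof (cases rule: J_cases)
    case (1 j')
    then show ?thesis
      by (simp add: residue_left_def right_diff_distrib sum_subtractf delta sum_distrib_right[symmetric])
  next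
    case (2 k k' \<rho>)
    then show ?thesis
      by (simp add: residue_left_def right_diff_distrib sum_subtractf delta)
  next
    case (3 k k')
    have "(\<Sum>l\<le>m. c l * residue_left c j l) = of_nat (\<epsilon> k k') * (\<Sum>l\<le>m. c l * ((if l = k' then c k else 0) - (if l = k then c k' else 0)))"
      unfolding 3 by (simp add: residue_left_def sum_distrib_left mult.left_commute)
    also have "(\<Sum>l\<le>m. c l * ((if l = k' then c k else 0) - (if l = k then c k' else 0))) = 0"
      using 3 by (simp add: right_diff_distrib sum_subtractf delta)
    finally show ?thesis by simp
  qed
qed

lemma residue_right_sum: "residue_right i (\<lambda>l. \<Sum>j\<in>J. \<xi> j * f j l) = (\<Sum>j\<in>J. \<xi> j * residue_right i (f j))"
  by (simp add: residue_right_def right_diff_distrib sum_subtractf split: collision.split)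

lemma residue_right_scale: "residue_right i (\<lambda>l. z * w l) = z * residue_right i w"
  by (simp add: residue_right_def right_diff_distrib split: collision.split)

lemma residue_right_cong:
  assumes "i \<in> J" "\<And>l. l \<le> m \<Longrightarrow> w l = w' l"
  shows "residue_right i w = residue_right i w'"
  using assms by (cases rule: J_cases[OF assms(1)]) (auto simp: residue_right_def)

lemma sum_gram: "(\<Sum>j\<in>J. gram c i j * \<xi> j) = residue_right i (\<lambda>l. \<Sum>j\<in>J. \<xi> j * residue_left c j l)"
  by (simp add: residue_right_sum gram_def mult.commute)

lemma cross_eq: "k < l \<Longrightarrow> l \<le> m \<Longrightarrow> cross k l x = \<kappa> k l * x ^ \<epsilon> k l * (\<Prod>\<rho>\<in>S k l. x - \<rho>)"
  using collision by (simp add: cross_def num_def den_def)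

text \<open>The product rule applied to the factorisation of \<open>cross\<close>: one summand for
  each simple root, and one with a factor \<open>1 / x\<close> for the root at 0 counted with
  multiplicity.\<close>

lemma dcross_eq:
  assumes kl: "k < l" "l \<le> m" and x: "x \<noteq> 0"
  shows "dcross k l x = (\<Sum>\<rho>\<in>S k l. \<kappa> k l * x ^ \<epsilon> k l * (\<Prod>\<sigma>\<in>S k l - {\<rho>}. x - \<sigma>)) + of_nat (\<epsilon> k l) * (cross k l x / x)"
proof -
  have "(cross k l has_field_derivative dcross k l x) (at x)"
    unfolding cross_def dcross_def num_def den_def
    by (auto intro!: derivative_eq_intros simp: algebra_simps)
  moreover have "(cross k l has_field_derivative
    (\<kappa> k l * (of_nat (\<epsilon> k l) * x ^ (\<epsilon> k l - 1))) * (\<Prod>\<rho>\<in>S k l. x - \<rho>) +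
      (\<Sum>\<rho>\<in>S k l. 1 * (\<Prod>\<sigma>\<in>S k l - {\<rho>}. x - \<sigma>)) * (\<kappa> k l * x ^ \<epsilon> k l)) (at x)"
    unfolding cross_eq[OF kl, abs_def]
    by (intro DERIV_mult has_field_derivative_prod DERIV_cmult) (auto intro!: derivative_eq_intros)
  ultimately have "dcross k l x = (\<kappa> k l * (of_nat (\<epsilon> k l) * x ^ (\<epsilon> k l - 1))) * (\<Prod>\<rho>\<in>S k l. x - \<rho>) +
      (\<Sum>\<rho>\<in>S k l. 1 * (\<Prod>\<sigma>\<in>S k l - {\<rho>}. x - \<sigma>)) * (\<kappa> k l * x ^ \<epsilon> k l)"
    by (rule DERIV_unique)
  also have "(\<kappa> k l * (of_nat (\<epsilon> k l) * x ^ (\<epsilon> k l - 1))) * (\<Prod>\<rho>\<in>S k l. x - \<rho>) =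
      of_nat (\<epsilon> k l) * (cross k l x / x)"
    unfolding cross_eq[OF kl] using x by (cases "\<epsilon> k l") auto
  finally show ?thesis by (simp add: sum_distrib_left sum_distrib_right mult_ac)
qed

section \<open>From solutions to kernel vectors\<close>

lemma antisym_pair_dcross:
  "antisym_pair (\<lambda>k l. dcross k l x / (form k x y * form l x y)) k l = dcross k l x / (form k x y * form l x y)"
  by (auto simp: antisym_pair_def dcross_def mult.commute divide_simps)

lemma pole_in_J1:
  "i \<in> J1 \<Longrightarrow> pole i \<noteq> 0"
  using nonzero S by (auto simp: J1_def pole_simps)

text \<open>The quotient of \<open>residue_right i w\<close> by \<open>x - pole i\<close>, or by
  \<open>x\<close> for \<open>CrossZero\<close>, where \<open>w l = 1 / (y - \<phi> l)\<close>. The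
  vanishing factor is cancelled for poles and crossings, so that the vector makes sense even if
  \<open>x\<close> is a collision.\<close>

definition kernel_vec :: "(nat \<Rightarrow> complex) \<Rightarrow> complex \<Rightarrow> complex \<Rightarrow> collision \<Rightarrow> complex" where
  "kernel_vec c x y i = (case i of
      Pole j \<Rightarrow> - t j / form j x y
    | Cross k l \<rho> \<Rightarrow> \<kappa> k l * x ^ \<epsilon> k l * (\<Prod>\<sigma>\<in>S k l - {\<rho>}. x - \<sigma>) / (form k x y * form l x y)
    | CrossZero k l \<Rightarrow> cross k l x / (x * form k x y * form l x y))"

lemma kernel_vec_combination:
  assumes xy: "(x, y) \<in> sols c a" and l: "l \<le> m"
  shows "x * (\<Sum>j\<in>J. kernel_vec c x y j * residue_left c j l) = a * (- den l x / form l x y)"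
proof -
  let ?F = "\<lambda>k. form k x y"
  define C where "C = (\<Sum>k\<le>m. c k)"
  have x: "x \<noteq> 0" and F: "\<And>k. k \<le> m \<Longrightarrow> ?F k \<noteq> 0" and L2: "(\<Sum>k\<le>m. c k * den k x / ?F k) = 0"
    and L1: "x * (\<Sum>k\<le>m. c k * slope k y / ?F k) = a"
    using xy by (auto simp: sols_def)
  have pair: "antisym_pair (\<lambda>k l. (\<Sum>\<rho>\<in>S k l. kernel_vec c x y (Cross k l \<rho>)) +
      of_nat (\<epsilon> k l) * kernel_vec c x y (CrossZero k l)) k l = dcross k l x / (?F k * ?F l)" if "k \<le> m" for k
  proof -
    have *: "(\<Sum>\<rho>\<in>S k l. kernel_vec c x y (Cross k l \<rho>)) + of_nat (\<epsilon> k l) * kernel_vec c x y (CrossZero k l) =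
        dcross k l x / (?F k * ?F l)" if "k < l" "l \<le> m" for k l
      unfolding dcross_eq[OF that x]
      by (simp add: kernel_vec_def add_divide_distrib sum_divide_distrib mult.assoc)
    have "antisym_pair (\<lambda>k l. (\<Sum>\<rho>\<in>S k l. kernel_vec c x y (Cross k l \<rho>)) +
        of_nat (\<epsilon> k l) * kernel_vec c x y (CrossZero k l)) k l =
      antisym_pair (\<lambda>k l. dcross k l x / (?F k * ?F l)) k l"
      using that l * by (auto simp: antisym_pair_def)
    also have "\<dots> = dcross k l x / (?F k * ?F l)" by (rule antisym_pair_dcross)
    finally show ?thesis .
  qed
  have pole0: "(\<Sum>j = 1..m. c j * kernel_vec c x y (Pole j)) = (\<Sum>k\<le>m. c k * (- t k / ?F k))"
    by (intro sum.mono_neutral_cong_left) (auto simp: kernel_vec_def zero Suc_le_eq)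
  have "(\<Sum>j\<in>J. kernel_vec c x y j * residue_left c j l) =
      (\<Sum>k\<le>m. c k * (- t k / ?F k)) + C * t l / ?F l + (\<Sum>k\<le>m. c k * (dcross k l x / (?F k * ?F l)))"
    unfolding sum_residue_left[OF l] pole0 using pair
    by (auto simp: C_def kernel_vec_def zero intro!: sum.cong)
  also have "\<dots> = (\<Sum>k\<le>m. c k * (- t k / ?F k) + c k * t l / ?F l + c k * (dcross k l x / (?F k * ?F l)))"
    by (simp add: sum.distrib C_def sum_distrib_right sum_divide_distrib sum_subtractf sum_negf)
  also have "\<dots> = (\<Sum>k\<le>m. slope l y / ?F l * (c k * den k x / ?F k) - den l x / ?F l * (c k * slope k y / ?F k))"
  proof (intro sum.cong refl)
    fix k assume "k \<in> {..m}"
    then have Fk: "?F k \<noteq> 0" using F by simp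
    \<comment> \<open>The right side is the Jacobian determinant of \<open>form k\<close> and
      \<open>form l\<close> in \<open>x\<close> and \<open>y\<close>. It separates the sum over
      \<open>k\<close> into the two score equations.\<close>
    have "dcross k l x - t k * ?F l + t l * ?F k = den k x * slope l y - den l x * slope k y"
      by (simp add: dcross_def form_def slope_def algebra_simps)
    then have "c k * (dcross k l x - t k * ?F l + t l * ?F k) / (?F k * ?F l) =
        c k * (den k x * slope l y - den l x * slope k y) / (?F k * ?F l)"
      by simp
    then show "c k * (- t k / ?F k) + c k * t l / ?F l + c k * (dcross k l x / (?F k * ?F l)) =
        slope l y / ?F l * (c k * den k x / ?F k) - den l x / ?F l * (c k * slope k y / ?F k)"
      using Fk F[OF l] by (simp add: field_simps)
  qed
  also have "\<dots> = - (den l x / ?F l) * (\<Sum>k\<le>m. c k * slope k y / ?F k)"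
    unfolding sum_subtractf sum_distrib_left[symmetric] L2 by simp
  finally show ?thesis unfolding L1[symmetric] by simp
qed

lemma residue_right_kernel_vec:
  assumes xy: "(x, y) \<in> sols c a" and i: "i \<in> J"
  shows "residue_right i (\<lambda>l. - den l x / form l x y) = (if i \<in> J0 then x else x - pole i) * kernel_vec c x y i"
proof -
  have x: "x \<noteq> 0" and F: "\<And>k. k \<le> m \<Longrightarrow> form k x y \<noteq> 0"
    using xy by (auto simp: sols_def)
  have diff: "- den l x / form l x y - (- den k x / form k x y) = cross k l x / (form k x y * form l x y)"
    if "k \<le> m" "l \<le> m" for k l
    using F[OF that(1)] F[OF that(2)] by (simp add: cross_def form_def field_simps)
  from i show ?thesis
  proof (cases rule: J_cases)
    case (1 j)
    then have "t j \<noteq> 0" using nonzero by blast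
    then have "1 + t j * x = (x - - 1 / t j) * t j"
      by (simp add: distrib_left mult.commute)
    moreover have "pole i = - 1 / t j" by (simp add: 1(1) pole_simps)
    ultimately have "den j x = (x - pole i) * t j" by (simp only: den_def)
    then show ?thesis using 1(1,5)
      by (simp add: residue_right_def kernel_vec_def)
  next
    case (2 k l \<rho>)
    have "(\<Prod>\<rho>\<in>S k l. x - \<rho>) = (x - \<rho>) * (\<Prod>\<sigma>\<in>S k l - {\<rho>}. x - \<sigma>)"
      using 2 S[of k l] by (simp add: prod.remove)
    then show ?thesis using 2 diff[of k l]
      by (simp add: residue_right_def kernel_vec_def pole_simps cross_eq)
  next
    case (3 k l)
    then show ?thesis using diff[of k l] x
      by (simp add: residue_right_def kernel_vec_def)
  qed
qed

lemma kernel_vec_in_kernel: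
  assumes xy: "(x, y) \<in> sols c a"
  shows "pencil_kernel J J0 pole a (gram c) x (kernel_vec c x y)" "kernel_vec c x y (Pole 1) \<noteq> 0"
proof -
  let ?w = "\<lambda>l. - den l x / form l x y"
  have x: "x \<noteq> 0" and F: "\<And>k. k \<le> m \<Longrightarrow> form k x y \<noteq> 0"
    using xy by (auto simp: sols_def)
  show "kernel_vec c x y (Pole 1) \<noteq> 0"
    using F[of 1] nonzero[of 1] m by (simp add: kernel_vec_def)
  have *: "x * (\<Sum>j\<in>J. gram c i j * kernel_vec c x y j) = a * ((if i \<in> J0 then x else x - pole i) * kernel_vec c x y i)"
    if i: "i \<in> J" for i
  proof -
    have "x * (\<Sum>j\<in>J. gram c i j * kernel_vec c x y j) =
        residue_right i (\<lambda>l. x * (\<Sum>j\<in>J. kernel_vec c x y j * residue_left c j l))"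
      by (simp only: sum_gram residue_right_scale)
    also have "\<dots> = residue_right i (\<lambda>l. a * ?w l)"
      by (rule residue_right_cong[OF i]) (rule kernel_vec_combination[OF xy])
    also have "\<dots> = a * ((if i \<in> J0 then x else x - pole i) * kernel_vec c x y i)"
      by (simp only: residue_right_scale residue_right_kernel_vec[OF xy i])
    finally show ?thesis .
  qed
  show "pencil_kernel J J0 pole a (gram c) x (kernel_vec c x y)"
    unfolding pencil_kernel_def
  proof
    fix i assume i: "i \<in> J"
    show "if i \<in> J0 then a * kernel_vec c x y i = (\<Sum>j\<in>J. gram c i j * kernel_vec c x y j)
      else a * (x - pole i) * kernel_vec c x y i = x * (\<Sum>j\<in>J. gram c i j * kernel_vec c x y j)"
      using *[OF i] x by (auto simp: mult.assoc mult.left_commute[of a x])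
  qed
qed

text \<open>The kernel vectors of the two solutions differ by a factor \<open>d\<close>. Coordinate
  \<open>Pole 1\<close> shows that \<open>form 1\<close> changes by this factor, and together with
  \<open>CrossZero 0 1\<close> so does \<open>y\<close>. Since \<open>form 1\<close> is
  \<open>num 1\<close> minus a multiple of \<open>y\<close>, a nonzero \<open>num 1\<close> forces
  \<open>d = 1\<close>.\<close>

lemma sols_inj:
  assumes num1: "num 1 x \<noteq> 0"
    and ker: "\<And>x \<xi> \<eta>. pencil_kernel J J0 pole a (gram c) x \<xi> \<Longrightarrow> pencil_kernel J J0 pole a (gram c) x \<eta> \<Longrightarrow>
      \<exists>i\<in>J. \<xi> i \<noteq> 0 \<Longrightarrow> \<exists>d. \<forall>i\<in>J. \<eta> i = d * \<xi> i"
    and xy: "(x, y) \<in> sols c a" "(x, y') \<in> sols c a"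
  shows "y = y'"
proof -
  have F: "form k x y \<noteq> 0" "form k x y' \<noteq> 0" if "k \<le> m" for k
    using xy that by (auto simp: sols_def)
  have "Pole 1 \<in> J" using Pole_J[of 1] m by (simp add: J_def)
  obtain d where d: "\<And>i. i \<in> J \<Longrightarrow> kernel_vec c x y' i = d * kernel_vec c x y i"
    using ker[OF kernel_vec_in_kernel(1)[OF xy(1)] kernel_vec_in_kernel(1)[OF xy(2)]]
      kernel_vec_in_kernel(2)[OF xy(1)] \<open>Pole 1 \<in> J\<close> by blast
  have w: "- den l x / form l x y' - - den 0 x / form 0 x y' = d * (- den l x / form l x y - - den 0 x / form 0 x y)"
    if "1 \<le> l" "l \<le> m" for l
  proof -
    have i: "CrossZero 0 l \<in> J" using CrossZero_J[of 0 l] that by (simp add: J_def)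
    from residue_right_kernel_vec[OF xy(1) i] residue_right_kernel_vec[OF xy(2) i] d[OF i]
    show ?thesis using CrossZero_J[of 0 l] that by (simp add: residue_right_def)
  qed
  have "t 1 \<noteq> 0" using nonzero[of 1] m by simp
  have *: "- t 1 / form 1 x y' = d * (- t 1 / form 1 x y)"
    using d[OF \<open>Pole 1 \<in> J\<close>] by (simp add: kernel_vec_def)
  then have "- t 1 * (1 / form 1 x y') = - t 1 * (d * (1 / form 1 x y))" by simp
  then have d': "1 / form 1 x y' = d * (1 / form 1 x y)"
    using \<open>t 1 \<noteq> 0\<close> unfolding mult_cancel_left by simp
  have "- den 1 x / form 1 x y' = d * (- den 1 x / form 1 x y)"
    using arg_cong[OF d', of "\<lambda>z. - den 1 x * z"] by simp
  then have "1 / form 0 x y' = d * (1 / form 0 x y)"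
    using w[of 1] m by (simp add: den_def zero algebra_simps)
  moreover have "form 0 x z = - z" for z by (simp add: form_def num_def den_def zero)
  moreover have "d \<noteq> 0" using d' F[of 1] m by auto
  moreover have "y \<noteq> 0" "y' \<noteq> 0" using F[of 0] calculation(2) by auto
  ultimately have y: "d * y' = y" by (simp add: field_simps)
  have "form 1 x y = d * form 1 x y'"
    using d' F[of 1] m by (simp add: field_simps)
  then have "num 1 x - den 1 x * (d * y') = d * (num 1 x - den 1 x * y')"
    by (simp add: form_def y)
  then have "num 1 x * (1 - d) = 0"
    by (simp add: algebra_simps)
  then have "d = 1" using num1 by simp
  then show ?thesis using y by simp
qed

text \<open>The vector \<open>w\<close> rebuilt from \<open>\<xi>\<close> satisfies the linear
  system, but its entries need not be \<open>1 / (y - \<phi> l)\<close> for a common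
  \<open>y\<close>. \<open>connection_eigenvector\<close> finds such a \<open>y\<close> in the
  eigenspace of \<open>w\<close>. Off the collisions \<open>\<xi>\<close> can be read off from
  \<open>w\<close>, so \<open>w\<close> is nonzero.\<close>

lemma sols_surj:
  assumes c: "\<And>k. k \<le> m \<Longrightarrow> c k \<noteq> 0" and C: "(\<Sum>k\<le>m. c k) \<noteq> 0" and a: "a \<noteq> 0"
    and \<xi>: "pencil_kernel J J0 pole a (gram c) x \<xi>" "\<exists>i\<in>J. \<xi> i \<noteq> 0"
    and x: "x \<noteq> 0" "\<And>i. i \<in> J1 \<Longrightarrow> x \<noteq> pole i"
  shows "\<exists>y. (x, y) \<in> sols c a"
proof -
  define w where "w l = x / a * (\<Sum>j\<in>J. \<xi> j * residue_left c j l)" for l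
  have vw: "residue_right i w = (if i \<in> J0 then x else x - pole i) * \<xi> i" if i: "i \<in> J" for i
  proof -
    have "residue_right i w = x / a * (\<Sum>j\<in>J. gram c i j * \<xi> j)"
      unfolding w_def residue_right_scale sum_gram ..
    moreover have "if i \<in> J0 then a * \<xi> i = (\<Sum>j\<in>J. gram c i j * \<xi> j)
           else a * (x - pole i) * \<xi> i = x * (\<Sum>j\<in>J. gram c i j * \<xi> j)"
      using \<xi>(1) i unfolding pencil_kernel_def by blast
    ultimately have "a * residue_right i w = a * ((if i \<in> J0 then x else x - pole i) * \<xi> i)"
      using a by (simp add: mult.assoc mult.left_commute[of x a] split: if_splits)
    then show ?thesis using a by simp
  qed
  have den: "den k x \<noteq> 0" if "k \<le> m" for k
  proof (cases "k = 0")
    case False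
    then have "t k \<noteq> 0" "x \<noteq> - 1 / t k"
      using nonzero[of k] x(2)[OF Pole_J[of k]] that by (auto simp: pole_simps)
    then show ?thesis by (auto simp: den_def field_simps add_eq_0_iff)
  qed (simp add: den_def zero)
  have cross_nz: "cross k l x \<noteq> 0" if "k < l" "l \<le> m" for k l
  proof -
    have "x \<noteq> \<rho>" if "\<rho> \<in> S k l" for \<rho>
      using x(2)[OF Cross_J[OF \<open>k < l\<close> \<open>l \<le> m\<close> that]] by (simp add: pole_simps)
    then show ?thesis
      using that \<kappa>[OF that] S[OF that] x(1) by (simp add: cross_eq)
  qed
  have cross_antisym: "cross k l x = - cross l k x" "dcross k l x = - dcross l k x" for k l
    by (simp_all add: cross_def dcross_def)
  have cross_nz': "cross k l x \<noteq> 0" if "k \<le> m" "l \<le> m" "k \<noteq> l" for k l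
    using cross_nz[of k l] cross_nz[of l k] cross_antisym(1)[of k l] that by (cases "k < l") auto
  have pair: "(\<Sum>\<rho>\<in>S k l. \<xi> (Cross k l \<rho>)) + of_nat (\<epsilon> k l) * \<xi> (CrossZero k l) =
      (w l - w k) * dcross k l x / cross k l x" if kl: "k < l" "l \<le> m" for k l
  proof -
    \<comment> \<open>The rows of all collisions of \<open>k\<close> and \<open>l\<close> express
      their coordinates as multiples of this one ratio, and the multiples add up to
      \<open>dcross\<close>.\<close>
    define q where "q = (w l - w k) / cross k l x"
    have 1: "\<xi> (Cross k l \<rho>) = q * (\<kappa> k l * x ^ \<epsilon> k l * (\<Prod>\<sigma>\<in>S k l - {\<rho>}. x - \<sigma>))"
      if \<rho>: "\<rho> \<in> S k l" for \<rho>
    proof -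
      have "Cross k l \<rho> \<in> J" "Cross k l \<rho> \<notin> J0" using Cross_J[OF kl \<rho>] by (auto simp: J_def J0_def)
      then have 1: "w l - w k = (x - \<rho>) * \<xi> (Cross k l \<rho>)"
        using vw[of "Cross k l \<rho>"] by (simp add: residue_right_def pole_simps)
      have "(\<Prod>\<rho>\<in>S k l. x - \<rho>) = (x - \<rho>) * (\<Prod>\<sigma>\<in>S k l - {\<rho>}. x - \<sigma>)"
        using \<rho> S[OF kl] by (simp add: prod.remove)
      then have "(w l - w k) / cross k l x * (\<kappa> k l * x ^ \<epsilon> k l * (\<Prod>\<sigma>\<in>S k l - {\<rho>}. x - \<sigma>)) =
          \<xi> (Cross k l \<rho>) * (cross k l x / cross k l x)"
        unfolding 1 by (simp add: cross_eq[OF kl])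
      then show ?thesis using cross_nz[OF kl] by (simp add: q_def)
    qed
    have 2: "\<xi> (CrossZero k l) = q * (cross k l x / x)"
      using vw[of "CrossZero k l"] CrossZero_J[OF kl] x(1) cross_nz[OF kl]
      by (simp add: residue_right_def J_def q_def)
    have "(\<Sum>\<rho>\<in>S k l. \<xi> (Cross k l \<rho>)) + of_nat (\<epsilon> k l) * \<xi> (CrossZero k l) = q * dcross k l x"
      unfolding dcross_eq[OF kl x(1)] 2 using 1 by (simp add: sum_distrib_left distrib_left mult.left_commute)
    then show ?thesis by (simp add: q_def)
  qed
  have pair': "antisym_pair (\<lambda>k l. (\<Sum>\<rho>\<in>S k l. \<xi> (Cross k l \<rho>)) + of_nat (\<epsilon> k l) * \<xi> (CrossZero k l)) k l =
      (w l - w k) * (dcross k l x / cross k l x)" if "k \<le> m" "l \<le> m" for k l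
  proof -
    have ratio: "dcross l k x / cross l k x = dcross k l x / cross k l x"
      by (simp add: cross_antisym[of l k])
    consider "k < l" | "l < k" | "k = l" by linarith
    then show ?thesis
    proof cases
      case 1
      then show ?thesis using pair[OF 1 that(2)] by (simp add: antisym_pair_def)
    next
      case 2
      then have "antisym_pair (\<lambda>k l. (\<Sum>\<rho>\<in>S k l. \<xi> (Cross k l \<rho>)) + of_nat (\<epsilon> k l) * \<xi> (CrossZero k l)) k l =
          - ((w k - w l) * (dcross l k x / cross l k x))"
        using pair[OF 2 that(1)] by (simp add: antisym_pair_def)
      also have "\<dots> = (w l - w k) * (dcross k l x / cross k l x)"
        unfolding ratio by (simp only: minus_diff_eq mult_minus_left[symmetric])
      finally show ?thesis .
    qed (simp add: antisym_pair_def)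
  qed
  have pole_\<xi>: "\<xi> (Pole j) = t j / den j x * w j" if "1 \<le> j" "j \<le> m" for j
  proof -
    have "Pole j \<in> J" "Pole j \<notin> J0" using Pole_J[OF that] by (auto simp: J_def J0_def)
    then have w: "w j = (x - - 1 / t j) * \<xi> (Pole j)"
      using vw[of "Pole j"] by (simp only: residue_right_def pole_simps collision.case if_False)
    have t: "t j \<noteq> 0" using nonzero that by blast
    then have "t j * (x - - 1 / t j) = den j x"
      by (simp add: den_def distrib_left)
    then have "t j * w j = den j x * \<xi> (Pole j)"
      unfolding w by (metis mult.assoc)
    then show ?thesis using den[OF that(2)] by (simp add: nonzero_eq_divide_eq mult.commute)
  qed
  have row: "a * w l = x * ((\<Sum>k\<le>m. c k * (t k / den k x * w k)) - (\<Sum>k\<le>m. c k) * (t l / den l x * w l) +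
      (\<Sum>k\<le>m. c k * ((w l - w k) * (dcross k l x / cross k l x))))" if l: "l \<le> m" for l
  proof -
    have "(\<Sum>j = 1..m. c j * \<xi> (Pole j)) = (\<Sum>k\<le>m. c k * (t k / den k x * w k))"
      by (intro sum.mono_neutral_cong_left) (auto simp: pole_\<xi> zero not_le)
    moreover have "(if l = 0 then 0 else (\<Sum>k\<le>m. c k) * \<xi> (Pole l)) = (\<Sum>k\<le>m. c k) * (t l / den l x * w l)"
      using pole_\<xi>[of l] l by (auto simp: zero)
    moreover have "a * w l = x * (\<Sum>j\<in>J. \<xi> j * residue_left c j l)"
      using a by (simp add: w_def)
    moreover have "(\<Sum>k\<le>m. c k * antisym_pair (\<lambda>k l. (\<Sum>\<rho>\<in>S k l. \<xi> (Cross k l \<rho>)) +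
        of_nat (\<epsilon> k l) * \<xi> (CrossZero k l)) k l) = (\<Sum>k\<le>m. c k * ((w l - w k) * (dcross k l x / cross k l x)))"
      using l by (intro sum.cong refl arg_cong[of _ _ "\<lambda>z. _ * z"] pair') auto
    ultimately show ?thesis
      by (simp only: sum_residue_left[OF l])
  qed
  define \<phi> where "\<phi> k = num k x / den k x" for k
  define \<phi>' where "\<phi>' k = (s k * den k x - t k * num k x) / (den k x)\<^sup>2" for k
  \<comment> \<open>The logarithmic derivative of \<open>\<phi> l - \<phi> k\<close>, because
    \<open>cross k l\<close> is \<open>den k * den l\<close> times this difference. The terms of the
    denominators cancel against the \<open>Pole\<close> terms, except for a scalar that changes the
    eigenvalue from \<open>a / x\<close> to \<open>\<sigma>\<close>.\<close>
  define \<delta> where "\<delta> k l = dcross k l x / cross k l x - t k / den k x - t l / den l x" for k l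
  define \<sigma> where "\<sigma> = a / x - (\<Sum>k\<le>m. c k * t k / den k x)"
  have cross_\<phi>: "cross k l x = den k x * den l x * (\<phi> l - \<phi> k)" if "k \<le> m" "l \<le> m" for k l
    using den[OF that(1)] den[OF that(2)] by (simp add: cross_def \<phi>_def field_simps)
  have inj: "inj_on \<phi> {..m}"
  proof (rule inj_onI, rule ccontr)
    fix k l assume "k \<in> {..m}" "l \<in> {..m}" "\<phi> k = \<phi> l" "k \<noteq> l"
    then show False using cross_nz'[of k l] cross_\<phi>[of k l] by simp
  qed
  have \<delta>1: "\<delta> k l * (\<phi> l - \<phi> k) = \<phi>' l - \<phi>' k" if "k \<le> m" "l \<le> m" for k l
  proof (cases "k = l")
    case False
    have d: "den k x \<noteq> 0" "den l x \<noteq> 0" using den that by auto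
    define e where "e = \<phi> l - \<phi> k"
    have cr: "cross k l x = den k x * den l x * e" using cross_\<phi>[OF that] by (simp add: e_def)
    then have "e \<noteq> 0" using cross_nz'[OF that False] by auto
    then have "\<delta> k l * e = dcross k l x / (den k x * den l x) - (t k / den k x + t l / den l x) * e"
      unfolding \<delta>_def cr by (simp add: left_diff_distrib distrib_right)
    also have "\<dots> = \<phi>' l - \<phi>' k"
      unfolding dcross_def e_def \<phi>_def \<phi>'_def using d by (rule log_derivative_quotient_diff)
    finally show ?thesis by (simp add: e_def)
  qed simp
  have \<delta>2: "\<delta> k l = \<delta> l k" for k l
    using cross_antisym[of k l] by (simp add: \<delta>_def)
  have cw: "(\<Sum>l\<le>m. c l * w l) = 0"
  proof -
    have "(\<Sum>l\<le>m. c l * w l) = x / a * (\<Sum>j\<in>J. \<xi> j * (\<Sum>l\<le>m. c l * residue_left c j l))"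
      unfolding w_def sum_distrib_left by (subst sum.swap) (simp add: mult_ac)
    then show ?thesis by (simp add: sum_residue_left_eq_0)
  qed
  have \<sigma>w: "\<sigma> * w l = (\<Sum>k\<le>m. c k * \<delta> k l * (w l - w k))" if l: "l \<le> m" for l
  proof -
    have "(\<Sum>k\<le>m. c k * \<delta> k l * (w l - w k)) =
        (\<Sum>k\<le>m. c k * ((w l - w k) * (dcross k l x / cross k l x)) - w l * (c k * t k / den k x) +
          c k * (t k / den k x * w k) - c k * (t l / den l x * w l) + t l / den l x * (c k * w k))"
      by (intro sum.cong refl) (simp add: \<delta>_def algebra_simps diff_divide_distrib)
    also have "\<dots> = (\<Sum>k\<le>m. c k * ((w l - w k) * (dcross k l x / cross k l x))) - w l * (\<Sum>k\<le>m. c k * t k / den k x) +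
        (\<Sum>k\<le>m. c k * (t k / den k x * w k)) - (\<Sum>k\<le>m. c k) * (t l / den l x * w l)"
      by (simp only: sum.distrib sum_subtractf sum_distrib_left[symmetric] sum_distrib_right[symmetric] cw mult_zero_right add_0_right)
    also have "\<dots> = a * w l / x - w l * (\<Sum>k\<le>m. c k * t k / den k x)"
      unfolding row[OF l] using x(1) by simp
    finally have "(\<Sum>k\<le>m. c k * \<delta> k l * (w l - w k)) = a * w l / x - w l * (\<Sum>k\<le>m. c k * t k / den k x)" .
    moreover have "\<sigma> * w l = a * w l / x - w l * (\<Sum>k\<le>m. c k * t k / den k x)"
      unfolding \<sigma>_def left_diff_distrib by (simp only: mult.commute[of "w l"] times_divide_eq_left)
    ultimately show ?thesis by (simp only:)
  qed
  have w0: "\<exists>k\<in>{..m}. w k \<noteq> 0"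
  proof (rule ccontr)
    assume "\<not> (\<exists>k\<in>{..m}. w k \<noteq> 0)"
    then have w0: "w k = 0" if "k \<le> m" for k using that by auto
    have "\<xi> i = 0" if i: "i \<in> J" for i
    proof -
      have "residue_right i w = residue_right i (\<lambda>_. 0)"
        by (rule residue_right_cong[OF i]) (simp add: w0)
      also have "\<dots> = 0" by (simp add: residue_right_def split: collision.split)
      finally show ?thesis using vw[OF i] x i by (auto simp: J_def split: if_splits)
    qed
    with \<xi>(2) show False by blast
  qed
  have "\<exists>y. (\<forall>k\<in>{..m}. y \<noteq> \<phi> k) \<and> (\<Sum>k\<le>m. c k / (y - \<phi> k)) = 0 \<and>
      \<sigma> = - (\<Sum>k\<le>m. c k * \<phi>' k / (y - \<phi> k))"
  proof (rule connection_eigenvector)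
    show "\<delta> k l * (\<phi> l - \<phi> k) = \<phi>' l - \<phi>' k" if "k \<in> {..m}" "l \<in> {..m}" for k l
      using \<delta>1 that by simp
    show "\<delta> k l = \<delta> l k" for k l by (rule \<delta>2)
    show "\<sigma> * w l = (\<Sum>k\<le>m. c k * \<delta> k l * (w l - w k))" if "l \<in> {..m}" for l
      using \<sigma>w that by simp
    show "c k \<noteq> 0" if "k \<in> {..m}" for k using c that by simp
  qed (fact finite_atMost C inj cw w0)+
  then obtain y where y: "\<And>k. k \<le> m \<Longrightarrow> y \<noteq> \<phi> k" "(\<Sum>k\<le>m. c k / (y - \<phi> k)) = 0"
    "\<sigma> = - (\<Sum>k\<le>m. c k * \<phi>' k / (y - \<phi> k))"
    by blast
  have form: "form k x y = - (den k x * (y - \<phi> k))" if "k \<le> m" for k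
    using den[OF that] by (simp add: form_def \<phi>_def field_simps)
  have F: "form k x y \<noteq> 0" if "k \<le> m" for k
    using den[OF that] y(1)[OF that] by (simp add: form[OF that])
  have "(\<Sum>k\<le>m. c k * den k x / form k x y) = - (\<Sum>k\<le>m. c k / (y - \<phi> k))"
    unfolding sum_negf[symmetric] using den by (intro sum.cong refl) (auto simp: form)
  then have L2: "(\<Sum>k\<le>m. c k * den k x / form k x y) = 0" using y(2) by simp
  have "(\<Sum>k\<le>m. c k * slope k y / form k x y) = (\<Sum>k\<le>m. c k * t k / den k x - c k * \<phi>' k / (y - \<phi> k))"
  proof (intro sum.cong refl)
    fix k assume "k \<in> {..m}"
    then have k: "k \<le> m" by simp
    have "slope k y * den k x = t k * form k x y + (s k * den k x - t k * num k x)"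
      by (simp add: slope_def form_def algebra_simps)
    then have "slope k y / form k x y = t k / den k x + (s k * den k x - t k * num k x) / (den k x * form k x y)"
      using den[OF k] F[OF k] by (simp add: field_simps)
    also have "(s k * den k x - t k * num k x) / (den k x * form k x y) = - (\<phi>' k / (y - \<phi> k))"
      using den[OF k] by (simp add: form[OF k] \<phi>'_def power2_eq_square)
    finally have "slope k y / form k x y = t k / den k x - \<phi>' k / (y - \<phi> k)" by simp
    then have "c k * (slope k y / form k x y) = c k * (t k / den k x - \<phi>' k / (y - \<phi> k))" by simp
    then show "c k * slope k y / form k x y = c k * t k / den k x - c k * \<phi>' k / (y - \<phi> k)"
      by (simp add: right_diff_distrib)
  qed
  also have "\<dots> = a / x"
    using y(3) by (simp add: sum_subtractf \<sigma>_def algebra_simps)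
  finally have "x * (\<Sum>k\<le>m. c k * slope k y / form k x y) = a" using x(1) by simp
  then show ?thesis using x(1) F L2 by (auto simp: sols_def)
qed

lemma card_sols:
  assumes c: "\<And>k. k \<le> m \<Longrightarrow> c k \<noteq> 0" "(\<Sum>k\<le>m. c k) \<noteq> 0" "a \<noteq> 0"
    and Z: "finite (pencil_roots J J0 pole a (gram c))" "0 \<notin> pencil_roots J J0 pole a (gram c)"
      "\<And>i. i \<in> J1 \<Longrightarrow> pole i \<notin> pencil_roots J J0 pole a (gram c)"
    and ker: "\<And>x \<xi> \<eta>. pencil_kernel J J0 pole a (gram c) x \<xi> \<Longrightarrow> pencil_kernel J J0 pole a (gram c) x \<eta> \<Longrightarrow>
      \<exists>i\<in>J. \<xi> i \<noteq> 0 \<Longrightarrow> \<exists>d. \<forall>i\<in>J. \<eta> i = d * \<xi> i"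
  shows "finite (sols c a) \<and> card (sols c a) = card (pencil_roots J J0 pole a (gram c))"
proof -
  have P1: "Pole 1 \<in> J" using Pole_J[of 1] m by (simp add: J_def)
  have root: "x \<in> pencil_roots J J0 pole a (gram c)" if "(x, y) \<in> sols c a" for x y
    using kernel_vec_in_kernel[OF that] P1 unfolding pencil_roots_def by blast
  \<comment> \<open>\<open>num 1\<close> equals \<open>cross 0 1\<close>, curve 0 being
    \<open>y = 0\<close>, and so it vanishes only at a collision.\<close>
  have num1: "num 1 x \<noteq> 0" if x: "x \<in> pencil_roots J J0 pole a (gram c)" for x
  proof -
    have "x \<noteq> \<rho>" if "\<rho> \<in> S 0 1" for \<rho>
      using Z(3)[OF Cross_J[of 0 1 \<rho>]] that m x by (auto simp: pole_simps)
    then have "cross 0 1 x \<noteq> 0"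
      using m S[of 0 1] \<kappa>[of 0 1] x Z(2) by (auto simp: cross_eq)
    then show ?thesis by (simp add: cross_def num_def den_def zero)
  qed
  have "bij_betw fst (sols c a) (pencil_roots J J0 pole a (gram c))"
    unfolding bij_betw_def
  proof (intro conjI inj_onI equalityI subsetI)
    fix p q assume p: "p \<in> sols c a" "q \<in> sols c a" "fst p = fst q"
    obtain x y y' where pq: "p = (x, y)" "q = (x, y')" using p(3) by (metis prod.collapse)
    have "y = y'"
    proof (rule sols_inj)
      show "num 1 x \<noteq> 0" using p(1) root num1 unfolding pq by blast
    qed (use ker p pq in blast)+
    then show "p = q" using pq by simp
  next
    fix x assume "x \<in> fst ` sols c a"
    then show "x \<in> pencil_roots J J0 pole a (gram c)" using root by auto
  next
    fix x assume x: "x \<in> pencil_roots J J0 pole a (gram c)"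
    then obtain \<xi> where "pencil_kernel J J0 pole a (gram c) x \<xi>" "\<exists>i\<in>J. \<xi> i \<noteq> 0"
      unfolding pencil_roots_def by blast
    moreover have "x \<noteq> 0" "\<And>i. i \<in> J1 \<Longrightarrow> x \<noteq> pole i" using Z x by auto
    ultimately obtain y where "(x, y) \<in> sols c a" using sols_surj[of c a x \<xi>] c by blast
    then show "x \<in> fst ` sols c a" by force
  qed
  then show ?thesis using Z(1) bij_betw_finite bij_betw_same_card by metis
qed

end

section \<open>Scalings that realise an arrangement\<close>

context mobius_arrangement
begin

text \<open>The first \<open>m\<close> indices carry one curve each and all later ones repeat curve
  1, so the same arrangement serves every \<open>n\<close> with
  \<open>m \<le> n + 1\<close>.\<close>

definition form_index :: "nat \<Rightarrow> nat" where
  "form_index k = (if k < m then k + 1 else 1)"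

definition scaling :: "nat \<times> nat \<times> nat \<Rightarrow> complex" where
  "scaling = (\<lambda>(i, j, k). if j = 0 then (if i = 0 then A (form_index k) else s (form_index k))
     else (if i = 0 then - 1 else - t (form_index k)))"

definition form_weight :: "nat \<Rightarrow> (nat \<times> nat \<times> nat \<Rightarrow> complex) \<Rightarrow> nat \<Rightarrow> complex" where
  "form_weight n v l = (if l = 0 then - margin_y n v
     else (\<Sum>k = 0..n. if form_index k = l then margin_z v k else 0))"

lemma form_index_bounds: "1 \<le> form_index k" "form_index k \<le> m"
  using m by (auto simp: form_index_def)

lemma scaling_nonzero: "\<forall>i\<in>segre_index n. scaling i \<noteq> 0"
  using nonzero[OF form_index_bounds] by (auto simp: scaling_def segre_index_def)

lemma curve_scaling:
  "curve scaling k x y = form (form_index k) x y"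
  "curve_dx scaling k y = slope (form_index k) y"
  "curve_dy scaling k x = - den (form_index k) x"
  by (simp_all add: curve_def curve_dx_def curve_dy_def scaling_def form_def num_def den_def slope_def algebra_simps)

lemma sum_form_weight:
  "(\<Sum>l\<le>m. form_weight n v l * h l) = - margin_y n v * h 0 + (\<Sum>k = 0..n. margin_z v k * h (form_index k))"
proof -
  have "{..m} = insert 0 {1..m}" using m by auto
  then have "(\<Sum>l\<le>m. form_weight n v l * h l) = - margin_y n v * h 0 + (\<Sum>l = 1..m. form_weight n v l * h l)"
    by (simp add: form_weight_def)
  also have "(\<Sum>l = 1..m. form_weight n v l * h l) =
      (\<Sum>l = 1..m. \<Sum>k = 0..n. if l = form_index k then margin_z v k * h l else 0)"
    by (intro sum.cong) (auto simp: form_weight_def sum_distrib_right intro!: sum.cong)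
  also have "\<dots> = (\<Sum>k = 0..n. \<Sum>l = 1..m. if l = form_index k then margin_z v k * h l else 0)"
    by (rule sum.swap)
  also have "\<dots> = (\<Sum>k = 0..n. margin_z v k * h (form_index k))"
    using form_index_bounds by (intro sum.cong) auto
  finally show ?thesis .
qed

text \<open>Dividing the \<open>y\<close>-equation by \<open>y\<close> turns its right side into the
  summand of curve 0. Indices with the same curve merge into one weight, and
  \<open>m \<le> n + 1\<close> ensures that every curve occurs.\<close>

lemma score_solutions_scaling:
  assumes n: "m \<le> n + 1"
  shows "score_solutions n scaling (margin_x n v) (margin_y n v) (margin_z v) = sols (form_weight n v) (margin_x n v)"
proof -
  have form0: "form 0 x y = - y" "den 0 x = 1" "slope 0 y = 0" for x y
    by (simp_all add: form_def num_def den_def slope_def zero)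
  have all_iff: "(\<forall>l\<le>m. form l x y \<noteq> 0) \<longleftrightarrow> y \<noteq> 0 \<and> (\<forall>k\<le>n. form (form_index k) x y \<noteq> 0)" for x y
  proof (intro iffI conjI allI impI)
    fix l assume *: "y \<noteq> 0 \<and> (\<forall>k\<le>n. form (form_index k) x y \<noteq> 0)" "l \<le> m"
    show "form l x y \<noteq> 0"
    proof (cases "l = 0")
      case False
      then have "l - 1 \<le> n" "form_index (l - 1) = l" using * n by (auto simp: form_index_def)
      then show ?thesis using * by metis
    qed (use * in \<open>simp add: form0\<close>)
  qed (use form_index_bounds form0(1) in fastforce)+
  have 1: "(\<Sum>k\<le>m. form_weight n v k * slope k y / form k x y) =
      (\<Sum>k = 0..n. margin_z v k * slope (form_index k) y / form (form_index k) x y)" for x y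
    using sum_form_weight[of n v "\<lambda>k. slope k y / form k x y"] by (simp add: form0)
  have 2: "(\<Sum>k\<le>m. form_weight n v k * den k x / form k x y) = 0 \<longleftrightarrow>
      y * (\<Sum>k = 0..n. margin_z v k * - den (form_index k) x / form (form_index k) x y) = margin_y n v"
    if "y \<noteq> 0" for x y
  proof -
    have "(\<Sum>k\<le>m. form_weight n v k * den k x / form k x y) = margin_y n v / y +
        (\<Sum>k = 0..n. margin_z v k * den (form_index k) x / form (form_index k) x y)"
      using sum_form_weight[of n v "\<lambda>k. den k x / form k x y"] by (simp add: form0)
    moreover have "(\<Sum>k = 0..n. margin_z v k * - den (form_index k) x / form (form_index k) x y) =
      - (\<Sum>k = 0..n. margin_z v k * den (form_index k) x / form (form_index k) x y)"
      by (simp add: sum_negf)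
    moreover have "M / y + X = 0 \<longleftrightarrow> y * - X = M" for M X
    proof -
      have "M / y + X = 0 \<longleftrightarrow> y * (M / y + X) = 0" using that by simp
      also have "\<dots> \<longleftrightarrow> M + y * X = 0" using that by (simp add: distrib_left)
      finally show ?thesis by (simp add: neg_eq_iff_add_eq_0 add.commute)
    qed
    ultimately show ?thesis by (simp only:)
  qed
  show ?thesis
    unfolding score_solutions_def sols_def curve_scaling all_iff 1 using 2 by auto
qed

lemma poly_fun_form_weight: "poly_fun (segre_index n) (\<lambda>v. form_weight n v l)"
proof (cases "l = 0")
  case True
  then show ?thesis by (simp add: form_weight_def poly_fun_intros poly_fun_margins)
next
  case False
  have "poly_fun (segre_index n) (\<lambda>v. \<Sum>k = 0..n. if form_index k = l then margin_z v k else 0)"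
    by (intro poly_fun_intros poly_fun_margins) auto
  with False show ?thesis by (simp add: form_weight_def)
qed

lemma poly_fun_gram:
  "poly_fun (segre_index n) (\<lambda>v. gram (form_weight n v) i j)"
  unfolding gram_def residue_right_def residue_left_def
  by (cases i; cases j) (auto intro!: poly_fun_intros poly_fun_form_weight)

lemma gram_scale: "gram (\<lambda>l. z * c l) i j = z * gram c i j"
proof -
  have "residue_left (\<lambda>l. z * c l) j = (\<lambda>l. z * residue_left c j l)"
    by (auto simp: residue_left_def fun_eq_iff sum_distrib_left[symmetric] algebra_simps split: collision.split)
  then show ?thesis by (simp add: gram_def residue_right_scale)
qed

lemma form_weight_data:
  "form_weight n (data_with_margins a b (\<lambda>_. z)) l =
    (if l = 0 then - b else of_nat (card {k \<in> {0..n}. form_index k = l}) * z)"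
proof -
  have "(\<Sum>k = 0..n. if form_index k = l then z else 0) = (\<Sum>k\<in>{k \<in> {0..n}. form_index k = l}. z)"
    by (rule sum.inter_filter[symmetric]) simp
  then show ?thesis by (simp add: form_weight_def margins_data_with_margins cong: if_cong)
qed

lemma card_form_index: "1 \<le> l \<Longrightarrow> l \<le> m \<Longrightarrow> m \<le> n + 1 \<Longrightarrow> 0 < card {k \<in> {0..n}. form_index k = l}"
  by (subst card_gt_0_iff) (auto simp: form_index_def intro!: exI[of _ "l - 1"])

lemma form_weight_linear:
  "margin_x n (\<lambda>i. v i + z * w i) = margin_x n v + z * margin_x n w"
  "form_weight n (\<lambda>i. v i + z * w i) l = form_weight n v l + z * form_weight n w l"
proof -
  show "margin_x n (\<lambda>i. v i + z * w i) = margin_x n v + z * margin_x n w"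
    by (simp add: margin_x_def sum_distrib_left sum.distrib[symmetric] algebra_simps)
  have "(\<Sum>k = 0..n. if form_index k = l then margin_z (\<lambda>i. v i + z * w i) k else 0) =
      (\<Sum>k = 0..n. (if form_index k = l then margin_z v k else 0) + z * (if form_index k = l then margin_z w k else 0))"
    by (intro sum.cong) (auto simp: margin_z_def algebra_simps)
  moreover have "margin_y n (\<lambda>i. v i + z * w i) = margin_y n v + z * margin_y n w"
    by (simp add: margin_y_def sum_distrib_left sum.distrib[symmetric] algebra_simps)
  ultimately show "form_weight n (\<lambda>i. v i + z * w i) l = form_weight n v l + z * form_weight n w l"
    by (simp add: form_weight_def sum.distrib sum_distrib_left)
qed

lemma has_mldeg_scaling:
  assumes n: "m \<le> n + 1"
  shows "has_mldeg n scaling (card J1)"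
proof (rule has_mldegI[OF scaling_nonzero], unfold score_solutions_scaling[OF n])
  let ?I = "segre_index n"
  \<comment> \<open>All weights and hence all entries of \<open>gram\<close> vanish here, which
    leaves the collisions as roots.\<close>
  let ?v0 = "data_with_margins 1 0 (\<lambda>_. 0)"
  let ?R = "\<lambda>v. pencil_roots J J0 pole (margin_x n v) (gram (form_weight n v))"
  let ?K = "\<lambda>v. pencil_kernel J J0 pole (margin_x n v) (gram (form_weight n v))"
  have v0: "margin_x n ?v0 = 1" "form_weight n ?v0 = (\<lambda>l. 0 * 0)"
    by (auto simp: margins_data_with_margins form_weight_data fun_eq_iff)
  have "generic ?I (\<lambda>v. finite (?R v) \<and> card (?R v) = card (J - J0) \<and> 0 \<notin> ?R v \<and>
    (\<forall>i\<in>J - J0. pole i \<notin> ?R v) \<and>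
    (\<forall>x \<xi> \<eta>. ?K v x \<xi> \<longrightarrow> ?K v x \<eta> \<longrightarrow> (\<exists>i\<in>J. \<xi> i \<noteq> 0) \<longrightarrow> (\<exists>c. \<forall>i\<in>J. \<eta> i = c * \<xi> i)))"
  proof (rule generic_pencil_roots)
    show "finite J" by (rule finite_J)
    show "J - J0 \<noteq> {}" unfolding J_diff using Pole_J[of 1] m by auto
    show "inj_on pole (J - J0)" unfolding J_diff J1_def by (rule inj_pole)
    show "pole i \<noteq> 0" if "i \<in> J - J0" for i using that pole_in_J1 unfolding J_diff by blast
    show "poly_fun ?I (margin_x n)" by (rule poly_fun_margins)
    show "poly_fun ?I (\<lambda>v. gram (form_weight n v) i j)" for i j by (rule poly_fun_gram)
    show "margin_x n ?v0 = 1" by (rule v0)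
    show "gram (form_weight n ?v0) i j = 0" for i j
      unfolding v0 gram_scale by simp
    fix i assume i: "i \<in> J - J0"
    have ex: "\<exists>w. gram (form_weight n w) i i \<noteq> 0 \<and> (\<forall>z. margin_x n (\<lambda>k. ?v0 k + z * w k) = 1 \<and>
        (\<forall>i\<in>J. \<forall>j\<in>J. gram (form_weight n (\<lambda>k. ?v0 k + z * w k)) i j = z * gram (form_weight n w) i j))"
      if w: "gram (form_weight n w) i i \<noteq> 0" "margin_x n w = 0" for w
    proof (intro exI[of _ w] conjI allI ballI)
      fix z i j
      show "margin_x n (\<lambda>k. ?v0 k + z * w k) = 1" unfolding form_weight_linear v0 w by simp
      have "form_weight n (\<lambda>k. ?v0 k + z * w k) = (\<lambda>l. z * form_weight n w l)"
        by (simp add: form_weight_linear v0 fun_eq_iff)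
      then show "gram (form_weight n (\<lambda>k. ?v0 k + z * w k)) i j = z * gram (form_weight n w) i j"
        by (simp only: gram_scale)
    qed (fact w)
    have "i \<in> J" using i by blast
    then show "\<exists>w. gram (form_weight n w) i i \<noteq> 0 \<and> (\<forall>z. margin_x n (\<lambda>k. ?v0 k + z * w k) = 1 \<and>
        (\<forall>i\<in>J. \<forall>j\<in>J. gram (form_weight n (\<lambda>k. ?v0 k + z * w k)) i j = z * gram (form_weight n w) i j))"
    proof (cases rule: J_cases)
      case (1 j)
      \<comment> \<open>The diagonal entry at \<open>Pole j\<close> is \<open>c j\<close> minus the
        total weight. With all weight, namely -1, on curve 0 it equals 1.\<close>
      have "(\<Sum>k\<le>m. form_weight n (data_with_margins 0 1 (\<lambda>_. 0)) k) = - 1"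
        using sum_form_weight[of n "data_with_margins 0 1 (\<lambda>_. 0)" "\<lambda>_. 1"]
        by (simp add: margins_data_with_margins)
      then show ?thesis using 1
        by (intro ex[of "data_with_margins 0 1 (\<lambda>_. 0)"])
          (auto simp: gram_def residue_right_def residue_left_def form_weight_data margins_data_with_margins)
    next
      case (2 k l \<rho>)
      \<comment> \<open>The diagonal entry at a crossing of \<open>k\<close> and \<open>l\<close> is
        \<open>c k + c l\<close>. Here the weights count indices, apart from the weight 0 of curve
        0, and curve \<open>l\<close> is used at least once.\<close>
      have "form_weight n (data_with_margins 0 0 (\<lambda>_. 1)) k + form_weight n (data_with_margins 0 0 (\<lambda>_. 1)) l \<noteq> 0"
      proof -
        let ?c = "\<lambda>l. card {k \<in> {0..n}. form_index k = l}"
        have "form_weight n (data_with_margins 0 0 (\<lambda>_. 1)) k + form_weight n (data_with_margins 0 0 (\<lambda>_. 1)) l =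
            of_nat ((if k = 0 then 0 else ?c k) + ?c l)"
          using 2 unfolding form_weight_data by simp
        also have "\<dots> \<noteq> 0"
          using 2 card_form_index[of l n] n unfolding of_nat_eq_0_iff by linarith
        finally show ?thesis .
      qed
      then show ?thesis using 2
        by (intro ex[of "data_with_margins 0 0 (\<lambda>_. 1)"])
          (auto simp: gram_def residue_right_def residue_left_def margins_data_with_margins)
    qed (use i in auto)
  qed
  moreover have "generic ?I (\<lambda>v. \<forall>l\<in>{..m}. form_weight n v l \<noteq> 0)"
  proof (rule generic_ball)
    fix l assume "l \<in> {..m}"
    then show "generic ?I (\<lambda>v. form_weight n v l \<noteq> 0)"
      using card_form_index[of l n] n
      by (intro generic_nonzero[of _ _ "data_with_margins 0 1 (\<lambda>_. 1)"] poly_fun_form_weight)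
        (auto simp: form_weight_data card_gt_0_iff not_less_eq_eq)
  qed simp
  moreover have "generic ?I (\<lambda>v. (\<Sum>l\<le>m. form_weight n v l) \<noteq> 0)"
  proof (rule generic_nonzero)
    show "poly_fun ?I (\<lambda>v. \<Sum>l\<le>m. form_weight n v l)" by (intro poly_fun_intros poly_fun_form_weight)
    show "(\<Sum>l\<le>m. form_weight n (data_with_margins 0 0 (\<lambda>_. 1)) l) \<noteq> 0"
      using sum_form_weight[of n "data_with_margins 0 0 (\<lambda>_. 1)" "\<lambda>_. 1"]
      by (simp add: margins_data_with_margins flip: of_nat_Suc)
  qed
  moreover have "generic ?I (\<lambda>v. margin_x n v \<noteq> 0)"
    by (rule generic_nonzero[of _ _ ?v0]) (auto simp: v0 poly_fun_margins)
  ultimately have "generic ?I (\<lambda>v. (finite (?R v) \<and> card (?R v) = card (J - J0) \<and> 0 \<notin> ?R v \<and>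
    (\<forall>i\<in>J - J0. pole i \<notin> ?R v) \<and>
    (\<forall>x \<xi> \<eta>. ?K v x \<xi> \<longrightarrow> ?K v x \<eta> \<longrightarrow> (\<exists>i\<in>J. \<xi> i \<noteq> 0) \<longrightarrow> (\<exists>c. \<forall>i\<in>J. \<eta> i = c * \<xi> i))) \<and>
    (\<forall>l\<in>{..m}. form_weight n v l \<noteq> 0) \<and> (\<Sum>l\<le>m. form_weight n v l) \<noteq> 0 \<and> margin_x n v \<noteq> 0)"
    by (rule generic_conj[OF _ generic_conj[OF _ generic_conj]])
  then show "generic ?I (\<lambda>v. finite (sols (form_weight n v) (margin_x n v)) \<and>
      card (sols (form_weight n v) (margin_x n v)) = card J1)"
  proof (rule generic_mono, elim conjE)
    fix v
    assume R: "finite (?R v)" "card (?R v) = card (J - J0)" "0 \<notin> ?R v" "\<forall>i\<in>J - J0. pole i \<notin> ?R v"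
      and K: "\<forall>x \<xi> \<eta>. ?K v x \<xi> \<longrightarrow> ?K v x \<eta> \<longrightarrow> (\<exists>i\<in>J. \<xi> i \<noteq> 0) \<longrightarrow> (\<exists>c. \<forall>i\<in>J. \<eta> i = c * \<xi> i)"
      and c: "\<forall>l\<in>{..m}. form_weight n v l \<noteq> 0" "(\<Sum>l\<le>m. form_weight n v l) \<noteq> 0" "margin_x n v \<noteq> 0"
    have "finite (sols (form_weight n v) (margin_x n v)) \<and>
        card (sols (form_weight n v) (margin_x n v)) = card (?R v)"
    proof (rule card_sols)
      show "pole i \<notin> ?R v" if "i \<in> J1" for i using R(4) that unfolding J_diff by blast
      show "\<exists>d. \<forall>i\<in>J. \<eta> i = d * \<xi> i" if "?K v x \<xi>" "?K v x \<eta>" "\<exists>i\<in>J. \<xi> i \<noteq> 0" for x \<xi> \<eta>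
        using K that by blast
    qed (use R c in auto)
    then show "finite (sols (form_weight n v) (margin_x n v)) \<and>
        card (sols (form_weight n v) (margin_x n v)) = card J1"
      using R(2) unfolding J_diff by simp
  qed
qed

end

section \<open>Arrangements with a prescribed number of collisions\<close>

text \<open>A nonzero discriminant makes roots at 0 and at infinity simple as well, so the constant
  and the leading coefficient each decide about exactly one root.\<close>

lemma quadratic_simple_roots:
  fixes q0 q1 q2 :: complex
  assumes "q1\<^sup>2 - 4 * q0 * q2 \<noteq> 0"
  shows "\<exists>\<epsilon> \<kappa>. \<kappa> \<noteq> 0 \<and> finite {x. x \<noteq> 0 \<and> q0 + q1 * x + q2 * x\<^sup>2 = 0} \<and>
    card {x. x \<noteq> 0 \<and> q0 + q1 * x + q2 * x\<^sup>2 = 0} = (if q0 = 0 then 0 else 1) + (if q2 = 0 then 0 else 1) \<and>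
    (\<forall>x. q0 + q1 * x + q2 * x\<^sup>2 = \<kappa> * x ^ \<epsilon> * (\<Prod>\<rho>\<in>{x. x \<noteq> 0 \<and> q0 + q1 * x + q2 * x\<^sup>2 = 0}. x - \<rho>))"
proof -
  let ?S = "{x. x \<noteq> 0 \<and> q0 + q1 * x + q2 * x\<^sup>2 = 0}"
  consider "q0 = 0" "q2 = 0" | "q0 = 0" "q2 \<noteq> 0" | "q0 \<noteq> 0" "q2 = 0" | "q0 \<noteq> 0" "q2 \<noteq> 0" by blast
  then show ?thesis
  proof cases
    case 1
    then have "q1 \<noteq> 0" using assms by auto
    with 1 have "?S = {}" by auto
    show ?thesis unfolding \<open>?S = {}\<close> using 1 \<open>q1 \<noteq> 0\<close> by (intro exI[of _ 1] exI[of _ q1]) auto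
  next
    case 2
    then have "q1 \<noteq> 0" using assms by auto
    have fac: "q0 + q1 * x + q2 * x\<^sup>2 = q2 * x ^ 1 * (x - - q1 / q2)" for x
      using 2 by (simp add: right_diff_distrib power2_eq_square algebra_simps)
    have "?S = {- q1 / q2}" unfolding fac using 2 \<open>q1 \<noteq> 0\<close> by (auto simp: eq_neg_iff_add_eq_0)
    then show ?thesis using 2 fac by (intro exI[of _ 1] exI[of _ q2]) auto
  next
    case 3
    then have "q1 \<noteq> 0" using assms by auto
    have fac: "q0 + q1 * x + q2 * x\<^sup>2 = q1 * x ^ 0 * (x - - q0 / q1)" for x
      using 3 \<open>q1 \<noteq> 0\<close> by (simp add: right_diff_distrib power2_eq_square algebra_simps)
    have "?S = {- q0 / q1}" unfolding fac using 3 \<open>q1 \<noteq> 0\<close> by (auto simp: eq_neg_iff_add_eq_0)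
    then show ?thesis using 3 \<open>q1 \<noteq> 0\<close> fac by (intro exI[of _ 0] exI[of _ q1]) auto
  next
    case 4
    define D where "D = csqrt (q1\<^sup>2 - 4 * q0 * q2)"
    have D2: "D * D = q1 * q1 - 4 * q0 * q2"
      unfolding D_def power2_eq_square[symmetric] by simp
    have "D \<noteq> 0" using assms by (simp add: D_def)
    define \<rho>1 where "\<rho>1 = (- q1 + D) / (2 * q2)"
    define \<rho>2 where "\<rho>2 = (- q1 - D) / (2 * q2)"
    have "\<rho>1 - \<rho>2 = D / q2" using 4 by (simp add: \<rho>1_def \<rho>2_def diff_divide_distrib[symmetric])
    then have "\<rho>1 \<noteq> \<rho>2" using \<open>D \<noteq> 0\<close> 4 by auto
    have sum: "q2 * (\<rho>1 + \<rho>2) = - q1"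
      using 4 by (simp add: \<rho>1_def \<rho>2_def add_divide_distrib[symmetric])
    have "(2 * q2) * (2 * q2) * (\<rho>1 * \<rho>2) = (- q1 + D) * (- q1 - D)"
      using 4 by (simp add: \<rho>1_def \<rho>2_def)
    also have "\<dots> = 4 * q0 * q2" using D2 by (simp add: algebra_simps)
    finally have prod: "q2 * (\<rho>1 * \<rho>2) = q0" using 4 by simp
    have fac: "q0 + q1 * x + q2 * x\<^sup>2 = q2 * x ^ 0 * ((x - \<rho>1) * (x - \<rho>2))" for x
    proof -
      have "q2 * x ^ 0 * ((x - \<rho>1) * (x - \<rho>2)) = q2 * (\<rho>1 * \<rho>2) - q2 * (\<rho>1 + \<rho>2) * x + q2 * x\<^sup>2"
        by (simp add: algebra_simps power2_eq_square)
      then show ?thesis unfolding sum prod by simp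
    qed
    have "\<rho>1 \<noteq> 0" "\<rho>2 \<noteq> 0" using prod 4 by auto
    then have "?S = {\<rho>1, \<rho>2}" unfolding fac using 4 by auto
    then show ?thesis using 4 \<open>\<rho>1 \<noteq> \<rho>2\<close> fac by (intro exI[of _ 0] exI[of _ q2]) auto
  qed
qed

text \<open>With \<open>s l = B l * t l\<close>, the numbers \<open>A l\<close> and
  \<open>B l\<close> are the values of curve \<open>l\<close> at \<open>x = 0\<close> and
  \<open>x = \<infinity>\<close>. Coincidences there are prescribed by \<open>A\<close> and
  \<open>B\<close>, while the \<open>t l\<close> stay free to separate all other collisions.\<close>

definition crossing :: "(nat \<Rightarrow> complex) \<Rightarrow> (nat \<Rightarrow> complex) \<Rightarrow> (nat \<Rightarrow> complex) \<Rightarrow> nat \<Rightarrow> nat \<Rightarrow> complex \<Rightarrow> complex" where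
  "crossing A B t k l x = (1 + t k * x) * (A l + B l * t l * x) - (1 + t l * x) * (A k + B k * t k * x)"

definition crossing_zeros :: "(nat \<Rightarrow> complex) \<Rightarrow> (nat \<Rightarrow> complex) \<Rightarrow> (nat \<Rightarrow> complex) \<Rightarrow> nat \<Rightarrow> nat \<Rightarrow> complex set" where
  "crossing_zeros A B t k l = {x. x \<noteq> 0 \<and> crossing A B t k l x = 0}"

definition crossing_discr :: "(nat \<Rightarrow> complex) \<Rightarrow> (nat \<Rightarrow> complex) \<Rightarrow> (nat \<Rightarrow> complex) \<Rightarrow> nat \<Rightarrow> nat \<Rightarrow> complex" where
  "crossing_discr A B t k l = (t l * (B l - A k) + t k * (A l - B k))\<^sup>2 -
    4 * (A l - A k) * (t k * t l * (B l - B k))"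

definition earlier_poles :: "(nat \<Rightarrow> complex) \<Rightarrow> (nat \<Rightarrow> complex) \<Rightarrow> (nat \<Rightarrow> complex) \<Rightarrow> nat \<Rightarrow> complex set" where
  "earlier_poles A B t l = (\<lambda>j. - 1 / t j) ` {1..<l} \<union> (\<Union>k'\<in>{..<l}. \<Union>k\<in>{..<k'}. crossing_zeros A B t k k')"

text \<open>Compares curve \<open>l\<close> with the earlier ones only, so that the parameters can
  be chosen one after another.\<close>

definition general_position :: "(nat \<Rightarrow> complex) \<Rightarrow> (nat \<Rightarrow> complex) \<Rightarrow> (nat \<Rightarrow> complex) \<Rightarrow> nat \<Rightarrow> bool" where
  "general_position A B t l \<longleftrightarrow> t l \<noteq> 0 \<and> (\<forall>k<l. t l \<noteq> t k \<and> crossing_discr A B t k l \<noteq> 0) \<and>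
    (\<forall>x\<in>earlier_poles A B t l. 1 + t l * x \<noteq> 0 \<and> (\<forall>k<l. crossing A B t k l x \<noteq> 0))"

lemma crossing_quadratic:
  "crossing A B t k l x = (A l - A k) + (t l * (B l - A k) + t k * (A l - B k)) * x + (t k * t l * (B l - B k)) * x\<^sup>2"
  by (simp add: crossing_def algebra_simps power2_eq_square)

lemma crossing_zeros:
  assumes "crossing_discr A B t k l \<noteq> 0"
  shows "finite (crossing_zeros A B t k l)"
    and "card (crossing_zeros A B t k l) = (if A l = A k then 0 else 1) + (if t k * t l * (B l - B k) = 0 then 0 else 1)"
    and "\<exists>\<epsilon> \<kappa>. \<kappa> \<noteq> 0 \<and> (\<forall>x. crossing A B t k l x = \<kappa> * x ^ \<epsilon> * (\<Prod>\<rho>\<in>crossing_zeros A B t k l. x - \<rho>))"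
proof -
  obtain \<epsilon> \<kappa> where *: "\<kappa> \<noteq> 0" "finite (crossing_zeros A B t k l)"
    "card (crossing_zeros A B t k l) = (if A l - A k = 0 then 0 else 1) + (if t k * t l * (B l - B k) = 0 then 0 else 1)"
    "\<forall>x. crossing A B t k l x = \<kappa> * x ^ \<epsilon> * (\<Prod>\<rho>\<in>crossing_zeros A B t k l. x - \<rho>)"
    using quadratic_simple_roots[OF assms[unfolded crossing_discr_def]]
    unfolding crossing_zeros_def crossing_quadratic by blast
  show "finite (crossing_zeros A B t k l)" by (rule *)
  show "card (crossing_zeros A B t k l) = (if A l = A k then 0 else 1) + (if t k * t l * (B l - B k) = 0 then 0 else 1)"
    unfolding *(3) by (simp only: right_minus_eq)
  show "\<exists>\<epsilon> \<kappa>. \<kappa> \<noteq> 0 \<and> (\<forall>x. crossing A B t k l x = \<kappa> * x ^ \<epsilon> * (\<Prod>\<rho>\<in>crossing_zeros A B t k l. x - \<rho>))"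
    using *(1,4) by blast
qed

text \<open>Each requirement on the next parameter says that a nonzero polynomial in it does not
  vanish. The polynomials are nonzero because \<open>A\<close> and \<open>B\<close> never agree: a
  curve with \<open>A l = B l\<close> would be constant, and \<open>A l = B k\<close> would spoil
  the discriminant.\<close>

lemma ex_general_position:
  assumes A0: "A 0 = 0" "B 0 = 0" and AB: "\<And>k l. 1 \<le> k \<Longrightarrow> 1 \<le> l \<Longrightarrow> A k \<noteq> B l"
    and nz: "\<And>l. 1 \<le> l \<Longrightarrow> A l \<noteq> 0 \<and> B l \<noteq> 0"
  shows "\<exists>t. t 0 = 0 \<and> (\<forall>l\<in>{1..m}. general_position A B t l)"
proof (induction m)
  case 0
  show ?case by (intro exI[of _ "\<lambda>_. 0"]) auto
next
  case (Suc m)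
  then obtain t where t0: "t 0 = 0" and t: "\<And>l. 1 \<le> l \<Longrightarrow> l \<le> m \<Longrightarrow> general_position A B t l" by auto
  let ?l = "Suc m"
  have tnz: "t k \<noteq> 0" if "1 \<le> k" "k \<le> m" for k using t[OF that] by (simp add: general_position_def)
  define X where "X = earlier_poles A B t ?l"
  have "finite X"
    unfolding X_def earlier_poles_def
  proof (intro finite_UnI finite_imageI finite_UN_I finite_lessThan finite_atLeastLessThan)
    fix k' k assume "k' \<in> {..<?l}" "k \<in> {..<k'}"
    then show "finite (crossing_zeros A B t k k')"
      using t[of k'] by (intro crossing_zeros) (auto simp: general_position_def)
  qed
  have X0: "x \<noteq> 0" if "x \<in> X" for x
    using that tnz by (auto simp: X_def earlier_poles_def crossing_zeros_def)
  \<comment> \<open>The four obstructions as polynomials in the new parameter: a pole of the new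
    curve at an earlier collision \<open>x\<close>, a crossing with curve \<open>k\<close> at
    \<open>x\<close>, a tangency with curve \<open>k\<close>, and a common pole with curve
    \<open>k\<close>.\<close>
  define bad1 where "bad1 x = [:1, x:]" for x :: complex
  define bad2 where "bad2 k x = [:(1 + t k * x) * A ?l - (A k + B k * t k * x),
    x * ((1 + t k * x) * B ?l - (A k + B k * t k * x)):]" for k x
  define bad3 where "bad3 k = [:t k * (A ?l - B k), B ?l - A k:]\<^sup>2 -
    [:0, 4 * (A ?l - A k) * t k * (B ?l - B k):]" for k
  define bad4 where "bad4 k = [:- t k, 1:]" for k
  define p where "p = (\<Prod>x\<in>X. bad1 x) * (\<Prod>x\<in>X. \<Prod>k\<le>m. bad2 k x) * (\<Prod>k\<le>m. bad3 k) * (\<Prod>k\<le>m. bad4 k)"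
  have "bad2 k x \<noteq> 0" if "x \<in> X" "k \<le> m" for k x
  proof
    assume "bad2 k x = 0"
    then have *: "(1 + t k * x) * A ?l = A k + B k * t k * x" "(1 + t k * x) * B ?l = A k + B k * t k * x"
      using X0[OF that(1)] by (auto simp: bad2_def)
    then have "(1 + t k * x) * (A ?l - B ?l) = 0" by (simp add: right_diff_distrib)
    then have **: "1 + t k * x = 0" using AB[of ?l ?l] by simp
    then have "k \<noteq> 0" using t0 by (metis add.right_neutral mult_zero_left one_neq_zero)
    have "t k * x = - 1" using ** by (simp add: add_eq_0_iff)
    then have "A k = B k" using *(1) ** by (simp add: mult.assoc)
    then show False using AB[of k k] \<open>k \<noteq> 0\<close> by simp
  qed
  moreover have "bad3 k \<noteq> 0" if "k \<le> m" for k
  proof (cases "k = 0")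
    case True
    have "poly (bad3 k) 1 \<noteq> 0" unfolding bad3_def True using t0 A0 nz[of ?l] by simp
    then show ?thesis by auto
  next
    case False
    have "poly (bad3 k) 0 \<noteq> 0" unfolding bad3_def using tnz[of k] AB[of ?l k] False that by simp
    then show ?thesis by auto
  qed
  ultimately have "p \<noteq> 0"
    using \<open>finite X\<close> by (auto simp: p_def bad1_def bad4_def)
  then have "finite {\<tau>. poly p \<tau> = 0}" by (rule poly_roots_finite)
  then obtain \<tau> where "\<tau> \<notin> {\<tau>. poly p \<tau> = 0}"
    using ex_new_if_finite[OF infinite_UNIV_char_0] by blast
  then have "poly p \<tau> \<noteq> 0" by simp
  then have \<tau>: "\<And>x. x \<in> X \<Longrightarrow> poly (bad1 x) \<tau> \<noteq> 0" "\<And>x k. x \<in> X \<Longrightarrow> k \<le> m \<Longrightarrow> poly (bad2 k x) \<tau> \<noteq> 0"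
    "\<And>k. k \<le> m \<Longrightarrow> poly (bad3 k) \<tau> \<noteq> 0" "\<And>k. k \<le> m \<Longrightarrow> poly (bad4 k) \<tau> \<noteq> 0"
    using \<open>finite X\<close> by (auto simp: p_def poly_prod)
  define t' where "t' = t(?l := \<tau>)"
  have t': "t' k = t k" if "k \<le> m" for k using that by (simp add: t'_def)
  have t'l: "t' ?l = \<tau>" by (simp add: t'_def)
  have cz: "crossing_zeros A B t' k l = crossing_zeros A B t k l" "crossing_discr A B t' k l = crossing_discr A B t k l"
    "crossing A B t' k l = crossing A B t k l" if "k < l" "l \<le> m" for k l
    using that t'[of k] t'[of l] by (auto simp: crossing_zeros_def crossing_def[abs_def] crossing_discr_def)
  have ep: "earlier_poles A B t' l = earlier_poles A B t l" if "l \<le> ?l" for l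
    unfolding earlier_poles_def using that cz t' by (intro arg_cong2[of _ _ _ _ "(\<union>)"] image_cong SUP_cong) auto
  have "general_position A B t' l" if "1 \<le> l" "l \<le> m" for l
    using t[OF that] that ep[of l] cz[of _ l] t' unfolding general_position_def by auto
  moreover have "general_position A B t' ?l"
    unfolding general_position_def ep[OF order_refl] X_def[symmetric]
  proof (intro conjI allI impI ballI)
    show "t' ?l \<noteq> 0" using \<tau>(4)[of 0] t0 by (simp add: bad4_def t'l)
    fix k assume "k < ?l"
    then have k: "k \<le> m" by simp
    show "t' ?l \<noteq> t' k" using \<tau>(4)[OF k] t'[OF k] by (auto simp: bad4_def t'l)
    show "crossing_discr A B t' k ?l \<noteq> 0"
      using \<tau>(3)[OF k] unfolding crossing_discr_def t'l t'[OF k] by (simp add: bad3_def algebra_simps)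
  next
    fix x assume x: "x \<in> X"
    show "1 + t' ?l * x \<noteq> 0" using \<tau>(1)[OF x] by (simp add: bad1_def t'l)
    fix k assume "k < ?l"
    then have k: "k \<le> m" by simp
    show "crossing A B t' k ?l x \<noteq> 0"
      using \<tau>(2)[OF x k] unfolding crossing_def t'l t'[OF k] by (simp add: bad2_def algebra_simps)
  qed
  ultimately show ?case
    using t0 t'[of 0] by (intro exI[of _ t']) (auto simp: le_Suc_eq)
qed

text \<open>Only the distinctness of the collisions needs an argument; their level is the largest
  curve involved. On different levels they differ by general position. On level \<open>l\<close>, a
  crossing with \<open>k\<close> at the pole of \<open>l\<close> would be a pole of \<open>k\<close>
  too, and two crossings with \<open>k\<close> and \<open>k'\<close> at the same place would make
  \<open>k\<close> and \<open>k'\<close> cross there, an earlier collision that curve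
  \<open>l\<close> has to avoid.\<close>

lemma mobius_arrangement_of_general_position:
  fixes A B t :: "nat \<Rightarrow> complex"
  assumes m: "1 \<le> m" and A0: "A 0 = 0" "B 0 = 0" "t 0 = 0"
    and AB: "\<And>k l. 1 \<le> k \<Longrightarrow> 1 \<le> l \<Longrightarrow> A k \<noteq> B l" and nz: "\<And>l. 1 \<le> l \<Longrightarrow> A l \<noteq> 0 \<and> B l \<noteq> 0"
    and gp: "\<And>l. 1 \<le> l \<Longrightarrow> l \<le> m \<Longrightarrow> general_position A B t l"
  shows "\<exists>\<epsilon> \<kappa>. mobius_arrangement m A (\<lambda>l. B l * t l) t (crossing_zeros A B t) \<epsilon> \<kappa>"
proof -
  have t: "t l \<noteq> 0" if "1 \<le> l" "l \<le> m" for l using gp[OF that] by (simp add: general_position_def)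
  have discr: "crossing_discr A B t k l \<noteq> 0" if "k < l" "l \<le> m" for k l
    using gp[of l] that by (auto simp: general_position_def)
  have "\<forall>k l. \<exists>\<epsilon> \<kappa>. k < l \<and> l \<le> m \<longrightarrow> \<kappa> \<noteq> 0 \<and>
      (\<forall>x. crossing A B t k l x = \<kappa> * x ^ \<epsilon> * (\<Prod>\<rho>\<in>crossing_zeros A B t k l. x - \<rho>))"
    using crossing_zeros(3)[OF discr] by blast
  then obtain \<epsilon> \<kappa> where \<epsilon>\<kappa>: "\<And>k l. k < l \<Longrightarrow> l \<le> m \<Longrightarrow> \<kappa> k l \<noteq> 0"
      "\<And>k l x. k < l \<Longrightarrow> l \<le> m \<Longrightarrow> crossing A B t k l x = \<kappa> k l * x ^ \<epsilon> k l * (\<Prod>\<rho>\<in>crossing_zeros A B t k l. x - \<rho>)"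
    by metis
  define pole :: "collision \<Rightarrow> complex" where
    "pole = (\<lambda>i. case i of Pole j \<Rightarrow> - 1 / t j | Cross k l \<rho> \<Rightarrow> \<rho> | CrossZero k l \<Rightarrow> 0)"
  define level where "level = (\<lambda>i. case i of Pole j \<Rightarrow> j | Cross k l \<rho> \<Rightarrow> l | CrossZero k l \<Rightarrow> l)"
  define J where "J = Pole ` {1..m} \<union> (\<lambda>(l, k, \<rho>). Cross k l \<rho>) ` (SIGMA l:{..m}. SIGMA k:{..<l}. crossing_zeros A B t k l)"
  have J_cases: "(\<exists>j. i = Pole j \<and> 1 \<le> j \<and> j \<le> m) \<or> (\<exists>k l \<rho>. i = Cross k l \<rho> \<and> k < l \<and> l \<le> m \<and> \<rho> \<in> crossing_zeros A B t k l)"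
    if "i \<in> J" for i
    using that by (auto simp: J_def)
  have earlier: "pole i \<in> earlier_poles A B t l" if "i \<in> J" "level i < l" for i l
    using J_cases[OF that(1)] that(2)
    by (auto simp: pole_def level_def earlier_poles_def)
  have new: "1 + t (level i) * pole i = 0 \<or> (\<exists>k<level i. crossing A B t k (level i) (pole i) = 0)" if "i \<in> J" for i
    using J_cases[OF that] t by (fastforce simp: pole_def level_def crossing_zeros_def)
  have level: "1 \<le> level i" "level i \<le> m" if "i \<in> J" for i
    using J_cases[OF that] by (auto simp: level_def)
  have lt: "pole i \<noteq> pole j" if "i \<in> J" "j \<in> J" "level i < level j" for i j
    using earlier[OF that(1,3)] new[OF that(2)] gp[OF level[OF that(2)]] by (auto simp: general_position_def)
  have det: "A l - B l \<noteq> 0" if "1 \<le> l" for l using AB[of l l] that by simp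
  have eq: "i = j" if ij: "i \<in> J" "j \<in> J" "level i = level j" "pole i = pole j" for i j
  proof -
    define l where "l = level i"
    have l: "1 \<le> l" "l \<le> m" "level j = l" using level[OF ij(1)] ij(3) by (auto simp: l_def)
    have tl: "t l \<noteq> 0" using t l by blast
    have Pole_Cross: "- 1 / t l \<noteq> \<rho>" if "k < l" "\<rho> \<in> crossing_zeros A B t k l" for k \<rho>
    proof
      assume "- 1 / t l = \<rho>"
      then have \<rho>: "t l * \<rho> = - 1" using tl by auto
      have "(1 + t k * \<rho>) * (A l - B l) = 0"
        using that(2) \<rho> by (simp add: crossing_zeros_def crossing_def mult.assoc)
      then have "t k * \<rho> = - 1" using det[OF l(1)] by (simp add: add_eq_0_iff)
      then have "t k = t l" using \<rho> by (metis mult_right_cancel mult_zero_right neg_equal_0_iff_equal one_neq_zero)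
      then show False using gp[OF l(1,2)] that(1) by (auto simp: general_position_def)
    qed
    have Cross_Cross: False
      if "k < k'" "k' < l" "\<rho> \<in> crossing_zeros A B t k l" "\<rho> \<in> crossing_zeros A B t k' l" for k k' \<rho>
    proof -
      define N where "N k = A k + B k * t k * \<rho>" for k
      define Q where "Q k = 1 + t k * \<rho>" for k
      have 1: "Q k * N l = Q l * N k" "Q k' * N l = Q l * N k'" and \<rho>0: "\<rho> \<noteq> 0"
        using that(3,4) by (simp_all add: crossing_zeros_def crossing_def N_def Q_def)
      have "Q k * N k' - Q k' * N k = 0"
      proof (cases "Q l = 0")
        case False
        have "Q l * (Q k * N k' - Q k' * N k) = Q k * (Q l * N k') - Q k' * (Q l * N k)"
          by (simp add: algebra_simps)
        also have "\<dots> = 0" unfolding 1[symmetric] by (simp add: algebra_simps)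
        finally show ?thesis using False by simp
      next
        case True
        then have "t l * \<rho> = - 1" by (simp add: Q_def add_eq_0_iff)
        then have "N l = A l - B l" by (simp add: N_def mult.assoc)
        then have "Q k = 0" "Q k' = 0" using 1 True det[OF l(1)] by auto
        then show ?thesis by simp
      qed
      then have "\<rho> \<in> crossing_zeros A B t k k'"
        using \<rho>0 by (simp add: crossing_zeros_def crossing_def N_def Q_def)
      then have "\<rho> \<in> earlier_poles A B t l" using that by (auto simp: earlier_poles_def)
      then show False using gp[OF l(1,2)] that by (auto simp: general_position_def crossing_zeros_def)
    qed
    have Cross_Cross': "k = k'"
      if "k < l" "k' < l" "\<rho> \<in> crossing_zeros A B t k l" "\<rho> \<in> crossing_zeros A B t k' l" for k k' \<rho>
      using Cross_Cross[of k k' \<rho>] Cross_Cross[of k' k \<rho>] that by (meson linorder_neqE_nat)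
    have levels: "level i = l" "level j = l" using l by (simp_all add: l_def)
    from J_cases[OF ij(1)] show ?thesis
    proof (elim disjE exE conjE)
      fix j1 assume i: "i = Pole j1"
      then have "j1 = l" using levels by (simp add: level_def)
      from J_cases[OF ij(2)] show ?thesis
      proof (elim disjE exE conjE)
        fix j2 assume "j = Pole j2"
        then show ?thesis using i ij(3) by (simp add: level_def)
      next
        fix k l' \<rho> assume j: "j = Cross k l' \<rho>" "k < l'" "\<rho> \<in> crossing_zeros A B t k l'"
        then have "l' = l" using levels by (simp add: level_def)
        then show ?thesis using Pole_Cross[of k \<rho>] i j ij(4) \<open>j1 = l\<close> by (simp add: pole_def)
      qed
    next
      fix k l' \<rho> assume i: "i = Cross k l' \<rho>" "k < l'" "\<rho> \<in> crossing_zeros A B t k l'"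
      then have "l' = l" using levels by (simp add: level_def)
      from J_cases[OF ij(2)] show ?thesis
      proof (elim disjE exE conjE)
        fix j2 assume "j = Pole j2"
        moreover from this have "j2 = l" using levels by (simp add: level_def)
        ultimately show ?thesis using Pole_Cross[of k \<rho>] i ij(4) \<open>l' = l\<close> by (simp add: pole_def)
      next
        fix k2 l2 \<rho>2 assume j: "j = Cross k2 l2 \<rho>2" "k2 < l2" "\<rho>2 \<in> crossing_zeros A B t k2 l2"
        then have "l2 = l" using levels by (simp add: level_def)
        moreover have "\<rho>2 = \<rho>" using ij(4) i(1) j(1) by (simp add: pole_def)
        ultimately show ?thesis using Cross_Cross'[of k k2 \<rho>] i j \<open>l' = l\<close> by simp
      qed
    qed
  qed
  have "mobius_arrangement m A (\<lambda>l. B l * t l) t (crossing_zeros A B t) \<epsilon> \<kappa>"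
  proof
    show "inj_on (\<lambda>i. case i of Pole j \<Rightarrow> - 1 / t j | Cross k l \<rho> \<Rightarrow> \<rho> | CrossZero k l \<Rightarrow> 0)
        (Pole ` {1..m} \<union> (\<lambda>(l, k, \<rho>). Cross k l \<rho>) ` (SIGMA l:{..m}. SIGMA k:{..<l}. crossing_zeros A B t k l))"
      unfolding pole_def[symmetric] J_def[symmetric]
      using lt eq by (intro inj_onI) (metis linorder_neqE_nat)
    show "(1 + t k * x) * (A l + B l * t l * x) - (1 + t l * x) * (A k + B k * t k * x) =
        \<kappa> k l * x ^ \<epsilon> k l * (\<Prod>\<rho>\<in>crossing_zeros A B t k l. x - \<rho>)" if "k < l" "l \<le> m" for k l x
      using \<epsilon>\<kappa>(2)[OF that] by (simp add: crossing_def)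
    show "finite (crossing_zeros A B t k l) \<and> 0 \<notin> crossing_zeros A B t k l" if "k < l" "l \<le> m" for k l
      using crossing_zeros(1)[OF discr[OF that]] by (simp add: crossing_zeros_def)
    show "A l \<noteq> 0 \<and> B l * t l \<noteq> 0 \<and> t l \<noteq> 0" if "1 \<le> l" "l \<le> m" for l
      using nz[of l] t[OF that] that by simp
  qed (use m A0 \<epsilon>\<kappa>(1) in auto)
  then show ?thesis by blast
qed

lemma (in mobius_arrangement) ex_has_mldeg_arrangement:
  assumes "m \<le> n + 1" "r = m + (\<Sum>l\<le>m. \<Sum>k<l. card (S k l))"
  shows "\<exists>W. (\<forall>i\<in>segre_index n. W i \<noteq> 0) \<and> has_mldeg n W r"
  using scaling_nonzero has_mldeg_scaling[OF assms(1)] unfolding card_J1 assms(2) by blast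

text \<open>The sum of \<open>g choose 2\<close> over the sizes \<open>g\<close> of the label
  classes, written row by row to match the count of crossings.\<close>

definition label_pairs :: "(nat \<Rightarrow> nat) \<Rightarrow> nat \<Rightarrow> nat" where
  "label_pairs \<alpha> m = (\<Sum>l = 1..m. card {k \<in> {1..<l}. \<alpha> k = \<alpha> l})"

text \<open>\<open>\<alpha>\<close> and \<open>\<beta>\<close> tell which curves agree at
  \<open>x = 0\<close> and at \<open>x = \<infinity>\<close>; each agreeing pair costs one
  collision.\<close>

lemma ex_has_mldeg_labels:
  fixes \<alpha> \<beta> :: "nat \<Rightarrow> nat"
  assumes m: "1 \<le> m" "m \<le> n + 1" and r: "r + label_pairs \<alpha> m + label_pairs \<beta> m = m * (m + 1)"
  shows "\<exists>W. (\<forall>i\<in>segre_index n. W i \<noteq> 0) \<and> has_mldeg n W r"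
proof -
  \<comment> \<open>Odd values for \<open>A\<close> and positive even values for \<open>B\<close>:
    they are nonzero, never meet each other, and coincide among themselves exactly when the labels
    do.\<close>
  define A :: "nat \<Rightarrow> complex" where "A l = (if l = 0 then 0 else of_nat (2 * \<alpha> l + 1))" for l
  define B :: "nat \<Rightarrow> complex" where "B l = (if l = 0 then 0 else of_nat (2 * \<beta> l + 2))" for l
  have A0: "A 0 = 0" "B 0 = 0" by (simp_all add: A_def B_def)
  have A_eq: "A k = A l \<longleftrightarrow> \<alpha> k = \<alpha> l" "B k = B l \<longleftrightarrow> \<beta> k = \<beta> l" if "1 \<le> k" "1 \<le> l" for k l
    using that unfolding A_def B_def by (auto simp del: of_nat_add of_nat_mult)
  have AB: "A k \<noteq> B l" if "1 \<le> k" "1 \<le> l" for k l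
  proof -
    have "A k = of_nat (2 * \<alpha> k + 1)" "B l = of_nat (2 * \<beta> l + 2)"
      using that unfolding A_def B_def by auto
    moreover have "2 * \<alpha> k + 1 \<noteq> 2 * \<beta> l + 2" by presburger
    ultimately show ?thesis by (metis of_nat_eq_iff)
  qed
  have nz: "A l \<noteq> 0 \<and> B l \<noteq> 0" if "1 \<le> l" for l
    using that unfolding A_def B_def by (simp del: of_nat_add of_nat_mult of_nat_Suc)
  obtain t where t0: "t 0 = 0" and gp: "\<And>l. 1 \<le> l \<Longrightarrow> l \<le> m \<Longrightarrow> general_position A B t l"
    using ex_general_position[of A B m] A0 AB nz by auto
  obtain \<epsilon> \<kappa> where ma: "mobius_arrangement m A (\<lambda>l. B l * t l) t (crossing_zeros A B t) \<epsilon> \<kappa>"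
    using mobius_arrangement_of_general_position[OF m(1) A0 t0 AB nz gp] by blast
  have t: "t l \<noteq> 0" if "1 \<le> l" "l \<le> m" for l using gp[OF that] by (simp add: general_position_def)
  have card_S: "card (crossing_zeros A B t k l) = (if A l = A k then 0 else 1) + (if t k * t l * (B l - B k) = 0 then 0 else 1)"
    if "k < l" "l \<le> m" for k l
    using gp[of l] that by (intro crossing_zeros(2)) (auto simp: general_position_def)
  \<comment> \<open>Curve 0 is met once, and each of the other \<open>l - 1\<close> earlier curves
    twice, apart from the coincidences at 0 and infinity.\<close>
  have row: "(\<Sum>k<l. card (crossing_zeros A B t k l)) + card {k \<in> {1..<l}. \<alpha> k = \<alpha> l} + card {k \<in> {1..<l}. \<beta> k = \<beta> l} = 2 * l - 1"
    if l: "1 \<le> l" "l \<le> m" for l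
  proof -
    have "{..<l} = insert 0 {1..<l}" using l by auto
    then have "(\<Sum>k<l. card (crossing_zeros A B t k l)) = card (crossing_zeros A B t 0 l) + (\<Sum>k = 1..<l. card (crossing_zeros A B t k l))"
      by simp
    moreover have "card (crossing_zeros A B t 0 l) = 1"
      using card_S[of 0 l] l nz[of l] A0 t0 by simp
    moreover have "card {k \<in> {1..<l}. \<gamma> k = \<gamma> l} = (\<Sum>k = 1..<l. if \<gamma> k = \<gamma> l then 1 else 0)" for \<gamma> :: "nat \<Rightarrow> nat"
      unfolding card_eq_sum by (rule sum.inter_filter) simp
    moreover have "(\<Sum>k = 1..<l. card (crossing_zeros A B t k l)) + (\<Sum>k = 1..<l. if \<alpha> k = \<alpha> l then 1 else 0) +
        (\<Sum>k = 1..<l. if \<beta> k = \<beta> l then 1 else 0) = (\<Sum>k = 1..<l. 2)"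
      unfolding sum.distrib[symmetric]
    proof (intro sum.cong refl)
      fix k assume "k \<in> {1..<l}"
      then have k: "1 \<le> k" "k < l" by auto
      have "t k \<noteq> 0" "t l \<noteq> 0" using t k l by auto
      then have "t k * t l * (B l - B k) = 0 \<longleftrightarrow> B k = B l" by auto
      then have "card (crossing_zeros A B t k l) = (if \<alpha> k = \<alpha> l then 0 else 1) + (if \<beta> k = \<beta> l then 0 else 1)"
        unfolding card_S[OF k(2) l(2)] eq_commute[of "A l"] A_eq[OF k(1) l(1)] by (simp only: A_eq[OF k(1) l(1)])
      then show "card (crossing_zeros A B t k l) + (if \<alpha> k = \<alpha> l then 1 else 0) + (if \<beta> k = \<beta> l then 1 else 0) = 2"
        by simp
    qed
    ultimately show ?thesis using l by simp
  qed
  have sum_eq: "(\<Sum>l\<le>m. h l) = (\<Sum>l = 1..m. h l)" if "h 0 = 0" for h :: "nat \<Rightarrow> nat"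
    using that by (intro sum.mono_neutral_right) (auto simp: not_less_eq_eq)
  have "(\<Sum>l\<le>m. \<Sum>k<l. card (crossing_zeros A B t k l)) = (\<Sum>l = 1..m. \<Sum>k<l. card (crossing_zeros A B t k l))"
    by (rule sum_eq) simp
  then have "(\<Sum>l\<le>m. \<Sum>k<l. card (crossing_zeros A B t k l)) + label_pairs \<alpha> m + label_pairs \<beta> m =
      (\<Sum>l = 1..m. (\<Sum>k<l. card (crossing_zeros A B t k l)) + card {k \<in> {1..<l}. \<alpha> k = \<alpha> l} + card {k \<in> {1..<l}. \<beta> k = \<beta> l})"
    unfolding label_pairs_def sum.distrib by simp
  also have "\<dots> = (\<Sum>l = 1..m. 2 * l - 1)"
    by (intro sum.cong refl row) auto
  also have "\<dots> = m * m"
    by (induction m) auto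
  finally have "r = m + (\<Sum>l\<le>m. \<Sum>k<l. card (crossing_zeros A B t k l))"
    using r by simp
  then show ?thesis using mobius_arrangement.ex_has_mldeg_arrangement[OF ma m(2)] by blast
qed

section \<open>Deficits as sums of triangular numbers\<close>

definition label_sums :: "nat \<Rightarrow> nat set" where
  "label_sums m = range (\<lambda>\<alpha>. label_pairs \<alpha> m)"

text \<open>The old labels are shifted by one, which frees the label 0 for a new class of
  \<open>g\<close> indices.\<close>

lemma label_sums_block:
  assumes "x \<in> label_sums m" shows "x + (g choose 2) \<in> label_sums (m + g)"
proof -
  obtain \<alpha> where \<alpha>: "x = label_pairs \<alpha> m" using assms by (auto simp: label_sums_def)
  define \<alpha>' where "\<alpha>' l = (if l \<le> m then Suc (\<alpha> l) else 0)" for l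
  have "label_pairs \<alpha>' (m + g) = label_pairs \<alpha> m + (g choose 2)"
  proof (induction g)
    case 0
    have "{k. 1 \<le> k \<and> k < l \<and> \<alpha>' k = \<alpha>' l} = {k. 1 \<le> k \<and> k < l \<and> \<alpha> k = \<alpha> l}" if "l \<le> m" for l
      using that by (auto simp: \<alpha>'_def)
    then show ?case by (auto simp: label_pairs_def intro!: sum.cong)
  next
    case (Suc g)
    have "{k \<in> {1..<Suc (m + g)}. \<alpha>' k = \<alpha>' (Suc (m + g))} = {Suc m..<Suc (m + g)}"
      by (auto simp: \<alpha>'_def)
    then have "label_pairs \<alpha>' (m + Suc g) = label_pairs \<alpha>' (m + g) + g"
      by (simp add: label_pairs_def)
    then show ?case using Suc by (simp add: numeral_2_eq_2)
  qed
  then show ?thesis unfolding \<alpha> label_sums_def by (metis rangeI)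
qed

lemma label_sums_mono:
  assumes "x \<in> label_sums m" "m \<le> m'" shows "x \<in> label_sums m'"
  using assms(2)
proof (induction m' rule: dec_induct)
  case (step k)
  then show ?case using label_sums_block[of x k 1] by (simp add: numeral_2_eq_2)
qed (rule assms(1))

lemma zero_label_sums: "0 \<in> label_sums m"
  by (rule label_sums_mono[of _ 0]) (auto simp: label_sums_def label_pairs_def)

lemma choose_label_sums: "g \<le> m \<Longrightarrow> (g choose 2) \<in> label_sums m"
  using label_sums_mono[OF label_sums_block[OF zero_label_sums[of 0], of g]] by simp

text \<open>A class of three indices contributes three pairs, so it costs no more indices than it
  yields. The two spare indices cover the start: 1 is one class of two, and 2 is two such
  classes.\<close>

lemma label_sums_small: "x \<in> label_sums (x + 2)"
proof (induction x rule: less_induct)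
  case (less x)
  consider "x = 0" | "x = 1" | "x = 2" | "3 \<le> x" by linarith
  then show ?case
  proof cases
    case 2
    then show ?thesis using choose_label_sums[of 2 3] by (simp add: numeral_3_eq_3)
  next
    case 3
    have "1 \<in> label_sums 2" using choose_label_sums[of 2 2] by simp
    then show ?thesis using label_sums_block[of 1 2 2] 3 by (simp flip: numeral_2_eq_2)
  next
    case 4
    have "x - 3 + (3 choose 2) \<in> label_sums (x - 3 + 2 + 3)"
      using less[of "x - 3"] 4 by (intro label_sums_block) simp
    moreover have "(3::nat) choose 2 = 3" by (simp add: choose_two)
    ultimately show ?thesis using 4 by simp
  qed (simp add: zero_label_sums)
qed

lemma triangular_decomposition: "\<exists>g. (g choose 2) \<le> d \<and> d < (g choose 2) + g"
proof (induction d)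
  case 0
  show ?case by (intro exI[of _ 1]) simp
next
  case (Suc d)
  then obtain g where g: "(g choose 2) \<le> d" "d < (g choose 2) + g" by blast
  show ?case
  proof (cases "Suc d < (g choose 2) + g")
    case True
    then show ?thesis using g by (intro exI[of _ g]) simp
  next
    case False
    then show ?thesis using g by (intro exI[of _ "Suc g"]) (simp add: numeral_2_eq_2)
  qed
qed

text \<open>For \<open>m \<ge> 5\<close> the largest triangular number \<open>g choose 2\<close> up
  to \<open>d\<close> has \<open>g < m\<close>, since \<open>m choose 2\<close> is already at least
  \<open>2 * m\<close>. The remainder is below \<open>g\<close>, hence at most \<open>m - 2\<close>,
  and \<open>label_sums_small\<close> applies. Smaller \<open>m\<close> are checked by hand.\<close>

lemma label_sums_decomposition:
  assumes "1 \<le> m" "d < 2 * m" and ex: "(m, d) \<noteq> (1, 1)" "(m, d) \<noteq> (2, 3)" "(m, d) \<noteq> (3, 5)"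
  shows "\<exists>x\<in>label_sums m. \<exists>y\<in>label_sums m. x + y = d"
proof (cases "5 \<le> m")
  case True
  obtain g where g: "(g choose 2) \<le> d" "d < (g choose 2) + g" using triangular_decomposition by blast
  have "g < m"
  proof (rule ccontr)
    assume "\<not> g < m"
    then have "m * (m - 1) \<le> g * (g - 1)" by (intro mult_le_mono) auto
    then have "m * (m - 1) div 2 \<le> d" using g(1) unfolding choose_two by (meson div_le_mono le_trans)
    moreover have "m * 4 \<le> m * (m - 1)" using True by (intro mult_le_mono) auto
    ultimately show False using assms(2) by linarith
  qed
  then have "(g choose 2) \<in> label_sums m" by (intro choose_label_sums) simp
  moreover have "d - (g choose 2) \<in> label_sums m"
    using g \<open>g < m\<close> by (intro label_sums_mono[OF label_sums_small]) simp
  ultimately show ?thesis using g(1) by (metis le_add_diff_inverse)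
next
  case False
  have c: "(3::nat) choose 2 = 3" "(4::nat) choose 2 = 6" by (simp_all add: choose_two)
  have 1: "1 \<in> label_sums m" if "2 \<le> m" for m using choose_label_sums[OF that] by simp
  have 3: "3 \<in> label_sums m" if "3 \<le> m" for m using choose_label_sums[OF that] c by simp
  have 6: "6 \<in> label_sums m" if "4 \<le> m" for m using choose_label_sums[OF that] c by simp
  have 2: "2 \<in> label_sums 4" using label_sums_small[of 2] by simp
  note 0 = zero_label_sums
  have "m = 1 \<longrightarrow> d \<noteq> 1" "m = 2 \<longrightarrow> d \<noteq> 3" "m = 3 \<longrightarrow> d \<noteq> 5" using ex by auto
  then have "d = 0 \<or> d = 1 \<and> 2 \<le> m \<or> d = 2 \<and> 2 \<le> m \<or> d = 3 \<and> 3 \<le> m \<or> d = 4 \<and> 3 \<le> m \<or>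
      d = 5 \<and> m = 4 \<or> d = 6 \<and> m = 4 \<or> d = 7 \<and> m = 4"
    using False assms(1,2) by presburger
  then consider "d = 0" | "d = 1" "2 \<le> m" | "d = 2" "2 \<le> m" | "d = 3" "3 \<le> m" | "d = 4" "3 \<le> m"
    | "d = 5" "m = 4" | "d = 6" "m = 4" | "d = 7" "m = 4"
    by blast
  then show ?thesis
  proof cases
    case 1 show ?thesis using 1 by (intro bexI[of _ 0] bexI[of _ 0] 0) auto
  next
    case 2 then show ?thesis by (intro bexI[of _ 0] bexI[of _ 1] 0 1) auto
  next
    case 3 then show ?thesis by (intro bexI[of _ 1] bexI[of _ 1] 1) auto
  next
    case 4 then show ?thesis by (intro bexI[of _ 0] bexI[of _ 3] 0 3) auto
  next
    case 5 then show ?thesis by (intro bexI[of _ 1] bexI[of _ 3] 1 3) auto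
  next
    case 6 then show ?thesis using 2 3[of 4] by (intro bexI[of _ 2] bexI[of _ 3]) auto
  next
    case 7 then show ?thesis by (intro bexI[of _ 0] bexI[of _ 6] 0 6) auto
  next
    case 8 then show ?thesis by (intro bexI[of _ 1] bexI[of _ 6] 1 6) auto
  qed
qed

text \<open>With all scalings equal to 1 every curve is \<open>(1 + x) * (1 + y) = 0\<close>. The
  score equations separate and have the closed solution of the independence model.\<close>

lemma ex_has_mldeg_1: "\<exists>W. (\<forall>i\<in>segre_index n. W i \<noteq> 0) \<and> has_mldeg n W 1"
proof (intro exI[of _ "\<lambda>_. 1"] conjI)
  let ?I = "segre_index n" and ?W = "\<lambda>_. 1 :: complex"
  show "\<forall>i\<in>?I. ?W i \<noteq> 0" by simp
  have tot: "margin_total n (data_with_margins 1 1 (\<lambda>k. if k = 0 then 2 else 0)) = 2"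
    by (simp add: margin_total_def margins_data_with_margins)
  have pf: "poly_fun ?I (margin_total n)"
    unfolding margin_total_def[abs_def] by (intro poly_fun_intros poly_fun_margins) auto
  have "generic ?I (\<lambda>v. margin_x n v \<noteq> 0 \<and> margin_y n v \<noteq> 0 \<and> margin_total n v \<noteq> 0 \<and>
      margin_total n v - margin_x n v \<noteq> 0 \<and> margin_total n v - margin_y n v \<noteq> 0)"
  proof (rule generic_conj[OF _ generic_conj[OF _ generic_conj[OF _ generic_conj]]])
    let ?v = "data_with_margins 1 1 (\<lambda>k. if k = 0 then 2 else 0)"
    show "generic ?I (\<lambda>v. margin_x n v \<noteq> 0)" "generic ?I (\<lambda>v. margin_y n v \<noteq> 0)" "generic ?I (\<lambda>v. margin_total n v \<noteq> 0)"
      by (rule generic_nonzero[where v = ?v]; simp add: margins_data_with_margins tot poly_fun_margins pf)+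
    show "generic ?I (\<lambda>v. margin_total n v - margin_x n v \<noteq> 0)"
      by (rule generic_nonzero[where v = ?v and g = "\<lambda>v. margin_total n v - margin_x n v"])
        (auto simp: margins_data_with_margins tot intro!: poly_fun_diff poly_fun_margins pf)
    show "generic ?I (\<lambda>v. margin_total n v - margin_y n v \<noteq> 0)"
      by (rule generic_nonzero[where v = ?v and g = "\<lambda>v. margin_total n v - margin_y n v"])
        (auto simp: margins_data_with_margins tot intro!: poly_fun_diff poly_fun_margins pf)
  qed
  then show "has_mldeg n ?W 1"
  proof (intro has_mldegI, simp, elim generic_mono conjE)
    fix v assume nz: "margin_x n v \<noteq> 0" "margin_y n v \<noteq> 0" "margin_total n v \<noteq> 0"
      "margin_total n v - margin_x n v \<noteq> 0" "margin_total n v - margin_y n v \<noteq> 0"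
    define a b C where "a = margin_x n v" "b = margin_y n v" "C = margin_total n v"
    note abC = this
    have curve: "curve ?W k x y = (1 + x) * (1 + y)" for k x y by (simp add: curve_def algebra_simps)
    have solve: "x * (C / (1 + x)) = a \<longleftrightarrow> x = a / (C - a)" if "1 + x \<noteq> 0" "C - a \<noteq> 0" for x a
    proof -
      have "x * (C / (1 + x)) = a \<longleftrightarrow> x * C = a * (1 + x)" using that by (simp add: field_simps)
      also have "\<dots> \<longleftrightarrow> x * (C - a) = a" by (auto simp: algebra_simps)
      finally show ?thesis using that by (simp add: field_simps)
    qed
    have ne: "1 + a / (C - a) \<noteq> 0" "a / (C - a) \<noteq> 0" if "a \<noteq> 0" "C - a \<noteq> 0" for a
    proof -
      have "1 + a / (C - a) = C / (C - a)" using that by (simp add: field_simps)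
      then show "1 + a / (C - a) \<noteq> 0" "a / (C - a) \<noteq> 0" using that nz by (simp_all add: abC)
    qed
    have sx: "(\<Sum>k = 0..n. margin_z v k * curve_dx ?W k y / curve ?W k x y) = C / (1 + x)"
      "(\<Sum>k = 0..n. margin_z v k * curve_dy ?W k x / curve ?W k x y) = C / (1 + y)"
      if "1 + x \<noteq> 0" "1 + y \<noteq> 0" for x y
      using that unfolding abC margin_total_def sum_divide_distrib
      by (auto simp: curve curve_dx_def curve_dy_def intro!: sum.cong)
    have "score_solutions n ?W a b (margin_z v) = {(a / (C - a), b / (C - b))}"
    proof (intro equalityI subsetI)
      fix p assume "p \<in> score_solutions n ?W a b (margin_z v)"
      then obtain x y where p: "p = (x, y)" "1 + x \<noteq> 0" "1 + y \<noteq> 0"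
        "x * (\<Sum>k = 0..n. margin_z v k * curve_dx ?W k y / curve ?W k x y) = a"
        "y * (\<Sum>k = 0..n. margin_z v k * curve_dy ?W k x / curve ?W k x y) = b"
        by (auto simp: score_solutions_def curve)
      then show "p \<in> {(a / (C - a), b / (C - b))}"
        using solve[of x a] solve[of y b] nz sx[OF p(2,3)] by (simp add: abC)
    next
      fix p assume "p \<in> {(a / (C - a), b / (C - b))}"
      then have p: "p = (a / (C - a), b / (C - b))" by simp
      have ca: "a \<noteq> 0" "C - a \<noteq> 0" "b \<noteq> 0" "C - b \<noteq> 0" using nz by (simp_all add: abC)
      define x y where "x = a / (C - a)" and "y = b / (C - b)"
      have x: "1 + x \<noteq> 0" "x \<noteq> 0" and y: "1 + y \<noteq> 0" "y \<noteq> 0"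
        using ne[OF ca(1,2)] ne[OF ca(3,4)] by (simp_all add: x_def y_def)
      have "x * (C / (1 + x)) = a" "y * (C / (1 + y)) = b"
        using solve[OF x(1) ca(2)] solve[OF y(1) ca(4)] by (simp_all add: x_def y_def)
      then have "(x, y) \<in> score_solutions n ?W a b (margin_z v)"
        unfolding score_solutions_def mem_Collect_eq prod.case sx[OF x(1) y(1)] using x y by (simp add: curve)
      then show "p \<in> score_solutions n ?W a b (margin_z v)"
        unfolding p x_def y_def .
    qed
    then show "finite (score_solutions n ?W (margin_x n v) (margin_y n v) (margin_z v)) \<and>
        card (score_solutions n ?W (margin_x n v) (margin_y n v) (margin_z v)) = 1"
      by (simp add: abC)
  qed
qed

text \<open>
  One reducible curve \<open>p = 0\<close> with \<open>p = (x - 1) * (y - 1)\<close>, and the curve \<open>p = 2\<close>. With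
  \<open>T = c0 / p + c1 / (p - 2)\<close> and \<open>\<tau> = p * T\<close> the score equations read
  \<open>\<tau> + (y - 1) * T = a\<close> and \<open>\<tau> + (x - 1) * T = b\<close>, whence \<open>\<tau>\<^sup>2 = p * (a - \<tau>) * (b - \<tau>)\<close>,
  a cubic equation for \<open>p\<close>.
\<close>

lemma ex_has_mldeg_3:
  assumes n: "1 \<le> n"
  shows "\<exists>W. (\<forall>i\<in>segre_index n. W i \<noteq> 0) \<and> has_mldeg n W 3"
proof -
  let ?I = "segre_index n"
  \<comment> \<open>Index 0 carries \<open>p = (x - 1) * (y - 1)\<close> and every other index
    \<open>p - 2\<close>; the shift by 2 turns the constant coefficient from 1 to -1, so all
    coefficients remain nonzero.\<close>
  define W :: "nat \<times> nat \<times> nat \<Rightarrow> complex" where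
    "W = (\<lambda>(i, j, k). if i = j then (if i = 0 \<and> k \<noteq> 0 then - 1 else 1) else - 1)"
  define c1 where "c1 v = (\<Sum>k = 1..n. margin_z v k)" for v
  \<comment> \<open>The cubic equation cleared of denominators by \<open>(p - 2)\<^sup>2\<close>,
    using that \<open>(p - 2) * \<tau>\<close> is linear in \<open>p\<close>. Here \<open>c1\<close>
    is the total weight of the curve \<open>p = 2\<close>.\<close>
  define F where "F v = [:- 2 * margin_z v 0, margin_z v 0 + c1 v:] * [:- 2 * margin_z v 0, margin_z v 0 + c1 v:] -
    [:0, 1:] * ([:- 2 * (margin_x n v - margin_z v 0), margin_x n v - (margin_z v 0 + c1 v):] *
      [:- 2 * (margin_y n v - margin_z v 0), margin_y n v - (margin_z v 0 + c1 v):])" for v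
  have Fp: "poly (F v) p = ((margin_z v 0 + c1 v) * p - 2 * margin_z v 0)\<^sup>2 -
      p * ((margin_x n v - (margin_z v 0 + c1 v)) * p - 2 * (margin_x n v - margin_z v 0)) *
      ((margin_y n v - (margin_z v 0 + c1 v)) * p - 2 * (margin_y n v - margin_z v 0))" for v p
    by (simp add: F_def power2_eq_square algebra_simps)
  \<comment> \<open>These margins make the cubic \<open>- 4 * p * (p - 4) * (p - 9 / 4)\<close>,
    with three distinct roots.\<close>
  let ?v0 = "data_with_margins 3 3 (\<lambda>k. if k = 1 then 1 else 0)"
  have v0: "margin_x n ?v0 = 3" "margin_y n ?v0 = 3" "margin_z ?v0 0 = 0" "c1 ?v0 = 1"
    using n by (simp_all add: margins_data_with_margins c1_def)
  have pf: "poly_fun ?I (margin_x n)" "poly_fun ?I (margin_y n)" "poly_fun ?I (\<lambda>v. margin_z v 0)" "poly_fun ?I c1"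
    unfolding c1_def[abs_def] by (intro poly_fun_intros poly_fun_margins; simp)+
  have F0: "F ?v0 = Polynomial.smult (- 4) (\<Prod>a\<in>{0, 4, 9 / 4}. [:- a, 1:])"
    by (rule poly_eq_poly_eq_iff[THEN iffD1], rule ext, unfold Fp v0) (simp add: power2_eq_square algebra_simps)
  have "generic ?I (\<lambda>v. degree (F v) = 3 \<and> rsquarefree (F v))"
  proof (rule generic_rsquarefree)
    show "poly_coeffs_fun ?I F"
    proof -
      have "F = (\<lambda>v. [:- 2 * margin_z v 0, margin_z v 0 + c1 v:] * [:- 2 * margin_z v 0, margin_z v 0 + c1 v:] +
        [:0, - 1:] * ([:- 2 * (margin_x n v - margin_z v 0), margin_x n v - (margin_z v 0 + c1 v):] *
          [:- 2 * (margin_y n v - margin_z v 0), margin_y n v - (margin_z v 0 + c1 v):]))"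
        by (rule ext) (simp add: F_def)
      then show ?thesis
        by (simp only:) (intro poly_coeffs_fun_intros poly_fun_intros pf)
    qed
    show "degree (F v) \<le> 3" for v
      by (rule degree_le) (auto simp: F_def coeff_pCons numeral_3_eq_3 split: nat.split)
    show "degree (F ?v0) = 3"
      unfolding F0 by simp
    show "rsquarefree (F ?v0)"
      unfolding F0 by (rule rsquarefree_prod_linear) auto
  qed auto
  moreover have "generic ?I (\<lambda>v. margin_x n v \<noteq> 0)"
    by (rule generic_nonzero[OF pf(1), of ?v0], unfold v0) simp
  moreover have "generic ?I (\<lambda>v. margin_y n v \<noteq> 0)"
    by (rule generic_nonzero[OF pf(2), of ?v0], unfold v0) simp
  moreover have "generic ?I (\<lambda>v. margin_z v 0 \<noteq> 0)"
    by (rule generic_nonzero[OF pf(3), of "data_with_margins 0 0 (\<lambda>_. 1)"]) (simp add: margins_data_with_margins)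
  moreover have "generic ?I (\<lambda>v. c1 v \<noteq> 0)"
    by (rule generic_nonzero[OF pf(4), of ?v0], unfold v0) simp
  ultimately have gen: "generic ?I (\<lambda>v. (degree (F v) = 3 \<and> rsquarefree (F v)) \<and> margin_x n v \<noteq> 0 \<and> margin_y n v \<noteq> 0 \<and>
      margin_z v 0 \<noteq> 0 \<and> c1 v \<noteq> 0)"
    by (rule generic_conj[OF _ generic_conj[OF _ generic_conj[OF _ generic_conj]]])
  have W_nz: "\<forall>i\<in>?I. W i \<noteq> 0" by (auto simp: W_def split: if_splits)
  have "has_mldeg n W 3"
  proof (rule has_mldegI[OF W_nz])
    show "generic ?I (\<lambda>v. finite (score_solutions n W (margin_x n v) (margin_y n v) (margin_z v)) \<and>
        card (score_solutions n W (margin_x n v) (margin_y n v) (margin_z v)) = 3)"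
      using gen
    proof (elim generic_mono conjE)
      fix v assume F: "degree (F v) = 3" "rsquarefree (F v)"
        and nz: "margin_x n v \<noteq> 0" "margin_y n v \<noteq> 0" "margin_z v 0 \<noteq> 0" "c1 v \<noteq> 0"
      define a b c0 where "a = margin_x n v" "b = margin_y n v" "c0 = margin_z v 0"
      note abc = this
      define d where "d = c1 v"
      define T where "T p = c0 / p + d / (p - 2)" for p
      have nz': "a \<noteq> 0" "b \<noteq> 0" "c0 \<noteq> 0" "d \<noteq> 0" using nz by (simp_all add: abc d_def)
      have curve: "curve W k x y = (x - 1) * (y - 1) - (if k = 0 then 0 else 2)" for k x y
        by (auto simp: curve_def W_def algebra_simps)
      have all_curve: "(\<forall>k\<le>n. curve W k x y \<noteq> 0) \<longleftrightarrow> (x - 1) * (y - 1) \<noteq> 0 \<and> (x - 1) * (y - 1) \<noteq> 2" for x y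
      proof
        assume *: "\<forall>k\<le>n. curve W k x y \<noteq> 0"
        show "(x - 1) * (y - 1) \<noteq> 0 \<and> (x - 1) * (y - 1) \<noteq> 2"
          using *[rule_format, of 0] *[rule_format, of 1] n unfolding curve by auto
      qed (auto simp: curve)
      have sums: "(\<Sum>k = 0..n. margin_z v k * curve_dx W k y / curve W k x y) = (y - 1) * T ((x - 1) * (y - 1))"
        "(\<Sum>k = 0..n. margin_z v k * curve_dy W k x / curve W k x y) = (x - 1) * T ((x - 1) * (y - 1))" for x y
      proof -
        have d: "curve_dx W k y = y - 1" "curve_dy W k x = x - 1" for k
          by (simp_all add: curve_dx_def curve_dy_def W_def)
        have *: "(\<Sum>k = 0..n. margin_z v k * q / curve W k x y) = q * T ((x - 1) * (y - 1))" for q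
        proof -
          have "{0..n} = insert 0 {1..n}" by auto
          then have "(\<Sum>k = 0..n. margin_z v k * q / curve W k x y) =
              margin_z v 0 * q / curve W 0 x y + (\<Sum>k = 1..n. margin_z v k * q / curve W k x y)" by simp
          also have "(\<Sum>k = 1..n. margin_z v k * q / curve W k x y) = (\<Sum>k = 1..n. margin_z v k * (q / ((x - 1) * (y - 1) - 2)))"
            by (intro sum.cong) (auto simp: curve)
          also have "\<dots> = d * (q / ((x - 1) * (y - 1) - 2))"
            unfolding d_def c1_def sum_distrib_right ..
          finally show ?thesis by (simp add: T_def curve abc distrib_left mult.commute)
        qed
        show "(\<Sum>k = 0..n. margin_z v k * curve_dx W k y / curve W k x y) = (y - 1) * T ((x - 1) * (y - 1))"
          "(\<Sum>k = 0..n. margin_z v k * curve_dy W k x / curve W k x y) = (x - 1) * T ((x - 1) * (y - 1))"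
          unfolding d * by simp_all
      qed
      let ?Sol = "score_solutions n W a b (margin_z v)"
      have sol_iff: "(x, y) \<in> ?Sol \<longleftrightarrow> x \<noteq> 0 \<and> y \<noteq> 0 \<and> (x - 1) * (y - 1) \<noteq> 0 \<and> (x - 1) * (y - 1) \<noteq> 2 \<and>
          x * ((y - 1) * T ((x - 1) * (y - 1))) = a \<and> y * ((x - 1) * T ((x - 1) * (y - 1))) = b" for x y
        unfolding score_solutions_def by (simp add: all_curve sums)
      have cubic: "poly (F v) p = (p - 2)\<^sup>2 * ((p * T p)\<^sup>2 - p * (a - p * T p) * (b - p * T p))"
        if "p \<noteq> 0" "p \<noteq> 2" for p
      proof -
        have pT: "(p - 2) * (p * T p) = (c0 + d) * p - 2 * c0"
          using that by (simp add: T_def field_simps)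
        have "(p - 2) * (a - p * T p) = (a - (c0 + d)) * p - 2 * (a - c0)" for a
          unfolding right_diff_distrib pT by (simp add: algebra_simps)
        then have "poly (F v) p = ((p - 2) * (p * T p))\<^sup>2 - p * ((p - 2) * (a - p * T p)) * ((p - 2) * (b - p * T p))"
          unfolding Fp pT by (simp add: abc d_def)
        then show ?thesis by (simp add: power2_eq_square algebra_simps)
      qed
      have root_ne: "p \<noteq> 0" "p \<noteq> 2" if "poly (F v) p = 0" for p
      proof -
        have "poly (F v) 0 = 4 * c0\<^sup>2" by (simp add: Fp abc power2_eq_square)
        then show "p \<noteq> 0" using that nz' by auto
        have "poly (F v) 2 = (2 * d)\<^sup>2 - 2 * (- 2 * d) * (- 2 * d)"
          unfolding Fp abc d_def by (simp add: algebra_simps)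
        also have "\<dots> = - 4 * d\<^sup>2" by (simp add: power2_eq_square)
        finally show "p \<noteq> 2" using that nz' by auto
      qed
      have "bij_betw (\<lambda>(x, y). (x - 1) * (y - 1)) ?Sol {p. poly (F v) p = 0}"
      proof (rule bij_betw_byWitness)
        \<comment> \<open>The inverse map: given \<open>p\<close>, the two score equations are
          linear in \<open>x - 1\<close> and \<open>y - 1\<close>.\<close>
        let ?g = "\<lambda>p. (1 + (b - p * T p) / T p, 1 + (a - p * T p) / T p)"
        have sol: "T p \<noteq> 0 \<and> (y - 1) * T p = a - p * T p \<and> (x - 1) * T p = b - p * T p"
          if "(x, y) \<in> ?Sol" "p = (x - 1) * (y - 1)" for x y p
        proof -
          have "x * ((y - 1) * T p) = a" "y * ((x - 1) * T p) = b" using that by (auto simp: sol_iff)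
          moreover have "x * ((y - 1) * T p) = p * T p + (y - 1) * T p" "y * ((x - 1) * T p) = p * T p + (x - 1) * T p"
            unfolding that(2) by (simp_all add: algebra_simps)
          ultimately have *: "p * T p + (y - 1) * T p = a" "p * T p + (x - 1) * T p = b" by metis+
          then have "T p \<noteq> 0" using nz' by auto
          moreover have "(y - 1) * T p = a - p * T p" "(x - 1) * T p = b - p * T p"
            unfolding *[symmetric] by simp_all
          ultimately show ?thesis by blast
        qed
        show "\<forall>q\<in>?Sol. ?g (case q of (x, y) \<Rightarrow> (x - 1) * (y - 1)) = q"
        proof
          fix q assume q: "q \<in> ?Sol"
          obtain x y where xy: "q = (x, y)" by (rule prod.exhaust)
          define p where "p = (x - 1) * (y - 1)"
          have "x - 1 = (b - p * T p) / T p" "y - 1 = (a - p * T p) / T p"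
            using sol[OF q[unfolded xy] p_def] by (simp_all add: eq_divide_eq)
          then have "?g p = (x, y)" by (simp add: algebra_simps)
          then show "?g (case q of (x, y) \<Rightarrow> (x - 1) * (y - 1)) = q" by (simp only: xy prod.case p_def)
        qed
        have g: "?g p \<in> ?Sol \<and> (1 + (b - p * T p) / T p - 1) * (1 + (a - p * T p) / T p - 1) = p"
          if p: "poly (F v) p = 0" for p
        proof -
          note pne = root_ne[OF p]
          have eq: "(p * T p)\<^sup>2 = p * (a - p * T p) * (b - p * T p)"
            using p cubic[OF pne] pne by simp
          have "T p \<noteq> 0"
          proof
            assume "T p = 0"
            then show False using eq pne nz' by simp
          qed
          define X where "X = (b - p * T p) / T p"
          define Y where "Y = (a - p * T p) / T p"
          have XT: "X * T p = b - p * T p" and YT: "Y * T p = a - p * T p"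
            using \<open>T p \<noteq> 0\<close> by (simp_all add: X_def Y_def)
          have "(X * Y) * (p * (T p * T p)) = p * (Y * T p) * (X * T p)" by (simp add: mult_ac)
          also have "\<dots> = p * (p * (T p * T p))" unfolding XT YT eq[symmetric] by (simp add: power2_eq_square mult_ac)
          finally have XY: "X * Y = p" using \<open>T p \<noteq> 0\<close> pne by simp
          have "(1 + X) * (Y * T p) = (X * Y) * T p + Y * T p" "(1 + Y) * (X * T p) = (X * Y) * T p + X * T p"
            by (simp_all add: algebra_simps)
          then have "(1 + X) * (Y * T p) = a" "(1 + Y) * (X * T p) = b"
            unfolding XY XT YT by simp_all
          then have "(1 + X, 1 + Y) \<in> ?Sol"
            using XY pne nz' unfolding sol_iff by auto
          then show ?thesis using XY by (simp add: X_def Y_def)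
        qed
        show "\<forall>p\<in>{p. poly (F v) p = 0}. (case ?g p of (x, y) \<Rightarrow> (x - 1) * (y - 1)) = p"
          using g by auto
        show "?g ` {p. poly (F v) p = 0} \<subseteq> ?Sol" using g by auto
        show "(\<lambda>(x, y). (x - 1) * (y - 1)) ` ?Sol \<subseteq> {p. poly (F v) p = 0}"
        proof clarify
          fix x y assume xy: "(x, y) \<in> ?Sol"
          define p where "p = (x - 1) * (y - 1)"
          have pne: "p \<noteq> 0" "p \<noteq> 2" using xy by (auto simp: sol_iff p_def)
          have "p * (a - p * T p) * (b - p * T p) = p * ((y - 1) * T p) * ((x - 1) * T p)"
            using sol[OF xy p_def] by simp
          also have "\<dots> = (p * T p)\<^sup>2" by (simp add: p_def power2_eq_square mult_ac)
          finally show "poly (F v) ((x - 1) * (y - 1)) = 0"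
            unfolding p_def[symmetric] cubic[OF pne] by simp
        qed
      qed
      then have "card ?Sol = 3" "finite ?Sol"
        using bij_betw_same_card bij_betw_finite card_roots_rsquarefree[OF F(2)] F(1) poly_roots_finite[of "F v"] F(2)
        by (metis, metis rsquarefree_def)
      then show "finite (score_solutions n W (margin_x n v) (margin_y n v) (margin_z v)) \<and>
          card (score_solutions n W (margin_x n v) (margin_y n v) (margin_z v)) = 3"
        by (simp add: abc)
    qed
  qed
  then show ?thesis using W_nz by blast
qed

text \<open>Three curves give 12 collisions. All three pass through \<open>(0, 1)\<close>, which
  removes three; curves 1 and 2 agree at infinity, where both have the value 2, which removes one;
  and curves 2 and 3 are tangent at \<open>x = 0\<close>, both with slope 1, which removes one more.
  The tangency makes the discriminant vanish, so the arrangement is not in general position, but the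
  locale allows any contact order at \<open>x = 0\<close>.\<close>

lemma ex_has_mldeg_7:
  assumes n: "2 \<le> n"
  shows "\<exists>W. (\<forall>i\<in>segre_index n. W i \<noteq> 0) \<and> has_mldeg n W 7"
proof -
  define A :: "nat \<Rightarrow> complex" where "A l = (if l = 0 then 0 else 1)" for l
  define s :: "nat \<Rightarrow> complex" where "s = (\<lambda>_. 5 / 4)(0 := 0, 1 := 6, 2 := 2)"
  define t :: "nat \<Rightarrow> complex" where "t = (\<lambda>_. 1 / 4)(0 := 0, 1 := 3, 2 := 1)"
  define S :: "nat \<Rightarrow> nat \<Rightarrow> complex set" where
    "S k l = (if k = 0 then {- 1 / s l} else if k = 1 \<and> l = 3 then {8 / 9} else {})" for k l
  define \<epsilon> :: "nat \<Rightarrow> nat \<Rightarrow> nat" where "\<epsilon> k l = (if k = 0 then 0 else if k = 2 then 2 else 1)" for k l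
  define \<kappa> :: "nat \<Rightarrow> nat \<Rightarrow> complex" where
    "\<kappa> k l = (if k = 0 then s l else if k = 1 then (if l = 2 then - 2 else 9 / 4) else 3 / 4)" for k l
  have pairs: "(k, l) \<in> {(0, 1), (0, 2), (0, 3), (1, 2), (1, 3), (2, 3)}" if "k < l" "l \<le> 3" for k l :: nat
    using that by auto
  have ma: "mobius_arrangement 3 A s t S \<epsilon> \<kappa>"
  proof
    show "A l \<noteq> 0 \<and> s l \<noteq> 0 \<and> t l \<noteq> 0" if "1 \<le> l" "l \<le> 3" for l
      using that by (auto simp: A_def s_def t_def)
    show "finite (S k l) \<and> 0 \<notin> S k l" if "k < l" "l \<le> 3" for k l
      using pairs[OF that] by (auto simp: S_def s_def)
    show "\<kappa> k l \<noteq> 0" if "k < l" "l \<le> 3" for k l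
      using pairs[OF that] by (auto simp: \<kappa>_def s_def)
    show "(1 + t k * x) * (A l + s l * x) - (1 + t l * x) * (A k + s k * x) =
        \<kappa> k l * x ^ \<epsilon> k l * (\<Prod>\<rho>\<in>S k l. x - \<rho>)" if "k < l" "l \<le> 3" for k l x
      using pairs[OF that]
      by (auto simp: A_def s_def t_def S_def \<epsilon>_def \<kappa>_def algebra_simps diff_divide_distrib add_divide_distrib power2_eq_square)
    have J: "Pole ` {1..3} \<union> (\<lambda>(l, k, \<rho>). Cross k l \<rho>) ` (SIGMA l:{..3}. SIGMA k:{..<l}. S k l) \<subseteq>
      {Pole 1, Pole 2, Pole 3, Cross 0 1 (- 1 / 6), Cross 0 2 (- 1 / 2), Cross 0 3 (- 4 / 5), Cross 1 3 (8 / 9)}"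
    proof
      fix i assume "i \<in> Pole ` {1..3} \<union> (\<lambda>(l, k, \<rho>). Cross k l \<rho>) ` (SIGMA l:{..3}. SIGMA k:{..<l}. S k l)"
      then consider j where "i = Pole j" "1 \<le> j" "j \<le> 3"
        | k l \<rho> where "i = Cross k l \<rho>" "k < l" "l \<le> 3" "\<rho> \<in> S k l"
        by auto
      then show "i \<in> {Pole 1, Pole 2, Pole 3, Cross 0 1 (- 1 / 6), Cross 0 2 (- 1 / 2), Cross 0 3 (- 4 / 5), Cross 1 3 (8 / 9)}"
      proof cases
        case (1 j)
        then have "j \<in> {1, 2, 3}" by auto
        then show ?thesis using 1 by auto
      next
        case (2 k l \<rho>)
        then show ?thesis using pairs[OF 2(2,3)] by (auto simp: S_def s_def)
      qed
    qed
    show "inj_on (\<lambda>i. case i of Pole j \<Rightarrow> - 1 / t j | Cross k l \<rho> \<Rightarrow> \<rho> | CrossZero k l \<Rightarrow> 0)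
        (Pole ` {1..3} \<union> (\<lambda>(l, k, \<rho>). Cross k l \<rho>) ` (SIGMA l:{..3}. SIGMA k:{..<l}. S k l))"
      by (rule inj_on_subset[OF _ J]) (simp add: t_def complex_eq_iff)
  qed (auto simp: A_def s_def t_def)
  have "(\<Sum>l\<le>3. \<Sum>k<l. card (S k l)) = 4"
    by (simp add: S_def numeral_3_eq_3 lessThan_Suc)
  then show ?thesis
    using mobius_arrangement.ex_has_mldeg_arrangement[OF ma, of n 7] n by simp
qed

theorem theorem1p8:
  fixes n r :: nat
  assumes "1 \<le> n" and "1 \<le> r" and "r \<le> (n + 1) * (n + 2)"
  shows "\<exists>W :: nat \<times> nat \<times> nat \<Rightarrow> complex.
           (\<forall>i\<in>segre_index n. W i \<noteq> 0) \<and> has_mldeg n W r"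
proof -
  \<comment> \<open>The least choice keeps the deficit \<open>d\<close> below \<open>2 * m\<close>,
    the distance between \<open>(m - 1) * m\<close> and \<open>m * (m + 1)\<close>.\<close>
  define m where "m = (LEAST m. r \<le> m * (m + 1))"
  have m: "r \<le> m * (m + 1)"
    unfolding m_def by (rule LeastI[of _ r]) simp
  have "1 \<le> m" using m assms(2) by (cases m) auto
  have "(m - 1) * m < r"
    using not_less_Least[of "m - 1" "\<lambda>m. r \<le> m * (m + 1)"] \<open>1 \<le> m\<close> unfolding m_def[symmetric] by simp
  have "m \<le> n + 1"
    unfolding m_def using assms(3) by (intro Least_le) simp
  define d where "d = m * (m + 1) - r"
  obtain m' where m': "m = Suc m'" using \<open>1 \<le> m\<close> by (cases m) auto
  have rd: "r + d = m * (m + 1)" using m by (simp add: d_def)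
  have "d < 2 * m" using rd \<open>(m - 1) * m < r\<close> unfolding m' by simp
  consider "m = 1" "d = 1" | "m = 2" "d = 3" | "m = 3" "d = 5"
    | "(m, d) \<noteq> (1, 1)" "(m, d) \<noteq> (2, 3)" "(m, d) \<noteq> (3, 5)" by blast
  then show ?thesis
  proof cases
    case 1
    then have "r = 1" using rd by simp
    then show ?thesis using ex_has_mldeg_1 by simp
  next
    case 2
    then have "r = 3" using rd by simp
    then show ?thesis using ex_has_mldeg_3[OF assms(1)] by simp
  next
    case 3
    then have "r = 7" "2 \<le> n" using rd \<open>m \<le> n + 1\<close> by simp_all
    then show ?thesis using ex_has_mldeg_7 by simp
  next
    case 4
    then obtain x y where "x \<in> label_sums m" "y \<in> label_sums m" "x + y = d"
      using label_sums_decomposition[OF \<open>1 \<le> m\<close> \<open>d < 2 * m\<close>] by blast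
    then obtain \<alpha> \<beta> where "label_pairs \<alpha> m + label_pairs \<beta> m = d"
      by (auto simp: label_sums_def)
    then show ?thesis
      using rd by (intro ex_has_mldeg_labels[OF \<open>1 \<le> m\<close> \<open>m \<le> n + 1\<close>, of r \<alpha> \<beta>]) simp
  qed
qed

end
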